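(* Let $d\ge 1$, let $\gamma$ be the standard Gaussian measure on $\mathbb{R}^d$, and let $d\nu = h\,d\gamma$ be a centered probability measure on $\mathbb{R}^d$ with smooth density $h$ with respect to $\gamma$. Assume that $\nu$ admits a Stein kernel $\tau_\nu$, and let ${\rm S}(\nu\,|\,\gamma)$ be the associated Stein discrepancy. Then $$ {\rm H}(\nu\,|\,\gamma) \,\le\, \frac12\, {\rm S}^2(\nu\,|\,\gamma)\, \log\bigg(1+\frac{{\rm I}(\nu\,|\,\gamma)}{{\rm S}^2(\nu\,|\,\gamma)}\bigg). $$
   Context: Here $d\gamma(x)=(2\pi)^{-d/2}e^{-|x|^2/2}dx$, with $|\cdot|$ the Euclidean norm. A probability measure $\nu$ is centered if $\int_{\mathbb{R}^d} x_j\,d\nu=0$ for $j=1,\dots,d$. A measurable matrix-valued map $\tau_\nu=(\tau_\nu^{ij})_{1\le i,j\le d}$ on $\mathbb{R}^d$ is a Stein kernel for $\nu$ if $\tau_\nu^{ij}\in L^1(\nu)$ for all $i,j$ and, for every smooth test function $\varphi:\mathbb{R}^d\to\mathbb{R}$ (the coordinate functions $x_i$ and the products $x_ix_j$ being admissible), $$\int_{\mathbb{R}^d} x\cdot\nabla\varphi\,d\nu=\int_{\mathbb{R}^d}\langle\tau_\nu,{\rm Hess}(\varphi)\rangle_{\rm HS}\,d\nu,$$ where $\langle\cdot,\cdot\rangle_{\rm HS}$, $\|\cdot\|_{\rm HS}$ are the Hilbert-Schmidt scalar product and norm on matrices. Without loss of generality $\tau_\nu$ is taken symmetric $\nu$-a.e.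 The Stein discrepancy (computed from the given kernel) is ${\rm S}(\nu|\gamma)=\big(\int_{\mathbb{R}^d}\|\tau_\nu-{\rm Id}\|_{\rm HS}^2\,d\nu\big)^{1/2}\in[0,\infty]$. For $d\nu=h\,d\gamma$, the relative entropy is ${\rm H}(\nu|\gamma)=\int h\log h\,d\gamma$ and the Fisher information is ${\rm I}(\nu|\gamma)=\int\frac{|\nabla h|^2}{h}\,d\gamma$. Conventions: $0\log(1+\frac{s}{0})=0$ and $\infty\log(1+\frac{s}{\infty})=s$ for every $s\in[0,\infty]$, and $r\log(1+\frac{\infty}{r})=\infty$ for every $r\in(0,\infty)$. *)

theory Defs
  imports "HOL-Probability.Probability"
begin

definition gaussian :: "(real ^ 'n) measure" where
  "gaussian = density lborel
     (\<lambda>x. ennreal ((2 * pi) powr (- real CARD('n) / 2) * exp (- (norm x)\<^sup>2 / 2)))"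

definition partial_deriv :: "'n \<Rightarrow> (real ^ 'n \<Rightarrow> real) \<Rightarrow> real ^ 'n \<Rightarrow> real" where
  "partial_deriv i f x = frechet_derivative f (at x) (axis i 1)"

definition gradient :: "(real ^ 'n \<Rightarrow> real) \<Rightarrow> real ^ 'n \<Rightarrow> real ^ 'n" where
  "gradient f x = (\<chi> i. partial_deriv i f x)"

definition hessian :: "(real ^ 'n \<Rightarrow> real) \<Rightarrow> real ^ 'n \<Rightarrow> real ^ 'n ^ 'n" where
  "hessian f x = (\<chi> i j. partial_deriv i (partial_deriv j f) x)"

primrec C_class :: "nat \<Rightarrow> (real ^ 'n \<Rightarrow> real) \<Rightarrow> bool" where
  "C_class 0 f \<longleftrightarrow> continuous_on UNIV f"
| "C_class (Suc k) f \<longleftrightarrow>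
     (\<forall>x. f differentiable (at x)) \<and> (\<forall>i. C_class k (partial_deriv i f))"

definition smooth :: "(real ^ 'n \<Rightarrow> real) \<Rightarrow> bool" where
  "smooth f \<longleftrightarrow> (\<forall>k. C_class k f)"

definition centered :: "(real ^ 'n) measure \<Rightarrow> bool" where
  "centered \<nu> \<longleftrightarrow>
     (\<forall>j. integrable \<nu> (\<lambda>x. x $ j) \<and> (\<integral>x. x $ j \<partial>\<nu>) = 0)"

definition stein_test_function :: "(real ^ 'n \<Rightarrow> real) \<Rightarrow> bool" where
  "stein_test_function \<phi> \<longleftrightarrow>
     (smooth \<phi> \<and> compact (closure {x. \<phi> x \<noteq> 0})) \<or>
     (\<exists>i. \<phi> = (\<lambda>x. x $ i)) \<or> (\<exists>i j. \<phi> = (\<lambda>x. x $ i * x $ j))"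

text \<open>
  On \<^typ>\<open>real ^ 'n ^ 'n\<close> the library inner product and norm are the Hilbert-Schmidt ones.
  The right-hand side of the Stein identity needs no integrability clause: the second
  derivatives of a test function are bounded and the entries of \<open>\<tau>\<close> are integrable.
\<close>

definition stein_kernel ::
  "(real ^ 'n) measure \<Rightarrow> (real ^ 'n \<Rightarrow> real ^ 'n ^ 'n) \<Rightarrow> bool" where
  "stein_kernel \<nu> \<tau> \<longleftrightarrow>
     (\<forall>i j. integrable \<nu> (\<lambda>x. \<tau> x $ i $ j)) \<and>
     (\<forall>\<phi>. stein_test_function \<phi> \<longrightarrow>
        integrable \<nu> (\<lambda>x. x \<bullet> gradient \<phi> x) \<and>
        (\<integral>x. x \<bullet> gradient \<phi> x \<partial>\<nu>) = (\<integral>x. \<tau> x \<bullet> hessian \<phi> x \<partial>\<nu>))"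

definition ennreal_sqrt :: "ennreal \<Rightarrow> ennreal" where
  "ennreal_sqrt a = (if a = \<infinity> then \<infinity> else ennreal (sqrt (enn2real a)))"

lemma ennreal_sqrt_power2: "(ennreal_sqrt a)\<^sup>2 = a"
  by (cases a) (auto simp: ennreal_sqrt_def power2_eq_square ennreal_mult_top simp flip: ennreal_mult)

definition stein_discrepancy ::
  "(real ^ 'n) measure \<Rightarrow> (real ^ 'n \<Rightarrow> real ^ 'n ^ 'n) \<Rightarrow> ennreal" where
  "stein_discrepancy \<nu> \<tau> =
     ennreal_sqrt (\<integral>\<^sup>+x. ennreal ((norm (\<tau> x - mat 1))\<^sup>2) \<partial>\<nu>)"

text \<open>
  The entropy may be infinite, so it is the difference of the integrals of the positive and
  negative parts of \<open>h ln h\<close>.  The negative part is at most \<open>1 / e\<close>, so the difference is never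
  \<open>\<infinity> - \<infinity>\<close>.  Since \<open>ln 0 = 0\<close>, points with \<open>h = 0\<close> contribute 0.
  (\<open>KL_divergence\<close> is a Bochner integral and would be 0 instead of \<open>\<infinity>\<close>.)
\<close>

definition relative_entropy :: "(real ^ 'n \<Rightarrow> real) \<Rightarrow> ereal" where
  "relative_entropy h =
     enn2ereal (\<integral>\<^sup>+x. ennreal (h x * ln (h x)) \<partial>gaussian) -
     enn2ereal (\<integral>\<^sup>+x. ennreal (- (h x * ln (h x))) \<partial>gaussian)"

text \<open>
  At a zero of a smooth \<open>h \<ge> 0\<close> the gradient vanishes too, and the integrand is \<open>0 / 0 = 0\<close>.
\<close>

definition fisher_information :: "(real ^ 'n \<Rightarrow> real) \<Rightarrow> ennreal" where
  "fisher_information h =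
     (\<integral>\<^sup>+x. ennreal ((norm (gradient h x))\<^sup>2 / h x) \<partial>gaussian)"

text \<open>
  The function \<open>r ln (1 + s / r)\<close> for \<open>r, s\<close> in \<open>[0, \<infinity>]\<close>, with value \<open>0\<close> at \<open>r = 0\<close> and \<open>s\<close> at
  \<open>r = \<infinity>\<close> (its limits in \<open>r\<close> for finite \<open>s\<close>), and \<open>\<infinity>\<close> at \<open>s = \<infinity>\<close> when \<open>0 < r < \<infinity>\<close>.
\<close>

definition log_profile :: "ennreal \<Rightarrow> ennreal \<Rightarrow> ennreal" where
  "log_profile r s =
     (if r = 0 then 0
      else if r = \<infinity> then s
      else if s = \<infinity> then \<infinity>
      else ennreal (enn2real r * ln (1 + enn2real s / enn2real r)))"

end

theory Submission
  imports Defs "HOL-Real_Asymp.Real_Asymp"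
begin

text \<open>
  Let \<open>f\<^sub>s\<close> and \<open>q\<^sub>s\<close> be the densities of \<open>\<nu>\<close> and \<open>\<gamma>\<close> after convolution with the centered Gaussian of
  variance \<open>s\<close>. The relative entropy \<open>D s\<close> of \<open>f\<^sub>s\<close> with respect to \<open>q\<^sub>s\<close> tends to \<open>0\<close> as \<open>s\<close> tends
  to \<open>\<infinity>\<close>, dominates \<open>H(\<nu>|\<gamma>)\<close> in the limit \<open>s \<rightarrow> 0\<close> (Fatou), and by de Bruijn's identity satisfies
  \<open>D' s = - R s / (2 (1 + s)\<^sup>2)\<close>, where \<open>R s\<close> is the integral of \<open>|U|\<^sup>2 / f\<^sub>s\<close> for the vector field
  \<open>U = x f\<^sub>s + (1 + s) \<nabla>f\<^sub>s\<close>.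
  Since \<open>U\<close> is the convolution of \<open>\<nabla>h d\<gamma>\<close> with the heat kernel, the Cauchy-Schwarz inequality gives
  \<open>R s \<le> I\<close>. The Stein identity, tested on heat kernels, says that \<open>U\<close> has the same divergence as
  the convolution \<open>V\<close> of \<open>(\<tau> - Id) d\<nu>\<close> with the negative gradient of the heat kernel. As \<open>U / f\<^sub>s\<close> is
  a gradient, the integrals of \<open>|U|\<^sup>2 / f\<^sub>s\<close> and \<open>U \<bullet> V / f\<^sub>s\<close> agree, whence \<open>R s \<le> S\<^sup>2 / s\<close>.
  Integrating the second bound over \<open>s \<ge> S\<^sup>2 / I\<close> and the first one over \<open>s \<le> S\<^sup>2 / I\<close> yields the claim.
\<close>

text \<open>Convolution is the Ornstein-Uhlenbeck flow in other coordinates: scaling by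
  \<open>1 / sqrt (1 + s)\<close> with \<open>s = exp (2 * t) - 1\<close> turns
  \<open>f\<^sub>s\<close> and \<open>q\<^sub>s\<close> into the law at time \<open>t\<close> and
  \<gamma>, and \<open>R s / (1 + s)\<close> into the usual Fisher information. Unscaled, every
  kernel stays explicit. The obstacle is behaviour at infinity: \<open>h\<close> is only smooth, and
  the kernel is only tested on compactly supported functions, coordinates and their products.
  Derivatives are therefore put on the heat kernel where possible. The products of coordinates give
  a finite second moment, which keeps \<open>\<bar>ln f\<^sub>s\<bar>\<close> below a quadratic
  polynomial, so that entropies are finite and dominated convergence applies. The comparison of
  \<open>U\<close> and \<open>V\<close> still needs a cutoff, since the potential of
  \<open>U / f\<^sub>s\<close> grows quadratically while the divergences are merely known to be
  integrable. The time \<open>S\<^sup>2 / I\<close> is where the bounds \<open>I\<close> and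
  \<open>S\<^sup>2 / s\<close> cross. Improper integrals in \<open>s\<close> are avoided:
  \<open>D\<close> is compared with explicit nonnegative functions, and its decay at infinity
  supplies the boundary value.\<close>

section \<open>Differentiation under the integral sign and integration by parts\<close>

text \<open>By the mean value inequality \<open>B\<close> also bounds the difference quotients, so
  dominated convergence applies along every sequence tending to \<open>t0\<close>.\<close>

lemma has_real_derivative_integral:
  fixes f f' :: "real \<Rightarrow> 'a \<Rightarrow> real"
  assumes t0: "t0 \<in> {a<..<b}"
    and int: "\<And>t. t \<in> {a<..<b} \<Longrightarrow> integrable M (f t)"
    and deriv: "\<And>t x. t \<in> {a<..<b} \<Longrightarrow> ((\<lambda>t. f t x) has_real_derivative f' t x) (at t)"
    and bound: "\<And>t x. t \<in> {a<..<b} \<Longrightarrow> \<bar>f' t x\<bar> \<le> B x"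
    and B: "integrable M B"
    and meas: "f' t0 \<in> borel_measurable M"
  shows "((\<lambda>t. \<integral>x. f t x \<partial>M) has_real_derivative (\<integral>x. f' t0 x \<partial>M)) (at t0)"
proof -
  let ?S = "{a<..<b}"
  have lip: "norm (f t x - f t0 x) \<le> B x * norm (t - t0)" if "t \<in> ?S" for t x
    by (rule field_differentiable_bound[where S = ?S and f' = "\<lambda>t. f' t x"])
      (use that t0 bound in \<open>auto intro!: has_field_derivative_at_within deriv\<close>)
  have "((\<lambda>t. ((\<integral>x. f t x \<partial>M) - (\<integral>x. f t0 x \<partial>M)) / (t - t0)) \<longlongrightarrow> (\<integral>x. f' t0 x \<partial>M)) (at t0 within ?S)"
    unfolding tendsto_at_iff_sequentially comp_def
  proof (intro allI impI)
    fix X :: "nat \<Rightarrow> real"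
    assume X: "\<forall>i. X i \<in> ?S - {t0}" and lim: "X \<longlonglongrightarrow> t0"
    have "(\<lambda>i. \<integral>x. (f (X i) x - f t0 x) / (X i - t0) \<partial>M) \<longlonglongrightarrow> (\<integral>x. f' t0 x \<partial>M)"
    proof (rule integral_dominated_convergence[where w = B])
      show "(\<lambda>x. (f (X i) x - f t0 x) / (X i - t0)) \<in> borel_measurable M" for i
        using int[of "X i"] int[OF t0] X by (auto intro!: borel_measurable_divide borel_measurable_diff)
      show "AE x in M. (\<lambda>i. (f (X i) x - f t0 x) / (X i - t0)) \<longlonglongrightarrow> f' t0 x"
      proof (rule AE_I2)
        fix x
        have "((\<lambda>t. (f t x - f t0 x) / (t - t0)) \<longlongrightarrow> f' t0 x) (at t0 within ?S)"
          using has_field_derivative_at_within[OF deriv[OF t0, of x], of ?S]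
          unfolding has_field_derivative_iff .
        then show "(\<lambda>i. (f (X i) x - f t0 x) / (X i - t0)) \<longlonglongrightarrow> f' t0 x"
          unfolding tendsto_at_iff_sequentially comp_def using X lim by blast
      qed
      show "AE x in M. norm ((f (X i) x - f t0 x) / (X i - t0)) \<le> B x" for i
        using lip[of "X i"] X by (auto simp: divide_simps mult.commute)
    qed (use B meas in auto)
    moreover have "(\<integral>x. (f (X i) x - f t0 x) / (X i - t0) \<partial>M) =
        ((\<integral>x. f (X i) x \<partial>M) - (\<integral>x. f t0 x \<partial>M)) / (X i - t0)" for i
      using int[of "X i"] int[OF t0] X by simp
    ultimately show "(\<lambda>i. ((\<integral>x. f (X i) x \<partial>M) - (\<integral>x. f t0 x \<partial>M)) / (X i - t0)) \<longlonglongrightarrow> (\<integral>x. f' t0 x \<partial>M)"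
      by (simp only:)
  qed
  then show ?thesis
    using t0 by (simp add: has_field_derivative_iff at_within_open[of t0 ?S])
qed

lemma
  fixes F :: "'a::euclidean_space \<Rightarrow> real"
  assumes F: "integrable lborel F"
  shows integrable_translation: "integrable lborel (\<lambda>x. F (x + c))"
    and integral_translation: "(\<integral>x. F (x + c) \<partial>lborel) = (\<integral>x. F x \<partial>lborel)"
proof -
  have [measurable]: "F \<in> borel_measurable borel" using F by auto
  have eq: "distr lborel borel ((+) c) = (lborel :: 'a measure)" by (rule lborel_distr_plus)
  show "integrable lborel (\<lambda>x. F (x + c))"
    using F integrable_distr_eq[of "(+) c" lborel borel F] by (simp add: eq add.commute)
  show "(\<integral>x. F (x + c) \<partial>lborel) = (\<integral>x. F x \<partial>lborel)"
    using integral_distr[of "(+) c" lborel borel F] by (simp add: eq add.commute)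
qed

text \<open>A derivative along one direction, at every base point: one-variable calculus and
  differentiation under the integral sign produce it directly, and integration by parts asks for
  nothing more.\<close>

definition has_dderiv :: "('a::real_vector \<Rightarrow> real) \<Rightarrow> 'a \<Rightarrow> ('a \<Rightarrow> real) \<Rightarrow> bool" where
  "has_dderiv F e F' \<longleftrightarrow> (\<forall>x. ((\<lambda>t. F (x + t *\<^sub>R e)) has_real_derivative F' x) (at 0))"

lemma has_dderiv_line:
  assumes "has_dderiv F e F'"
  shows "((\<lambda>t. F (x + t *\<^sub>R e)) has_real_derivative F' (x + t *\<^sub>R e)) (at t)"
proof -
  have "((\<lambda>u. F ((x + t *\<^sub>R e) + u *\<^sub>R e)) has_real_derivative F' (x + t *\<^sub>R e)) (at 0)"
    using assms unfolding has_dderiv_def by blast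
  then have "((\<lambda>u. F (x + (t + u) *\<^sub>R e)) has_real_derivative F' (x + t *\<^sub>R e)) (at 0)"
    by (simp add: scaleR_add_left add.assoc)
  then show ?thesis
    using DERIV_shift[of "\<lambda>v. F (x + v *\<^sub>R e)" "F' (x + t *\<^sub>R e)" 0 t] by (simp add: add.commute)
qed

lemma has_dderiv_mult:
  "has_dderiv F e F' \<Longrightarrow> has_dderiv G e G' \<Longrightarrow> has_dderiv (\<lambda>x. F x * G x) e (\<lambda>x. F' x * G x + F x * G' x)"
  unfolding has_dderiv_def by (auto intro!: derivative_eq_intros)

lemma has_dderiv_add:
  "has_dderiv F e F' \<Longrightarrow> has_dderiv G e G' \<Longrightarrow> has_dderiv (\<lambda>x. F x + G x) e (\<lambda>x. F' x + G' x)"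
  unfolding has_dderiv_def by (auto intro!: derivative_eq_intros)

lemma has_dderiv_sum:
  "(\<And>j. j \<in> A \<Longrightarrow> has_dderiv (F j) e (F' j)) \<Longrightarrow> has_dderiv (\<lambda>x. \<Sum>j\<in>A. F j x) e (\<lambda>x. \<Sum>j\<in>A. F' j x)"
  unfolding has_dderiv_def by (auto intro!: derivative_eq_intros)

lemma has_dderiv_cmult:
  "has_dderiv F e F' \<Longrightarrow> has_dderiv (\<lambda>x. c * F x) e (\<lambda>x. c * F' x)"
  unfolding has_dderiv_def by (auto intro!: derivative_eq_intros)

lemma has_dderiv_compose:
  assumes "has_dderiv F e F'" "\<And>x. (f has_real_derivative f' x) (at (F x))"
  shows "has_dderiv (\<lambda>x. f (F x)) e (\<lambda>x. f' x * F' x)"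
  unfolding has_dderiv_def
proof
  fix x
  show "((\<lambda>t. f (F (x + t *\<^sub>R e))) has_real_derivative f' x * F' x) (at 0)"
    using DERIV_chain2[where f = f and g = "\<lambda>t. F (x + t *\<^sub>R e)" and x = 0, of "f' x" "F' x" UNIV] assms
    unfolding has_dderiv_def by simp
qed

text \<open>The integral of \<open>F (x + e) - F x\<close> vanishes by translation invariance and equals
  the integral of \<open>F'\<close> over \<open>x + t *\<^sub>R e\<close> with \<open>0 \<le> t \<le> 1\<close>.\<close>

lemma integral_dderiv_eq_0:
  fixes F :: "'a::euclidean_space \<Rightarrow> real"
  assumes D: "has_dderiv F e F'" and F: "integrable lborel F" and F': "integrable lborel F'"
  shows "(\<integral>x. F' x \<partial>lborel) = 0"
proof -
  have m[measurable]: "F' \<in> borel_measurable borel" "F \<in> borel_measurable borel" using F F' by auto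
  define G :: "real \<Rightarrow> 'a \<Rightarrow> real" where "G t x = indicator {0..1} t * F' (x + t *\<^sub>R e)" for t x
  have G: "integrable (lborel \<Otimes>\<^sub>M lborel) (case_prod G)"
  proof (rule lborel_pair.Fubini_integrable)
    show "case_prod G \<in> borel_measurable (lborel \<Otimes>\<^sub>M lborel)"
      unfolding G_def[abs_def] by measurable
    have "(\<integral>x. norm (case (t, x) of (t, x) \<Rightarrow> G t x) \<partial>lborel) = indicator {0..1} t * (\<integral>x. \<bar>F' x\<bar> \<partial>lborel)" for t
      using integral_translation[of "\<lambda>x. \<bar>F' x\<bar>" "t *\<^sub>R e"] F' by (simp add: G_def abs_mult)
    then show "integrable lborel (\<lambda>t. \<integral>x. norm (case (t, x) of (t, x) \<Rightarrow> G t x) \<partial>lborel)"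
      by simp
    show "AE t in lborel. integrable lborel (\<lambda>x. case (t, x) of (t, x) \<Rightarrow> G t x)"
      using integrable_translation[OF F'] by (simp add: G_def)
  qed
  have "(\<integral>x. (\<integral>t. G t x \<partial>lborel) \<partial>lborel) = (\<integral>t. (\<integral>x. G t x \<partial>lborel) \<partial>lborel)"
    by (rule lborel_pair.Fubini_integral[OF G])
  also have "(\<lambda>t. \<integral>x. G t x \<partial>lborel) = (\<lambda>t. indicator {0..1} t * (\<integral>x. F' x \<partial>lborel))"
    using integral_translation[OF F'] by (simp add: G_def)
  also have "(\<integral>t. indicator {0..1::real} t * (\<integral>x. F' x \<partial>lborel) \<partial>lborel) = (\<integral>x. F' x \<partial>lborel)"
    by simp
  finally have 1: "(\<integral>x. (\<integral>t. G t x \<partial>lborel) \<partial>lborel) = (\<integral>x. F' x \<partial>lborel)" .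
  \<comment> \<open>Fubini makes the restriction to the line integrable for almost every
    \<open>x\<close>. As \<open>F'\<close> need not be continuous, the fundamental theorem gives a
    gauge integral; it equals the Lebesgue integral for these \<open>x\<close>.\<close>
  have "AE x in lborel. (\<integral>t. G t x \<partial>lborel) = F (x + e) - F x"
    using lborel_pair.AE_integrable_snd[OF G]
  proof eventually_elim
    fix x assume int: "integrable lborel (\<lambda>t. G t x)"
    have "((\<lambda>t. F' (x + t *\<^sub>R e)) has_integral (F (x + 1 *\<^sub>R e) - F (x + 0 *\<^sub>R e))) {0..1}"
    proof (rule fundamental_theorem_of_calculus)
      fix t :: real
      show "((\<lambda>t. F (x + t *\<^sub>R e)) has_vector_derivative F' (x + t *\<^sub>R e)) (at t within {0..1})"
        unfolding has_real_derivative_iff_has_vector_derivative[symmetric]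
        by (rule has_field_derivative_at_within[OF has_dderiv_line[OF D]])
    qed simp
    moreover have "(\<lambda>t. if t \<in> {0..1} then F' (x + t *\<^sub>R e) else 0) = (\<lambda>t. G t x)"
      by (auto simp: G_def)
    ultimately have "((\<lambda>t. G t x) has_integral (F (x + e) - F x)) UNIV"
      using has_integral_restrict_UNIV[of "{0..1}" "\<lambda>t. F' (x + t *\<^sub>R e)"] by simp
    then show "(\<integral>t. G t x \<partial>lborel) = F (x + e) - F x"
      using has_integral_integral_lborel[OF int] has_integral_unique by blast
  qed
  then have "(\<integral>x. (\<integral>t. G t x \<partial>lborel) \<partial>lborel) = (\<integral>x. F (x + e) - F x \<partial>lborel)"
    by (intro integral_cong_AE) (auto simp: G_def)
  also have "\<dots> = 0"
    using integrable_translation[OF F] F integral_translation[OF F] by simp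
  finally show ?thesis using 1 by simp
qed

lemma integral_by_parts_dderiv:
  fixes F G :: "'a::euclidean_space \<Rightarrow> real"
  assumes "has_dderiv F e F'" "has_dderiv G e G'"
    and "integrable lborel (\<lambda>x. F x * G x)"
    and i: "integrable lborel (\<lambda>x. F' x * G x)" "integrable lborel (\<lambda>x. F x * G' x)"
  shows "(\<integral>x. F x * G' x \<partial>lborel) = - (\<integral>x. F' x * G x \<partial>lborel)"
  using integral_dderiv_eq_0[OF has_dderiv_mult[OF assms(1,2)] assms(3)] i by simp

section \<open>The heat kernel\<close>

definition heat :: "real \<Rightarrow> 'a::euclidean_space \<Rightarrow> real" where
  "heat s x = (2 * pi * s) powr (- real DIM('a) / 2) * exp (- (norm x)\<^sup>2 / (2 * s))"

lemma heat_nonneg: "0 \<le> heat s x"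
  by (simp add: heat_def)

lemma heat_pos: "0 < s \<Longrightarrow> 0 < heat s x"
  by (simp add: heat_def)

lemma heat_uminus [simp]: "heat s (- x) = heat s x"
  by (simp add: heat_def)

lemma heat_minus_commute: "heat s (x - y) = heat s (y - x)"
  using heat_uminus[of s "x - y"] by simp

lemma borel_measurable_heat [measurable]: "heat s \<in> borel_measurable borel"
  unfolding heat_def[abs_def] by measurable

lemma heat_le: "0 < s \<Longrightarrow> heat s (x::'a::euclidean_space) \<le> (2 * pi * s) powr (- real DIM('a) / 2)"
  unfolding heat_def by (simp add: mult_left_le)

text \<open>Reduces the total mass to that of the one-dimensional
  \<open>normal_density\<close>.\<close>

lemma heat_eq_prod:
  fixes x :: "'a::euclidean_space"
  assumes s: "0 < s"
  shows "heat s x = (\<Prod>b\<in>Basis. normal_density 0 (sqrt s) (x \<bullet> b))"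
proof -
  have "(\<Prod>b\<in>(Basis::'a set). normal_density 0 (sqrt s) (x \<bullet> b)) =
      (1 / sqrt (2 * pi * s)) ^ DIM('a) * exp (\<Sum>b\<in>(Basis::'a set). - (x \<bullet> b)\<^sup>2 / (2 * s))"
    using s by (simp add: normal_density_def prod_dividef exp_sum power_divide)
  also have "(\<Sum>b\<in>(Basis::'a set). - (x \<bullet> b)\<^sup>2 / (2 * s)) = - (norm x)\<^sup>2 / (2 * s)"
    unfolding power2_norm_eq_inner
    by (subst euclidean_inner[of x x]) (simp add: sum_negf sum_divide_distrib power2_eq_square)
  also have "(1 / sqrt (2 * pi * s)) ^ DIM('a) = (2 * pi * s) powr (- real DIM('a) / 2)"
  proof -
    have "1 / sqrt (2 * pi * s) = (2 * pi * s) powr (- (1 / 2))"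
      using s by (simp add: powr_half_sqrt powr_minus_divide)
    then show ?thesis
      using s by (simp add: powr_powr flip: powr_realpow)
  qed
  finally show ?thesis by (simp add: heat_def)
qed

lemma nn_integral_heat: "0 < s \<Longrightarrow> (\<integral>\<^sup>+x. ennreal (heat s (x::'a::euclidean_space)) \<partial>lborel) = 1"
proof -
  assume s: "0 < s"
  have 1: "(\<integral>\<^sup>+x. ennreal (normal_density 0 (sqrt s) x) \<partial>lborel) = 1"
    using s by (subst nn_integral_eq_integral) auto
  have "(\<integral>\<^sup>+x. ennreal (heat s (x::'a)) \<partial>lborel) =
      (\<integral>\<^sup>+x. (\<Prod>b\<in>(Basis::'a set). ennreal (normal_density 0 (sqrt s) (x \<bullet> b))) \<partial>lborel)"
    using s by (simp add: heat_eq_prod prod_ennreal)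
  also have "\<dots> = 1"
    by (subst nn_integral_lborel_prod) (auto simp: 1)
  finally show ?thesis .
qed

lemma integrable_heat: "0 < s \<Longrightarrow> integrable lborel (heat s :: 'a::euclidean_space \<Rightarrow> real)"
  using nn_integral_heat[of s, where 'a='a] by (intro integrableI_nonneg) (auto simp: heat_nonneg)

lemma integral_heat: "0 < s \<Longrightarrow> (\<integral>x. heat s (x::'a::euclidean_space) \<partial>lborel) = 1"
  using nn_integral_heat[of s, where 'a='a] by (subst integral_eq_nn_integral) (auto simp: heat_nonneg)

text \<open>This class contains the heat kernel and the derivatives of it that are used, is closed
  under sums and factors of quadratic growth, and consists of bounded integrable functions.
  Boundedness makes convolutions exist at every point, integrability makes them integrable.\<close>

definition gauss_dom :: "('a::euclidean_space \<Rightarrow> real) \<Rightarrow> bool" where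
  "gauss_dom K \<longleftrightarrow> K \<in> borel_measurable borel \<and>
     (\<exists>C c. 0 < c \<and> 0 \<le> C \<and> (\<forall>u. \<bar>K u\<bar> \<le> C * exp (- c * (norm u)\<^sup>2)))"

lemma gauss_domI:
  assumes "K \<in> borel_measurable borel" "0 < c" "\<And>u. \<bar>K u\<bar> \<le> C * exp (- c * (norm u)\<^sup>2)"
  shows "gauss_dom K"
proof -
  have "0 \<le> C * exp (- c * (norm (0::'a))\<^sup>2)"
    using assms(3)[of 0] by linarith
  then have "0 \<le> C" by simp
  then show ?thesis using assms unfolding gauss_dom_def by blast
qed

lemma gauss_dom_measurable: "gauss_dom K \<Longrightarrow> K \<in> borel_measurable borel"
  by (simp add: gauss_dom_def)

lemma gauss_dom_heat: "0 < s \<Longrightarrow> gauss_dom (heat s)"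
  by (rule gauss_domI[where c = "1 / (2 * s)" and C = "(2 * pi * s) powr (- real DIM('a) / 2)"])
    (auto simp: heat_def abs_mult)

lemma gauss_dom_cmult: "gauss_dom K \<Longrightarrow> gauss_dom (\<lambda>u. a * K u)"
proof -
  assume "gauss_dom K"
  then obtain C c where c: "0 < c" "0 \<le> C" "\<And>u. \<bar>K u\<bar> \<le> C * exp (- c * (norm u)\<^sup>2)"
    and [measurable]: "K \<in> borel_measurable borel"
    unfolding gauss_dom_def by blast
  show ?thesis
    by (rule gauss_domI[where c = c and C = "\<bar>a\<bar> * C"])
      (use c in \<open>auto simp: abs_mult mult.assoc intro!: mult_left_mono\<close>)
qed

lemma gauss_dom_add: "gauss_dom K \<Longrightarrow> gauss_dom L \<Longrightarrow> gauss_dom (\<lambda>u. K u + L u)"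
proof -
  assume "gauss_dom K" "gauss_dom L"
  then obtain C c D d where c: "0 < c" "0 \<le> C" "\<And>u. \<bar>K u\<bar> \<le> C * exp (- c * (norm u)\<^sup>2)"
    and d: "0 < d" "0 \<le> D" "\<And>u. \<bar>L u\<bar> \<le> D * exp (- d * (norm u)\<^sup>2)"
    and [measurable]: "K \<in> borel_measurable borel" "L \<in> borel_measurable borel"
    unfolding gauss_dom_def by blast
  have "\<bar>K u + L u\<bar> \<le> (C + D) * exp (- min c d * (norm u)\<^sup>2)" for u
  proof -
    have "C * exp (- c * (norm u)\<^sup>2) \<le> C * exp (- min c d * (norm u)\<^sup>2)"
      "D * exp (- d * (norm u)\<^sup>2) \<le> D * exp (- min c d * (norm u)\<^sup>2)"
      using c(2) d(2) by (auto intro!: mult_left_mono mult_right_mono)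
    then show ?thesis using c(3)[of u] d(3)[of u] by (simp add: distrib_right)
  qed
  then show ?thesis
    using c(1) d(1) by (intro gauss_domI[where c = "min c d" and C = "C + D"]) auto
qed

text \<open>Half of the decay rate \<open>c\<close> is spent on absorbing the quadratic
  factor.\<close>

lemma gauss_dom_poly_mult:
  assumes K: "gauss_dom K" and [measurable]: "p \<in> borel_measurable borel"
    and p: "\<And>u. \<bar>p u\<bar> \<le> A * (1 + (norm u)\<^sup>2)"
  shows "gauss_dom (\<lambda>u. p u * K u)"
proof -
  obtain C c where c: "0 < c" "0 \<le> C" "\<And>u. \<bar>K u\<bar> \<le> C * exp (- c * (norm u)\<^sup>2)"
    and [measurable]: "K \<in> borel_measurable borel"
    using K unfolding gauss_dom_def by blast
  have A: "0 \<le> A" using p[of 0] by simp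
  have "\<bar>p u * K u\<bar> \<le> A * (1 + 2 / c) * C * exp (- (c / 2) * (norm u)\<^sup>2)" for u
  proof -
    define r where "r = (norm u)\<^sup>2"
    have r: "0 \<le> r" by (simp add: r_def)
    have "1 + r \<le> (1 + 2 / c) * (1 + c / 2 * r)"
      using c(1) r by (simp add: field_simps)
    also have "\<dots> \<le> (1 + 2 / c) * exp (c / 2 * r)"
      using c(1) by (intro mult_left_mono exp_ge_add_one_self) auto
    finally have *: "1 + r \<le> (1 + 2 / c) * exp (c / 2 * r)" .
    have "\<bar>p u * K u\<bar> \<le> (A * (1 + r)) * (C * exp (- c * r))"
      unfolding abs_mult r_def using p c(3) A by (intro mult_mono) auto
    also have "\<dots> \<le> (A * ((1 + 2 / c) * exp (c / 2 * r))) * (C * exp (- c * r))"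
      using * A c(2) by (intro mult_right_mono mult_left_mono) auto
    also have "\<dots> = A * (1 + 2 / c) * C * (exp (c / 2 * r) * exp (- c * r))"
      by simp
    also have "exp (c / 2 * r) * exp (- c * r) = exp (- (c / 2) * r)"
      unfolding exp_add[symmetric] by (simp add: field_simps)
    finally show ?thesis by (simp add: r_def)
  qed
  then show ?thesis
    using c(1) by (intro gauss_domI[where c = "c / 2" and C = "A * (1 + 2 / c) * C"]) auto
qed

lemma norm_le_one_plus_square: "norm u \<le> 1 + (norm u)\<^sup>2"
proof -
  have "0 \<le> (1 - norm u)\<^sup>2" "0 \<le> norm u" by simp_all
  then show ?thesis unfolding power2_diff one_power2 by linarith
qed

lemma inner_le_one_plus_square: "\<bar>u \<bullet> a\<bar> \<le> norm a * (1 + (norm u)\<^sup>2)"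
proof -
  have "norm a * norm u \<le> norm a * (1 + (norm u)\<^sup>2)"
    by (intro mult_left_mono norm_le_one_plus_square) auto
  with Cauchy_Schwarz_ineq2[of u a] show ?thesis by (simp add: mult.commute)
qed

lemma gauss_dom_inner_mult: "gauss_dom K \<Longrightarrow> gauss_dom (\<lambda>u. (u \<bullet> a) * K u)"
  by (rule gauss_dom_poly_mult[where A = "norm a"]) (auto simp: inner_le_one_plus_square)

lemma gauss_dom_square_mult: "gauss_dom K \<Longrightarrow> gauss_dom (\<lambda>u. (norm u)\<^sup>2 * K u)"
  by (rule gauss_dom_poly_mult[where A = 1]) auto

lemma gauss_dom_bounded:
  assumes "gauss_dom K" obtains B where "0 \<le> B" "\<And>u. \<bar>K u\<bar> \<le> B"
proof -
  obtain C c where c: "0 < c" "0 \<le> C" "\<And>u. \<bar>K u\<bar> \<le> C * exp (- c * (norm u)\<^sup>2)"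
    using assms unfolding gauss_dom_def by blast
  have "\<bar>K u\<bar> \<le> C" for u
    using c(3)[of u] mult_left_le[of "exp (- c * (norm u)\<^sup>2)" C] c(1,2) by auto
  with that c(2) show ?thesis by blast
qed

lemma gauss_dom_integrable:
  fixes K :: "'a::euclidean_space \<Rightarrow> real"
  assumes "gauss_dom K" shows "integrable lborel K"
proof -
  obtain C c where c: "0 < c" "0 \<le> C" "\<And>u. \<bar>K u\<bar> \<le> C * exp (- c * (norm u)\<^sup>2)"
    and [measurable]: "K \<in> borel_measurable borel"
    using assms unfolding gauss_dom_def by blast
  \<comment> \<open>With this variance the dominating Gaussian is a multiple of
    \<open>heat s\<close>.\<close>
  define s where "s = 1 / (2 * c)"
  have s: "0 < s" using c by (simp add: s_def)
  define D where "D = C / (2 * pi * s) powr (- real DIM('a) / 2)"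
  have "C * exp (- c * (norm u)\<^sup>2) = D * heat s u" for u :: 'a
    using s c by (simp add: D_def heat_def s_def)
  then have "\<bar>K u\<bar> \<le> D * heat s u" for u using c(3)[of u] by simp
  then show ?thesis
    using integrable_heat[OF s, where 'a='a]
    by (intro Bochner_Integration.integrable_bound[of lborel "\<lambda>u. D * heat s u" K])
      (auto intro: order_trans[OF _ abs_ge_self])
qed

section \<open>Derivatives and moments of the heat kernel\<close>

definition dheat :: "real \<Rightarrow> 'a \<Rightarrow> 'a::euclidean_space \<Rightarrow> real" where
  "dheat s a u = - ((u \<bullet> a) / s) * heat s u"

definition ddheat :: "real \<Rightarrow> 'a \<Rightarrow> 'a \<Rightarrow> 'a::euclidean_space \<Rightarrow> real" where
  "ddheat s a e u = ((u \<bullet> a) * (u \<bullet> e) / s\<^sup>2 - (e \<bullet> a) / s) * heat s u"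

lemma borel_measurable_dheat [measurable]: "dheat s a \<in> borel_measurable borel"
  unfolding dheat_def[abs_def] by measurable

lemma borel_measurable_ddheat [measurable]: "ddheat s a e \<in> borel_measurable borel"
  unfolding ddheat_def[abs_def] by measurable

lemma norm_add_scaleR_square:
  fixes x e :: "'a::real_inner"
  shows "(norm (x + t *\<^sub>R e))\<^sup>2 = (norm x)\<^sup>2 + 2 * t * (x \<bullet> e) + t\<^sup>2 * (norm e)\<^sup>2"
  unfolding power2_norm_eq_inner
  by (simp add: inner_add_left inner_add_right inner_commute[of e x] power2_eq_square algebra_simps)

lemma has_dderiv_heat:
  assumes "0 < s"
  shows "has_dderiv (heat s) e (dheat s e)"
  unfolding has_dderiv_def dheat_def
proof
  fix x :: 'a
  show "((\<lambda>t. heat s (x + t *\<^sub>R e)) has_real_derivative - ((x \<bullet> e) / s) * heat s x) (at 0)"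
    unfolding heat_def norm_add_scaleR_square using assms
    by (auto intro!: derivative_eq_intros simp: field_simps)
qed

lemma has_dderiv_inner: "has_dderiv (\<lambda>u. u \<bullet> a) e (\<lambda>u. e \<bullet> a)"
  unfolding has_dderiv_def by (auto simp: inner_add_left intro!: derivative_eq_intros)

lemma has_dderiv_dheat:
  assumes "0 < s"
  shows "has_dderiv (dheat s a) e (ddheat s a e)"
proof -
  have "has_dderiv (\<lambda>u. (- 1 / s) * ((u \<bullet> a) * heat s u)) e
     (\<lambda>u. (- 1 / s) * ((e \<bullet> a) * heat s u + (u \<bullet> a) * dheat s e u))"
    by (intro has_dderiv_cmult has_dderiv_mult has_dderiv_heat has_dderiv_inner assms)
  moreover have "(\<lambda>u. (- 1 / s) * ((u \<bullet> a) * heat s u)) = dheat s a"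
    "(\<lambda>u. (- 1 / s) * ((e \<bullet> a) * heat s u + (u \<bullet> a) * dheat s e u)) = ddheat s a e"
    using assms by (auto simp: field_simps power2_eq_square dheat_def ddheat_def fun_eq_iff)
  ultimately show ?thesis by simp
qed

lemma gauss_dom_dheat: "0 < s \<Longrightarrow> gauss_dom (dheat s a)"
  unfolding dheat_def[abs_def] using gauss_dom_cmult[OF gauss_dom_inner_mult[OF gauss_dom_heat[of s], of a], of "- 1 / s"] by simp

lemma gauss_dom_ddheat:
  assumes "0 < s"
  shows "gauss_dom (ddheat s a e)"
proof -
  have "gauss_dom (\<lambda>u. (1 / s\<^sup>2) * ((u \<bullet> a) * ((u \<bullet> e) * heat s u)) + (- (e \<bullet> a) / s) * heat s u)"
    by (intro gauss_dom_add gauss_dom_cmult gauss_dom_inner_mult gauss_dom_heat assms)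
  then show ?thesis unfolding ddheat_def[abs_def] by (simp add: algebra_simps)
qed

text \<open>\<open>dheat s a\<close> is the derivative of an integrable function, so its integral
  vanishes. The second moments below come from \<open>ddheat\<close> in the same way.\<close>

lemma heat_moment1: "0 < s \<Longrightarrow> (\<integral>u. (u \<bullet> a) * heat s u \<partial>lborel) = 0"
proof -
  assume s: "0 < s"
  have "(\<integral>u. dheat s a u \<partial>lborel) = 0"
    using s by (intro integral_dderiv_eq_0[OF has_dderiv_heat] gauss_dom_integrable gauss_dom_dheat integrable_heat)
  moreover have "(\<integral>u. dheat s a u \<partial>lborel) = (\<integral>u. (- 1 / s) * ((u \<bullet> a) * heat s u) \<partial>lborel)"
    by (intro Bochner_Integration.integral_cong) (auto simp: dheat_def)
  ultimately show ?thesis using s by (simp only: integral_mult_right_zero) auto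
qed

lemma heat_moment2: "0 < s \<Longrightarrow> (\<integral>u. (u \<bullet> a) * (u \<bullet> b) * heat s u \<partial>lborel) = s * (a \<bullet> b)"
proof -
  assume s: "0 < s"
  have i: "integrable lborel (\<lambda>u. (u \<bullet> a) * ((u \<bullet> b) * heat s u))"
    by (intro gauss_dom_integrable gauss_dom_inner_mult gauss_dom_heat s)
  have "0 = (\<integral>u. ddheat s a b u \<partial>lborel)"
    using s by (intro integral_dderiv_eq_0[OF has_dderiv_dheat, symmetric] gauss_dom_integrable gauss_dom_dheat gauss_dom_ddheat)
  also have "\<dots> = (\<integral>u. (1 / s\<^sup>2) * ((u \<bullet> a) * ((u \<bullet> b) * heat s u)) - ((b \<bullet> a) / s) * heat s u \<partial>lborel)"
    by (intro Bochner_Integration.integral_cong) (auto simp: algebra_simps ddheat_def)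
  also have "\<dots> = (1 / s\<^sup>2) * (\<integral>u. (u \<bullet> a) * ((u \<bullet> b) * heat s u) \<partial>lborel) - (b \<bullet> a) / s"
    using i integrable_heat[OF s, where 'a='a] integral_heat[OF s, where 'a='a] by simp
  finally show ?thesis using s by (simp add: field_simps power2_eq_square inner_commute mult.assoc)
qed

section \<open>Convolution with a measure\<close>

lemma abs_mult_le_sum_squares: "\<bar>p * q\<bar> \<le> p\<^sup>2 + (q::real)\<^sup>2"
proof -
  have "2 * \<bar>p\<bar> * \<bar>q\<bar> \<le> p\<^sup>2 + q\<^sup>2" using sum_squares_bound[of "\<bar>p\<bar>" "\<bar>q\<bar>"] by simp
  moreover have "0 \<le> \<bar>p\<bar> * \<bar>q\<bar>" by simp
  ultimately show ?thesis unfolding abs_mult by linarith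
qed

text \<open>The integral of \<open>g x * (m x - t)\<^sup>2\<close> is a nonnegative quadratic
  polynomial in \<open>t\<close>; its value at the minimum \<open>t = b / a\<close> is the
  claim.\<close>

lemma weighted_Cauchy_Schwarz:
  fixes g m :: "'a \<Rightarrow> real"
  assumes "\<And>x. 0 \<le> g x" and i: "integrable M g" "integrable M (\<lambda>x. g x * m x)" "integrable M (\<lambda>x. g x * (m x)\<^sup>2)"
  shows "(\<integral>x. g x * m x \<partial>M)\<^sup>2 \<le> (\<integral>x. g x \<partial>M) * (\<integral>x. g x * (m x)\<^sup>2 \<partial>M)"
proof -
  define a b c where "a = (\<integral>x. g x \<partial>M)" and "b = (\<integral>x. g x * m x \<partial>M)" and "c = (\<integral>x. g x * (m x)\<^sup>2 \<partial>M)"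
  have q: "0 \<le> c - 2 * t * b + t\<^sup>2 * a" for t
  proof -
    have "0 \<le> (\<integral>x. g x * (m x - t)\<^sup>2 \<partial>M)"
      using assms(1) by (intro integral_nonneg_AE AE_I2) auto
    also have "(\<lambda>x. g x * (m x - t)\<^sup>2) = (\<lambda>x. g x * (m x)\<^sup>2 - 2 * t * (g x * m x) + t\<^sup>2 * g x)"
      by (auto simp: power2_diff algebra_simps)
    also have "(\<integral>x. g x * (m x)\<^sup>2 - 2 * t * (g x * m x) + t\<^sup>2 * g x \<partial>M) = c - 2 * t * b + t\<^sup>2 * a"
      using i by (simp add: a_def b_def c_def)
    finally show ?thesis .
  qed
  have a: "0 \<le> a" unfolding a_def using assms(1) by (intro integral_nonneg_AE AE_I2) auto
  show ?thesis
  proof (cases "a = 0")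
    case True
    have "b = 0"
    proof (rule ccontr)
      assume b: "b \<noteq> 0"
      \<comment> \<open>For \<open>a = 0\<close> the polynomial is affine, and at this
        \<open>t\<close> it would take the value -1.\<close>
      have "2 * ((c + 1) / (2 * b)) * b = c + 1" using b by simp
      then show False using q[of "(c + 1) / (2 * b)"] True by simp
    qed
    then show ?thesis using True by (simp flip: a_def b_def c_def)
  next
    case False
    with a have "0 < a" by simp
    moreover have "c - 2 * (b / a) * b + (b / a)\<^sup>2 * a = c - b\<^sup>2 / a"
      using False by (simp add: field_simps power2_eq_square)
    ultimately have "b\<^sup>2 / a \<le> c" using q[of "b / a"] by simp
    then have "b\<^sup>2 \<le> a * c" using \<open>0 < a\<close> by (simp add: field_simps)
    then show ?thesis by (simp add: a_def b_def c_def)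
  qed
qed

text \<open>The second moment yields a Gaussian lower bound for the mollified density, hence
  quadratic growth of its logarithm, and lets weights of quadratic growth be integrated against
  it.\<close>

locale finite_second_moment = prob_space \<nu> for \<nu> :: "'a::euclidean_space measure" +
  assumes sets_eq [measurable_cong]: "sets \<nu> = sets borel"
    and integrable_norm_square: "integrable \<nu> (\<lambda>y. (norm y)\<^sup>2)"
begin

text \<open>Convolution of the signed measure \<open>m d\<nu>\<close> with \<open>K\<close>.
  Derivatives in \<open>x\<close> fall on \<open>K\<close> alone, so the weight \<open>m\<close>
  need only be integrable; it will be 1, a coordinate, a logarithmic derivative of \<open>h\<close>
  or an entry of the kernel.\<close>

definition conv :: "('a \<Rightarrow> real) \<Rightarrow> ('a \<Rightarrow> real) \<Rightarrow> 'a \<Rightarrow> real" where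
  "conv m K x = (\<integral>y. m y * K (x - y) \<partial>\<nu>)"

abbreviation "conv1 \<equiv> conv (\<lambda>_. 1)"

lemma integrable_conv_point:
  fixes m K :: "'a \<Rightarrow> real"
  assumes "integrable \<nu> m" "K \<in> borel_measurable borel" "\<And>u. \<bar>K u\<bar> \<le> B"
  shows "integrable \<nu> (\<lambda>y. m y * K (x - y))"
proof (rule Bochner_Integration.integrable_bound[of \<nu> "\<lambda>y. B * \<bar>m y\<bar>"])
  have [measurable]: "m \<in> borel_measurable \<nu>" "K \<in> borel_measurable borel" using assms by auto
  show "integrable \<nu> (\<lambda>y. B * \<bar>m y\<bar>)" using assms by simp
  show "(\<lambda>y. m y * K (x - y)) \<in> borel_measurable \<nu>" by measurable
  show "AE y in \<nu>. norm (m y * K (x - y)) \<le> norm (B * \<bar>m y\<bar>)"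
  proof (rule AE_I2)
    fix y
    have "\<bar>m y\<bar> * \<bar>K (x - y)\<bar> \<le> \<bar>m y\<bar> * B" using assms(3) by (intro mult_left_mono) auto
    also have "\<dots> \<le> \<bar>B * \<bar>m y\<bar>\<bar>" by (simp add: mult.commute)
    finally show "norm (m y * K (x - y)) \<le> norm (B * \<bar>m y\<bar>)" by (simp add: abs_mult)
  qed
qed

lemma integrable_conv_point_gauss:
  "integrable \<nu> m \<Longrightarrow> gauss_dom K \<Longrightarrow> integrable \<nu> (\<lambda>y. m y * K (x - y))"
  by (metis gauss_dom_bounded gauss_dom_measurable integrable_conv_point)

lemma borel_measurable_conv [measurable]:
  assumes [measurable]: "m \<in> borel_measurable borel" "K \<in> borel_measurable borel"
  shows "conv m K \<in> borel_measurable borel"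
  unfolding conv_def[abs_def] by measurable

text \<open>\<open>K'\<close> is bounded, so a multiple of \<open>\<bar>m\<bar>\<close> dominates
  the differentiated integrand.\<close>

lemma has_dderiv_conv:
  assumes m: "integrable \<nu> m" and D: "has_dderiv K e K'" and K: "gauss_dom K" "gauss_dom K'"
  shows "has_dderiv (conv m K) e (conv m K')"
  unfolding has_dderiv_def
proof
  fix x
  obtain B where B: "\<And>u. \<bar>K' u\<bar> \<le> B" by (metis gauss_dom_bounded[OF K(2)])
  have "((\<lambda>t. \<integral>y. m y * K (x + t *\<^sub>R e - y) \<partial>\<nu>) has_real_derivative
      (\<integral>y. m y * K' (x + 0 *\<^sub>R e - y) \<partial>\<nu>)) (at 0)"
  proof (rule has_real_derivative_integral[where a = "-1" and b = 1 and B = "\<lambda>y. B * \<bar>m y\<bar>"])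
    show "integrable \<nu> (\<lambda>y. m y * K (x + t *\<^sub>R e - y))" for t
      by (intro integrable_conv_point_gauss m K)
    show "((\<lambda>t. m y * K (x + t *\<^sub>R e - y)) has_real_derivative m y * K' (x + t *\<^sub>R e - y)) (at t)" for t y
      using DERIV_cmult[OF has_dderiv_line[OF D, of "x - y" t], of "m y"] by (simp add: algebra_simps)
    show "\<bar>m y * K' (x + t *\<^sub>R e - y)\<bar> \<le> B * \<bar>m y\<bar>" for t y
      using mult_right_mono[OF B[of "x + t *\<^sub>R e - y"], of "\<bar>m y\<bar>"] by (simp add: abs_mult mult.commute)
    show "(\<lambda>y. m y * K' (x + 0 *\<^sub>R e - y)) \<in> borel_measurable \<nu>"
      by (rule borel_measurable_integrable) (intro integrable_conv_point_gauss m K)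
  qed (use m in auto)
  then show "((\<lambda>t. conv m K (x + t *\<^sub>R e)) has_real_derivative conv m K' x) (at 0)"
    by (simp add: conv_def)
qed

sublocale pair: pair_sigma_finite "lborel :: 'a measure" \<nu> ..

lemma integrable_pair_conv:
  fixes m K :: "'a \<Rightarrow> real"
  assumes m: "integrable \<nu> m" and K: "integrable lborel K"
  shows "integrable (lborel \<Otimes>\<^sub>M \<nu>) (\<lambda>(x, y). m y * K (x - y))"
proof -
  have [measurable]: "m \<in> borel_measurable borel" "K \<in> borel_measurable borel"
    using m K measurable_cong_sets[OF sets_eq refl] by (auto dest: borel_measurable_integrable)
  interpret sw: pair_sigma_finite \<nu> "lborel :: 'a measure" ..
  have "integrable (\<nu> \<Otimes>\<^sub>M lborel) (\<lambda>(y, x). m y * K (x - y))"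
  proof (rule sw.Fubini_integrable)
    have "(\<integral>x. norm (case (y, x) of (y, x) \<Rightarrow> m y * K (x - y)) \<partial>lborel) = \<bar>m y\<bar> * (\<integral>x. \<bar>K x\<bar> \<partial>lborel)" for y
      using integral_translation[of "\<lambda>x. \<bar>K x\<bar>" "- y"] K by (simp add: abs_mult)
    then show "integrable \<nu> (\<lambda>y. \<integral>x. norm (case (y, x) of (y, x) \<Rightarrow> m y * K (x - y)) \<partial>lborel)"
      using m by simp
    show "AE y in \<nu>. integrable lborel (\<lambda>x. case (y, x) of (y, x) \<Rightarrow> m y * K (x - y))"
      using integrable_translation[OF K, of "- y" for y] by simp
  qed measurable
  then show ?thesis
    using pair.integrable_product_swap_iff[of "\<lambda>(x, y). m y * K (x - y)"] by (simp add: case_prod_beta')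
qed

lemma
  fixes m K :: "'a \<Rightarrow> real"
  assumes m: "integrable \<nu> m" and K: "integrable lborel K"
  shows integrable_conv: "integrable lborel (conv m K)"
    and integral_conv: "(\<integral>x. conv m K x \<partial>lborel) = (\<integral>y. m y \<partial>\<nu>) * (\<integral>u. K u \<partial>lborel)"
proof -
  note int = integrable_pair_conv[OF m K]
  show "integrable lborel (conv m K)"
    using pair.integrable_fst'[OF int] by (simp add: conv_def[abs_def])
  have "(\<integral>x. conv m K x \<partial>lborel) = (\<integral>y. (\<integral>x. m y * K (x - y) \<partial>lborel) \<partial>\<nu>)"
    unfolding conv_def by (rule pair.Fubini_integral[OF int, symmetric])
  also have "(\<lambda>y. \<integral>x. m y * K (x - y) \<partial>lborel) = (\<lambda>y. m y * (\<integral>u. K u \<partial>lborel))"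
    using integral_translation[OF K, of "- y" for y] by simp
  finally show "(\<integral>x. conv m K x \<partial>lborel) = (\<integral>y. m y \<partial>\<nu>) * (\<integral>u. K u \<partial>lborel)" by simp
qed

text \<open>The variables separate by \<open>1 + |x|\<^sup>2 \<le> 2 (1 + |y|\<^sup>2) (1 + |x -
  y|\<^sup>2)\<close>: the factor in \<open>y\<close> is integrable by the second moment, the factor
  in \<open>x - y\<close> is absorbed by the Gaussian decay of \<open>K\<close>.\<close>

lemma
  fixes p :: "'a \<Rightarrow> real"
  assumes K: "gauss_dom K" and [measurable]: "p \<in> borel_measurable borel"
    and p: "\<And>x. \<bar>p x\<bar> \<le> A * (1 + (norm x)\<^sup>2)"
  shows integrable_weight_conv1: "integrable lborel (\<lambda>x. p x * conv1 K x)"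
    and integral_weight_conv1: "(\<integral>x. p x * conv1 K x \<partial>lborel) = (\<integral>y. (\<integral>u. p (u + y) * K u \<partial>lborel) \<partial>\<nu>)"
proof -
  have [measurable]: "K \<in> borel_measurable borel" by (rule gauss_dom_measurable[OF K])
  have A: "0 \<le> A" using p[of 0] by simp
  have g: "gauss_dom (\<lambda>u. (1 + (norm u)\<^sup>2) * K u)"
    by (rule gauss_dom_poly_mult[OF K, where A = 1]) auto
  have int: "integrable (lborel \<Otimes>\<^sub>M \<nu>) (\<lambda>(x, y). p x * K (x - y))"
  proof (rule Bochner_Integration.integrable_bound)
    show "integrable (lborel \<Otimes>\<^sub>M \<nu>) (\<lambda>(x, y). (2 * A * (1 + (norm y)\<^sup>2)) * ((1 + (norm (x - y))\<^sup>2) * K (x - y)))"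
      by (rule integrable_pair_conv) (use integrable_norm_square g in \<open>auto intro: gauss_dom_integrable\<close>)
    show "AE z in lborel \<Otimes>\<^sub>M \<nu>. norm (case z of (x, y) \<Rightarrow> p x * K (x - y)) \<le>
        norm (case z of (x, y) \<Rightarrow> (2 * A * (1 + (norm y)\<^sup>2)) * ((1 + (norm (x - y))\<^sup>2) * K (x - y)))"
    proof (rule AE_I2, clarify)
      fix x y :: 'a
      have "norm x \<le> norm y + norm (x - y)" using norm_triangle_ineq[of y "x - y"] by simp
      then have "(norm x)\<^sup>2 \<le> (norm y + norm (x - y))\<^sup>2" by (intro power_mono) auto
      also have "\<dots> \<le> 2 * (norm y)\<^sup>2 + 2 * (norm (x - y))\<^sup>2"
        using sum_squares_bound[of "norm y" "norm (x - y)"] by (simp add: power2_sum)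
      also have "\<dots> + 1 \<le> 2 * (1 + (norm y)\<^sup>2) * (1 + (norm (x - y))\<^sup>2)"
        by (simp add: algebra_simps)
      finally have "1 + (norm x)\<^sup>2 \<le> 2 * (1 + (norm y)\<^sup>2) * (1 + (norm (x - y))\<^sup>2)" by simp
      then have "A * (1 + (norm x)\<^sup>2) \<le> A * (2 * (1 + (norm y)\<^sup>2) * (1 + (norm (x - y))\<^sup>2))"
        using A by (rule mult_left_mono)
      with p[of x] have "\<bar>p x\<bar> \<le> 2 * A * (1 + (norm y)\<^sup>2) * (1 + (norm (x - y))\<^sup>2)"
        by (simp add: mult_ac)
      then have "\<bar>p x\<bar> * \<bar>K (x - y)\<bar> \<le> 2 * A * (1 + (norm y)\<^sup>2) * (1 + (norm (x - y))\<^sup>2) * \<bar>K (x - y)\<bar>"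
        by (rule mult_right_mono) simp
      then show "norm (p x * K (x - y)) \<le> norm (2 * A * (1 + (norm y)\<^sup>2) * ((1 + (norm (x - y))\<^sup>2) * K (x - y)))"
        using A by (simp add: abs_mult mult.assoc)
    qed
  qed measurable
  show "integrable lborel (\<lambda>x. p x * conv1 K x)"
    using pair.integrable_fst'[OF int] by (simp add: conv_def)
  have "(\<integral>x. p x * conv1 K x \<partial>lborel) = (\<integral>x. (\<integral>y. p x * K (x - y) \<partial>\<nu>) \<partial>lborel)"
    by (simp add: conv_def)
  also have "\<dots> = (\<integral>y. (\<integral>x. p x * K (x - y) \<partial>lborel) \<partial>\<nu>)"
    by (rule pair.Fubini_integral[OF int, symmetric])
  also have "\<dots> = (\<integral>y. (\<integral>u. p (u + y) * K u \<partial>lborel) \<partial>\<nu>)"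
  proof (rule integral_cong_AE)
    show "AE y in \<nu>. (\<integral>x. p x * K (x - y) \<partial>lborel) = (\<integral>u. p (u + y) * K u \<partial>lborel)"
      using pair.AE_integrable_snd[OF int]
    proof eventually_elim
      fix y assume "integrable lborel (\<lambda>x. p x * K (x - y))"
      from integral_translation[OF this, of y]
      show "(\<integral>x. p x * K (x - y) \<partial>lborel) = (\<integral>u. p (u + y) * K u \<partial>lborel)" by simp
    qed
  qed measurable
  finally show "(\<integral>x. p x * conv1 K x \<partial>lborel) = (\<integral>y. (\<integral>u. p (u + y) * K u \<partial>lborel) \<partial>\<nu>)" .
qed

end

section \<open>De Bruijn's identity\<close>

definition theat :: "real \<Rightarrow> 'a::euclidean_space \<Rightarrow> real" where
  "theat s u = ((norm u)\<^sup>2 / s\<^sup>2 - real DIM('a) / s) / 2 * heat s u"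

lemma borel_measurable_theat [measurable]: "theat s \<in> borel_measurable borel"
  unfolding theat_def[abs_def] by measurable

lemma heat_has_time_derivative:
  fixes u :: "'a::euclidean_space"
  assumes "0 < s"
  shows "((\<lambda>s. heat s u) has_real_derivative theat s u) (at s)"
proof -
  define D r where "D = real DIM('a) / 2" and "r = (norm u)\<^sup>2"
  have "((\<lambda>s. (2 * pi * s) powr (- D)) has_real_derivative - D / s * (2 * pi * s) powr (- D)) (at s)"
    using assms by (auto intro!: derivative_eq_intros simp: powr_diff)
  moreover have "((\<lambda>s. exp (- r / (2 * s))) has_real_derivative r / (2 * s\<^sup>2) * exp (- r / (2 * s))) (at s)"
    using assms by (auto intro!: derivative_eq_intros simp: power2_eq_square)
  ultimately have "((\<lambda>s. (2 * pi * s) powr (- D) * exp (- r / (2 * s))) has_real_derivative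
      - D / s * (2 * pi * s) powr (- D) * exp (- r / (2 * s)) +
      r / (2 * s\<^sup>2) * exp (- r / (2 * s)) * (2 * pi * s) powr (- D)) (at s)"
    by (rule DERIV_mult)
  also have "- D / s * (2 * pi * s) powr (- D) * exp (- r / (2 * s)) +
      r / (2 * s\<^sup>2) * exp (- r / (2 * s)) * (2 * pi * s) powr (- D) = theat s u"
    using assms by (simp add: theat_def heat_def D_def r_def field_simps)
  finally show ?thesis by (simp add: heat_def D_def r_def)
qed

text \<open>This is the heat equation. It turns the time derivative of the entropy into spatial
  derivatives, which can be integrated by parts.\<close>

lemma theat_eq_sum_ddheat: "theat s u = (\<Sum>b\<in>Basis. ddheat s b b u) / 2"
proof -
  have "(norm u)\<^sup>2 = (\<Sum>b\<in>Basis. (u \<bullet> b) * (u \<bullet> b))"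
    unfolding power2_norm_eq_inner by (rule euclidean_inner)
  then show ?thesis
    by (simp add: theat_def ddheat_def sum_subtractf flip: sum_distrib_right sum_divide_distrib)
qed

text \<open>A single Gaussian bound for all times in a bounded interval, as differentiation in
  \<open>s\<close> under the integral sign requires.\<close>

lemma theat_dominated:
  assumes "0 < a"
  obtains G :: "'a::euclidean_space \<Rightarrow> real"
  where "gauss_dom G" "\<And>s u. a < s \<Longrightarrow> s < b \<Longrightarrow> \<bar>theat s u\<bar> \<le> G u"
proof -
  define C where "C = (2 * pi * a) powr (- real DIM('a) / 2)"
  \<comment> \<open>The rate \<open>1 / (2 * \<bar>b\<bar> + 1)\<close> lies below
    \<open>1 / (2 * s)\<close> for all \<open>s < b\<close>; the absolute value and the summand 1
    keep it positive for every real \<open>b\<close>.\<close>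
  define G where "G u = ((norm u)\<^sup>2 / a\<^sup>2 + real DIM('a) / a) / 2 * (C * exp (- (1 / (2 * \<bar>b\<bar> + 1)) * (norm u)\<^sup>2))" for u :: 'a
  have g0: "gauss_dom (\<lambda>u::'a. C * exp (- (1 / (2 * \<bar>b\<bar> + 1)) * (norm u)\<^sup>2))"
    by (rule gauss_domI[where c = "1 / (2 * \<bar>b\<bar> + 1)" and C = C]) (auto simp: C_def)
  have "gauss_dom G"
    unfolding G_def[abs_def]
  proof (rule gauss_dom_poly_mult[OF g0, where A = "1 / a\<^sup>2 + real DIM('a) / a"])
    show "\<bar>((norm u)\<^sup>2 / a\<^sup>2 + real DIM('a) / a) / 2\<bar> \<le> (1 / a\<^sup>2 + real DIM('a) / a) * (1 + (norm u)\<^sup>2)" for u :: 'a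
    proof -
      have gen: "\<bar>(X + Y) / 2\<bar> \<le> Z + Y + X + W" if "0 \<le> X" "0 \<le> Y" "0 \<le> Z" "0 \<le> W" for X Y Z W :: real
        using that by simp
      have "\<bar>((norm u)\<^sup>2 / a\<^sup>2 + real DIM('a) / a) / 2\<bar> \<le>
          1 / a\<^sup>2 + real DIM('a) / a + (norm u)\<^sup>2 / a\<^sup>2 + real DIM('a) / a * (norm u)\<^sup>2"
        by (rule gen) (use assms in \<open>auto\<close>)
      moreover have "(1 / a\<^sup>2 + real DIM('a) / a) * (1 + (norm u)\<^sup>2) =
          1 / a\<^sup>2 + real DIM('a) / a + (norm u)\<^sup>2 / a\<^sup>2 + real DIM('a) / a * (norm u)\<^sup>2"
        by (simp add: distrib_left distrib_right)
      ultimately show ?thesis by simp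
    qed
  qed measurable
  moreover have "\<bar>theat s u\<bar> \<le> G u" if s: "a < s" "s < b" for s and u :: 'a
  proof -
    have s0: "0 < s" using assms s by simp
    have "heat s u \<le> C * exp (- (1 / (2 * \<bar>b\<bar> + 1)) * (norm u)\<^sup>2)"
      unfolding heat_def C_def
    proof (rule mult_mono)
      show "(2 * pi * s) powr (- real DIM('a) / 2) \<le> (2 * pi * a) powr (- real DIM('a) / 2)"
        using s assms by (intro powr_mono2') auto
      have "(norm u)\<^sup>2 / (2 * \<bar>b\<bar> + 1) \<le> (norm u)\<^sup>2 / (2 * s)"
        using s s0 by (intro divide_left_mono) auto
      then show "exp (- (norm u)\<^sup>2 / (2 * s)) \<le> exp (- (1 / (2 * \<bar>b\<bar> + 1)) * (norm u)\<^sup>2)"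
        by simp
    qed auto
    moreover have "\<bar>((norm u)\<^sup>2 / s\<^sup>2 - real DIM('a) / s) / 2\<bar> \<le> ((norm u)\<^sup>2 / a\<^sup>2 + real DIM('a) / a) / 2"
    proof -
      have gen: "\<bar>(X - Y) / 2\<bar> \<le> (X' + Y') / 2" if "X \<le> X'" "Y \<le> Y'" "0 \<le> X" "0 \<le> Y" for X Y X' Y' :: real
        using that by argo
      have "(norm u)\<^sup>2 / s\<^sup>2 \<le> (norm u)\<^sup>2 / a\<^sup>2"
        using s assms by (intro divide_left_mono power_mono) auto
      moreover have "real DIM('a) / s \<le> real DIM('a) / a"
        using s assms by (intro divide_left_mono) auto
      moreover have "0 \<le> (norm u)\<^sup>2 / s\<^sup>2" "0 \<le> real DIM('a) / s" using s0 by auto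
      ultimately show ?thesis by (rule gen)
    qed
    ultimately show ?thesis
      unfolding theat_def G_def abs_mult using heat_nonneg[of s u] by (intro mult_mono) auto
  qed
  ultimately show ?thesis using that by blast
qed

section \<open>The mollified density, its logarithm and its entropy\<close>

context finite_second_moment
begin

definition second_moment :: real where "second_moment = (\<integral>y. (norm y)\<^sup>2 \<partial>\<nu>)"

lemma second_moment_nonneg: "0 \<le> second_moment"
  unfolding second_moment_def by (intro integral_nonneg_AE AE_I2) auto

text \<open>The density \<open>f\<^sub>s\<close> of the overview.\<close>

definition flow :: "real \<Rightarrow> 'a \<Rightarrow> real" where "flow s = conv1 (heat s)"

definition dflow :: "real \<Rightarrow> 'a \<Rightarrow> 'a \<Rightarrow> real" where "dflow s e = conv1 (dheat s e)"

lemma borel_measurable_flow [measurable]: "flow s \<in> borel_measurable borel"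
  unfolding flow_def by measurable

lemma borel_measurable_dflow [measurable]: "dflow s e \<in> borel_measurable borel"
  unfolding dflow_def by measurable

lemma integrable_conv1_point:
  assumes "gauss_dom K" shows "integrable \<nu> (\<lambda>y. K (x - y))"
  using integrable_conv_point_gauss[of "\<lambda>_. 1" K x] assms by simp

lemma flow_le: assumes "0 < s" shows "flow s x \<le> (2 * pi * s) powr (- real DIM('a) / 2)"
proof -
  have "flow s x \<le> (\<integral>y. (2 * pi * s) powr (- real DIM('a) / 2) \<partial>\<nu>)"
    unfolding flow_def conv_def
    using assms heat_le[OF assms] integrable_conv1_point[OF gauss_dom_heat[OF assms]] by (intro integral_mono) auto
  then show ?thesis by (simp add: prob_space)
qed

text \<open>Jensen's inequality for \<open>exp\<close>: from
  \<open>|x - y|\<^sup>2 \<le> 2 (|x|\<^sup>2 + |y|\<^sup>2)\<close> the kernel is at least a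
  constant times \<open>exp (- (|x|\<^sup>2 + |y|\<^sup>2) / s)\<close>, and the tangent of
  \<open>exp\<close> at the mean \<open>k\<close> of this exponent is integrated over
  \<open>y\<close>.\<close>

lemma flow_ge:
  assumes s: "0 < s"
  shows "(2 * pi * s) powr (- real DIM('a) / 2) * exp (- ((norm x)\<^sup>2 + second_moment) / s) \<le> flow s x"
proof -
  define c where "c = (2 * pi * s) powr (- real DIM('a) / 2)"
  define k where "k = - ((norm x)\<^sup>2 + second_moment) / s"
  have i: "integrable \<nu> (\<lambda>y. c * exp k * (1 + (- ((norm x)\<^sup>2 + (norm y)\<^sup>2) / s - k)))"
    using integrable_norm_square by (simp add: add_divide_distrib diff_divide_distrib)
  have "c * exp k = (\<integral>y. c * exp k * (1 + (- ((norm x)\<^sup>2 + (norm y)\<^sup>2) / s - k)) \<partial>\<nu>)"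
    using integrable_norm_square s by (simp add: add_divide_distrib diff_divide_distrib prob_space k_def second_moment_def)
  also have "\<dots> \<le> (\<integral>y. heat s (x - y) \<partial>\<nu>)"
  proof (rule integral_mono[OF i integrable_conv1_point[OF gauss_dom_heat[OF s]]])
    fix y
    have "norm (x - y) \<le> norm x + norm y" by (rule norm_triangle_ineq4)
    then have "(norm (x - y))\<^sup>2 \<le> (norm x + norm y)\<^sup>2" by (intro power_mono) auto
    also have "\<dots> \<le> 2 * ((norm x)\<^sup>2 + (norm y)\<^sup>2)"
      using sum_squares_bound[of "norm x" "norm y"] by (simp add: power2_sum)
    finally have "- ((norm x)\<^sup>2 + (norm y)\<^sup>2) / s \<le> - (norm (x - y))\<^sup>2 / (2 * s)"
      using s by (simp add: divide_simps mult_left_mono mult.commute)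
    then have "exp (- ((norm x)\<^sup>2 + (norm y)\<^sup>2) / s) \<le> exp (- (norm (x - y))\<^sup>2 / (2 * s))" by simp
    moreover have "exp k * (1 + (- ((norm x)\<^sup>2 + (norm y)\<^sup>2) / s - k)) \<le> exp k * exp (- ((norm x)\<^sup>2 + (norm y)\<^sup>2) / s - k)"
      by (intro mult_left_mono exp_ge_add_one_self) auto
    moreover have "exp k * exp (- ((norm x)\<^sup>2 + (norm y)\<^sup>2) / s - k) = exp (- ((norm x)\<^sup>2 + (norm y)\<^sup>2) / s)"
      unfolding exp_add[symmetric] by (rule arg_cong) simp
    ultimately have "exp k * (1 + (- ((norm x)\<^sup>2 + (norm y)\<^sup>2) / s - k)) \<le> exp (- (norm (x - y))\<^sup>2 / (2 * s))"
      by linarith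
    then have "c * (exp k * (1 + (- ((norm x)\<^sup>2 + (norm y)\<^sup>2) / s - k))) \<le> c * exp (- (norm (x - y))\<^sup>2 / (2 * s))"
      by (rule mult_left_mono) (simp add: c_def)
    then show "c * exp k * (1 + (- ((norm x)\<^sup>2 + (norm y)\<^sup>2) / s - k)) \<le> heat s (x - y)"
      by (simp add: heat_def c_def mult.assoc)
  qed
  finally show ?thesis by (simp add: flow_def conv_def c_def k_def)
qed

lemma flow_pos: "0 < s \<Longrightarrow> 0 < flow s x"
  by (rule less_le_trans[OF _ flow_ge]) auto

lemma ln_flow_le: assumes "0 < s" shows "ln (flow s x) \<le> - (real DIM('a) / 2) * ln (2 * pi * s)"
proof -
  have "ln (flow s x) \<le> ln ((2 * pi * s) powr (- real DIM('a) / 2))"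
    using flow_le[OF assms] flow_pos[OF assms] assms by (subst ln_le_cancel_iff) auto
  then show ?thesis using assms by (simp only: ln_powr)
qed

lemma ln_flow_ge:
  assumes "0 < s"
  shows "- (real DIM('a) / 2) * ln (2 * pi * s) - ((norm x)\<^sup>2 + second_moment) / s \<le> ln (flow s x)"
proof -
  have "ln ((2 * pi * s) powr (- real DIM('a) / 2) * exp (- ((norm x)\<^sup>2 + second_moment) / s)) \<le> ln (flow s x)"
    using flow_ge[OF assms] flow_pos[OF assms] assms by (subst ln_le_cancel_iff) auto
  then show ?thesis using assms by (subst (asm) ln_mult) (auto simp: ln_powr diff_divide_distrib add_divide_distrib)
qed

text \<open>Uniform in \<open>s\<close> on bounded intervals away from 0, so that it can dominate
  the time derivative of the entropy.\<close>

lemma ln_flow_bound: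
  assumes a: "0 < a"
  obtains A where "0 \<le> A" "\<And>s x. a < s \<Longrightarrow> s < b \<Longrightarrow> \<bar>ln (flow s x)\<bar> \<le> A * (1 + (norm x)\<^sup>2)"
proof
  define A where "A = real DIM('a) / 2 * (\<bar>ln (2 * pi * a)\<bar> + \<bar>ln (2 * pi * b)\<bar>) + (1 + second_moment) / a"
  show "0 \<le> A" using a second_moment_nonneg by (simp add: A_def)
  fix s :: real and x :: 'a assume s: "a < s" "s < b"
  have s0: "0 < s" using a s by simp
  have "ln (2 * pi * a) \<le> ln (2 * pi * s)" "ln (2 * pi * s) \<le> ln (2 * pi * b)"
    using s a by auto
  then have "\<bar>ln (2 * pi * s)\<bar> \<le> \<bar>ln (2 * pi * a)\<bar> + \<bar>ln (2 * pi * b)\<bar>" by linarith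
  then have 1: "\<bar>real DIM('a) / 2 * ln (2 * pi * s)\<bar> \<le> real DIM('a) / 2 * (\<bar>ln (2 * pi * a)\<bar> + \<bar>ln (2 * pi * b)\<bar>)"
    unfolding abs_mult by (simp add: mult_left_mono)
  have "((norm x)\<^sup>2 + second_moment) / s \<le> ((norm x)\<^sup>2 + second_moment) / a"
    using s a second_moment_nonneg by (intro divide_left_mono) auto
  also have "\<dots> \<le> (1 + second_moment) * (1 + (norm x)\<^sup>2) / a"
    using a second_moment_nonneg by (intro divide_right_mono) (auto simp: algebra_simps)
  finally have 2: "((norm x)\<^sup>2 + second_moment) / s \<le> (1 + second_moment) / a * (1 + (norm x)\<^sup>2)" by simp
  have 3: "0 \<le> ((norm x)\<^sup>2 + second_moment) / s" using second_moment_nonneg s0 by simp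
  have "\<bar>ln (flow s x)\<bar> \<le> real DIM('a) / 2 * (\<bar>ln (2 * pi * a)\<bar> + \<bar>ln (2 * pi * b)\<bar>) * 1 + (1 + second_moment) / a * (1 + (norm x)\<^sup>2)"
    using ln_flow_le[OF s0, of x] ln_flow_ge[OF s0, of x] 1 2 3 unfolding mult_minus_left mult_1_right by linarith
  also have "\<dots> \<le> A * (1 + (norm x)\<^sup>2)"
    unfolding A_def distrib_right using a second_moment_nonneg by (intro add_mono mult_left_mono) auto
  finally show "\<bar>ln (flow s x)\<bar> \<le> A * (1 + (norm x)\<^sup>2)" .
qed

lemma ln_flow_bound1:
  assumes "0 < s" obtains A where "0 \<le> A" "\<And>x. \<bar>ln (flow s x)\<bar> \<le> A * (1 + (norm x)\<^sup>2)"
  using ln_flow_bound[of "s / 2" "2 * s"] assms by (metis half_gt_zero field_sum_of_halves less_add_same_cancel1 mult_2)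

lemma has_dderiv_flow: "0 < s \<Longrightarrow> has_dderiv (flow s) e (dflow s e)"
  unfolding flow_def dflow_def by (intro has_dderiv_conv has_dderiv_heat gauss_dom_heat gauss_dom_dheat) auto

lemma has_dderiv_dflow: "0 < s \<Longrightarrow> has_dderiv (dflow s a) e (conv1 (ddheat s a e))"
  unfolding dflow_def by (intro has_dderiv_conv has_dderiv_dheat gauss_dom_ddheat gauss_dom_dheat) auto

lemma has_dderiv_ln_flow: "0 < s \<Longrightarrow> has_dderiv (\<lambda>x. ln (flow s x)) e (\<lambda>x. 1 / flow s x * dflow s e x)"
  by (rule has_dderiv_compose[OF has_dderiv_flow]) (auto intro!: DERIV_ln_divide flow_pos)

lemma integrable_flow: "0 < s \<Longrightarrow> integrable lborel (flow s)"
  unfolding flow_def by (intro integrable_conv integrable_heat) auto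

lemma integral_flow: "0 < s \<Longrightarrow> (\<integral>x. flow s x \<partial>lborel) = 1"
  unfolding flow_def by (subst integral_conv) (auto simp: integral_heat integrable_heat prob_space)

text \<open>Cauchy-Schwarz with weight \<open>heat s (x - y)\<close> bounds the integrand by the
  convolution of \<nu> with \<open>?K\<close>, whatever the regularity of \<nu>.\<close>

lemma integrable_score_square:
  assumes s: "0 < s"
  shows "integrable lborel (\<lambda>x. (dflow s e x)\<^sup>2 / flow s x)"
proof (rule Bochner_Integration.integrable_bound)
  let ?K = "\<lambda>u. (1 / s\<^sup>2) * ((u \<bullet> e) * ((u \<bullet> e) * heat s u))"
  have K: "gauss_dom ?K" by (intro gauss_dom_cmult gauss_dom_inner_mult gauss_dom_heat s)
  show "integrable lborel (conv1 ?K)"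
    by (intro integrable_conv gauss_dom_integrable K) auto
  show "AE x in lborel. norm ((dflow s e x)\<^sup>2 / flow s x) \<le> norm (conv1 ?K x)"
  proof (rule AE_I2)
    fix x
    have "(\<integral>y. heat s (x - y) * (- ((x - y) \<bullet> e) / s) \<partial>\<nu>)\<^sup>2 \<le>
        (\<integral>y. heat s (x - y) \<partial>\<nu>) * (\<integral>y. heat s (x - y) * (- ((x - y) \<bullet> e) / s)\<^sup>2 \<partial>\<nu>)"
    proof (rule weighted_Cauchy_Schwarz)
      show "integrable \<nu> (\<lambda>y. heat s (x - y))" by (intro integrable_conv1_point gauss_dom_heat s)
      show "integrable \<nu> (\<lambda>y. heat s (x - y) * (- ((x - y) \<bullet> e) / s))"
        using integrable_conv1_point[OF gauss_dom_dheat[OF s, of e], of x] by (simp add: dheat_def mult.commute)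
      show "integrable \<nu> (\<lambda>y. heat s (x - y) * (- ((x - y) \<bullet> e) / s)\<^sup>2)"
        using integrable_conv1_point[OF K, of x] by (simp add: power2_eq_square mult_ac)
    qed (rule heat_nonneg)
    also have "(\<lambda>y. heat s (x - y) * (- ((x - y) \<bullet> e) / s)) = (\<lambda>y. dheat s e (x - y))"
      by (auto simp: dheat_def)
    also have "(\<lambda>y. heat s (x - y) * (- ((x - y) \<bullet> e) / s)\<^sup>2) = (\<lambda>y. ?K (x - y))"
      by (auto simp: power2_eq_square mult_ac)
    finally have "(dflow s e x)\<^sup>2 \<le> flow s x * conv1 ?K x"
      by (simp add: dflow_def flow_def conv_def)
    then have "(dflow s e x)\<^sup>2 / flow s x \<le> conv1 ?K x"
      using flow_pos[OF s, of x] by (simp add: field_simps)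
    then show "norm ((dflow s e x)\<^sup>2 / flow s x) \<le> norm (conv1 ?K x)"
      using flow_pos[OF s, of x] by simp
  qed
qed measurable

definition neg_entropy :: "real \<Rightarrow> real" where "neg_entropy s = (\<integral>x. flow s x * ln (flow s x) \<partial>lborel)"

lemma integrable_flow_ln_flow:
  assumes s: "0 < s" shows "integrable lborel (\<lambda>x. flow s x * ln (flow s x))"
proof -
  obtain A where A: "\<And>x. \<bar>ln (flow s x)\<bar> \<le> A * (1 + (norm x)\<^sup>2)" by (metis ln_flow_bound1[OF s])
  have "integrable lborel (\<lambda>x. ln (flow s x) * conv1 (heat s) x)"
    by (rule integrable_weight_conv1[OF gauss_dom_heat[OF s] _ A]) measurable
  then show ?thesis by (simp add: flow_def mult.commute)
qed

lemma flow_has_time_derivative: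
  assumes s: "0 < s"
  shows "((\<lambda>s. flow s x) has_real_derivative conv1 (theat s) x) (at s)"
proof -
  obtain G :: "'a \<Rightarrow> real" where G: "gauss_dom G" "\<And>t u. s / 2 < t \<Longrightarrow> t < 2 * s \<Longrightarrow> \<bar>theat t u\<bar> \<le> G u"
    using theat_dominated[of "s / 2" "2 * s"] s by (metis half_gt_zero)
  have "((\<lambda>t. \<integral>y. 1 * heat t (x - y) \<partial>\<nu>) has_real_derivative (\<integral>y. 1 * theat s (x - y) \<partial>\<nu>)) (at s)"
  proof (rule has_real_derivative_integral[where a = "s / 2" and b = "2 * s" and B = "\<lambda>y. G (x - y)"])
    fix t assume t: "t \<in> {s / 2<..<2 * s}"
    then have t0: "0 < t" using s by auto
    show "integrable \<nu> (\<lambda>y. 1 * heat t (x - y))" using t0 by (simp add: integrable_conv1_point gauss_dom_heat)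
    show "((\<lambda>t. 1 * heat t (x - y)) has_real_derivative 1 * theat t (x - y)) (at t)" for y
      using heat_has_time_derivative[OF t0] by simp
    show "\<bar>1 * theat t (x - y)\<bar> \<le> G (x - y)" for y using G(2) t by auto
  qed (use s G(1) in \<open>auto intro: integrable_conv1_point\<close>)
  then show ?thesis by (simp add: flow_def conv_def)
qed

text \<open>Between the times \<open>s / 2\<close> and \<open>2 * s\<close> the factor
  \<open>ln f + 1\<close> grows at most quadratically and the time derivative of the flow is at most
  \<open>conv1 G\<close>, both uniformly; their product is an integrable bound.\<close>

lemma neg_entropy_has_derivative:
  assumes s: "0 < s"
  shows "(neg_entropy has_real_derivative (\<integral>x. (ln (flow s x) + 1) * conv1 (theat s) x \<partial>lborel)) (at s)"
proof -
  obtain G :: "'a \<Rightarrow> real" where G: "gauss_dom G" "\<And>t u. s / 2 < t \<Longrightarrow> t < 2 * s \<Longrightarrow> \<bar>theat t u\<bar> \<le> G u"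
    using theat_dominated[of "s / 2" "2 * s"] s by (metis half_gt_zero)
  have [measurable]: "G \<in> borel_measurable borel" by (rule gauss_dom_measurable[OF G(1)])
  obtain A where A: "0 \<le> A" "\<And>t x. s / 2 < t \<Longrightarrow> t < 2 * s \<Longrightarrow> \<bar>ln (flow t x)\<bar> \<le> A * (1 + (norm x)\<^sup>2)"
    using ln_flow_bound[of "s / 2" "2 * s"] s by (metis half_gt_zero)
  have "((\<lambda>t. \<integral>x. flow t x * ln (flow t x) \<partial>lborel) has_real_derivative
      (\<integral>x. (ln (flow s x) + 1) * conv1 (theat s) x \<partial>lborel)) (at s)"
  proof (rule has_real_derivative_integral[where a = "s / 2" and b = "2 * s"
        and B = "\<lambda>x. ((A + 1) * (1 + (norm x)\<^sup>2)) * conv1 G x"])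
    show "integrable lborel (\<lambda>x. ((A + 1) * (1 + (norm x)\<^sup>2)) * conv1 G x)"
      by (rule integrable_weight_conv1[OF G(1), where A = "A + 1"]) (use A(1) in \<open>auto simp: abs_mult\<close>)
    fix t assume t: "t \<in> {s / 2<..<2 * s}"
    then have t0: "0 < t" using s by auto
    show "integrable lborel (\<lambda>x. flow t x * ln (flow t x))" by (rule integrable_flow_ln_flow[OF t0])
    fix x :: 'a
    show "((\<lambda>t. flow t x * ln (flow t x)) has_real_derivative (ln (flow t x) + 1) * conv1 (theat t) x) (at t)"
      using flow_pos[OF t0, of x]
      by (auto intro!: derivative_eq_intros flow_has_time_derivative[OF t0] simp: field_simps)
    have "\<bar>conv1 (theat t) x\<bar> \<le> (\<integral>y. \<bar>1 * theat t (x - y)\<bar> \<partial>\<nu>)"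
      unfolding conv_def by (rule integral_abs_bound)
    also have "\<dots> \<le> conv1 G x"
      unfolding conv_def
    proof (rule integral_mono')
      show "integrable \<nu> (\<lambda>y. 1 * G (x - y))" using integrable_conv1_point[OF G(1)] by simp
      show "\<bar>1 * theat t (x - y)\<bar> \<le> 1 * G (x - y)" for y using G(2) t by auto
      then show "0 \<le> 1 * G (x - y)" for y by (meson abs_ge_zero order_trans)
    qed
    finally have 1: "\<bar>conv1 (theat t) x\<bar> \<le> conv1 G x" .
    have "\<bar>ln (flow t x) + 1\<bar> \<le> \<bar>ln (flow t x)\<bar> + 1" by simp
    also have "\<dots> \<le> A * (1 + (norm x)\<^sup>2) + 1" using A(2)[of t x] t by simp
    also have "\<dots> \<le> (A + 1) * (1 + (norm x)\<^sup>2)" by (simp add: distrib_right)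
    finally show "\<bar>(ln (flow t x) + 1) * conv1 (theat t) x\<bar> \<le> (A + 1) * (1 + (norm x)\<^sup>2) * conv1 G x"
      unfolding abs_mult using 1 A(1) by (intro mult_mono) auto
  qed (use s in auto)
  then show ?thesis by (simp add: neg_entropy_def[abs_def])
qed

text \<open>Relative to Lebesgue measure, in contrast to \<open>rel_fisher\<close> below.\<close>

definition fisher :: "real \<Rightarrow> real" where
  "fisher s = (\<Sum>b\<in>Basis. \<integral>x. (dflow s b x)\<^sup>2 / flow s x \<partial>lborel)"

text \<open>After the heat equation, each second derivative is integrated by parts against
  \<open>ln f + 1\<close>, whose derivative is the score \<open>\<partial>f / f\<close>.\<close>

lemma de_Bruijn:
  assumes s: "0 < s"
  shows "(neg_entropy has_real_derivative - fisher s / 2) (at s)"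
proof -
  obtain A where A: "0 \<le> A" "\<And>x. \<bar>ln (flow s x)\<bar> \<le> A * (1 + (norm x)\<^sup>2)" by (metis ln_flow_bound1[OF s])
  have A': "\<bar>ln (flow s x) + 1\<bar> \<le> (A + 1) * (1 + (norm x)\<^sup>2)" for x
  proof -
    have "\<bar>ln (flow s x) + 1\<bar> \<le> \<bar>ln (flow s x)\<bar> + 1" by simp
    also have "\<dots> \<le> A * (1 + (norm x)\<^sup>2) + 1" using A(2)[of x] by simp
    also have "\<dots> \<le> (A + 1) * (1 + (norm x)\<^sup>2)" by (simp add: distrib_right)
    finally show ?thesis .
  qed
  have ibp: "integrable lborel (\<lambda>x. (ln (flow s x) + 1) * conv1 (ddheat s b b) x)"
    "(\<integral>x. (ln (flow s x) + 1) * conv1 (ddheat s b b) x \<partial>lborel) = - (\<integral>x. (dflow s b x)\<^sup>2 / flow s x \<partial>lborel)" for b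
  proof -
    show 1: "integrable lborel (\<lambda>x. (ln (flow s x) + 1) * conv1 (ddheat s b b) x)"
      by (rule integrable_weight_conv1[OF gauss_dom_ddheat[OF s] _ A']) measurable
    have 2: "integrable lborel (\<lambda>x. (ln (flow s x) + 1) * dflow s b x)"
      unfolding dflow_def by (rule integrable_weight_conv1[OF gauss_dom_dheat[OF s] _ A']) measurable
    have eq: "(\<lambda>x. (1 / flow s x * dflow s b x) * dflow s b x) = (\<lambda>x. (dflow s b x)\<^sup>2 / flow s x)"
      by (auto simp: power2_eq_square)
    have D: "has_dderiv (\<lambda>x. ln (flow s x) + 1) b (\<lambda>x. 1 / flow s x * dflow s b x)"
      using has_dderiv_add[OF has_dderiv_ln_flow[OF s, of b], of "\<lambda>_. 1" "\<lambda>_. 0"] by (simp add: has_dderiv_def)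
    show "(\<integral>x. (ln (flow s x) + 1) * conv1 (ddheat s b b) x \<partial>lborel) = - (\<integral>x. (dflow s b x)\<^sup>2 / flow s x \<partial>lborel)"
      using integral_by_parts_dderiv[OF D has_dderiv_dflow[OF s, of b b] 2 _ 1] integrable_score_square[OF s, of b]
      unfolding eq by blast
  qed
  have theat: "conv1 (theat s) x = (\<Sum>b\<in>Basis. conv1 (ddheat s b b) x) / 2" for x
    unfolding conv_def theat_eq_sum_ddheat using integrable_conv1_point[OF gauss_dom_ddheat[OF s]]
    by simp
  have "(\<integral>x. (ln (flow s x) + 1) * conv1 (theat s) x \<partial>lborel) =
      (\<integral>x. (\<Sum>b\<in>Basis. (ln (flow s x) + 1) * conv1 (ddheat s b b) x) / 2 \<partial>lborel)"
    by (simp only: theat sum_distrib_left times_divide_eq_right)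
  also have "\<dots> = - fisher s / 2"
    using ibp by (simp add: fisher_def sum_negf)
  finally show ?thesis using neg_entropy_has_derivative[OF s] by simp
qed

end

section \<open>Relative entropy along the heat flow\<close>

lemma norm_square_eq_sum_inner: "(norm (x::'a::euclidean_space))\<^sup>2 = (\<Sum>b\<in>Basis. (x \<bullet> b)\<^sup>2)"
  unfolding power2_norm_eq_inner by (subst euclidean_inner) (simp add: power2_eq_square)

lemma heat_moment_norm:
  assumes s: "0 < s"
  shows "(\<integral>u. (norm (u::'a::euclidean_space))\<^sup>2 * heat s u \<partial>lborel) = s * real DIM('a)"
proof -
  have i: "integrable lborel (\<lambda>u::'a. (u \<bullet> b) * (u \<bullet> b) * heat s u)" for b
    using gauss_dom_integrable[OF gauss_dom_inner_mult[OF gauss_dom_inner_mult[OF gauss_dom_heat[OF s]]], of b b]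
    by (simp add: mult.assoc)
  have "(\<lambda>u::'a. (norm u)\<^sup>2 * heat s u) = (\<lambda>u. \<Sum>b\<in>Basis. (u \<bullet> b) * (u \<bullet> b) * heat s u)"
    unfolding norm_square_eq_sum_inner by (simp add: sum_distrib_right power2_eq_square)
  then show ?thesis
    using i by (simp add: heat_moment2[OF s])
qed

text \<open>Convexity of \<open>t ln t\<close>: its graph lies above the tangent at
  \<open>a\<close>. This is the source of both Jensen's inequality and the nonnegativity of relative
  entropy below.\<close>

lemma xlnx_tangent:
  fixes a b :: real
  assumes "0 < a" "0 < b"
  shows "a * ln a + (1 + ln a) * (b - a) \<le> b * ln b"
proof -
  have "ln (a / b) \<le> a / b - 1" using assms by (intro ln_le_minus_one) auto
  then have "b * (ln a - ln b) \<le> b * (a / b - 1)"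
    using assms by (intro mult_left_mono) (auto simp: ln_div)
  then show ?thesis using assms by (simp add: algebra_simps)
qed

context finite_second_moment
begin

text \<open>The component along \<open>b\<close> of the field \<open>U\<close> of the overview.
  Divided by \<open>flow s\<close> it is \<open>1 + s\<close> times the derivative of
  \<open>ln (f\<^sub>s / q\<^sub>s)\<close>.\<close>

definition rel_score :: "real \<Rightarrow> 'a \<Rightarrow> 'a \<Rightarrow> real" where
  "rel_score s b x = (x \<bullet> b) * flow s x + (1 + s) * dflow s b x"

text \<open>\<open>R s\<close> of the overview, that is \<open>(1 + s)\<^sup>2\<close> times the
  Fisher information of \<open>f\<^sub>s\<close> relative to \<open>q\<^sub>s\<close>. In this
  scaling the bound by \<open>I\<close> is free of \<open>s\<close>.\<close>

definition rel_fisher :: "real \<Rightarrow> real" where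
  "rel_fisher s = (\<Sum>b\<in>Basis. \<integral>x. (rel_score s b x)\<^sup>2 / flow s x \<partial>lborel)"

text \<open>\<open>D s\<close> of the overview with the integral of
  \<open>f\<^sub>s ln q\<^sub>s\<close> already evaluated: the last numerator is the second moment
  of \<open>f\<^sub>s\<close>. The formula as an integral is
  \<open>integral_rel_entropy\<close>.\<close>

definition rel_entropy :: "real \<Rightarrow> real" where
  "rel_entropy s = neg_entropy s + real DIM('a) / 2 * ln (2 * pi * (1 + s)) + (second_moment + real DIM('a) * s) / (2 * (1 + s))"

lemma borel_measurable_rel_score [measurable]: "rel_score s b \<in> borel_measurable borel"
  unfolding rel_score_def[abs_def] by measurable

lemma integrable_weight_flow:
  assumes "0 < s" "p \<in> borel_measurable borel" "\<And>x. \<bar>p x\<bar> \<le> A * (1 + (norm x)\<^sup>2)"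
  shows "integrable lborel (\<lambda>x. p x * flow s x)"
  unfolding flow_def using integrable_weight_conv1[OF gauss_dom_heat[OF assms(1)] assms(2,3)] .

lemma integrable_weight_dflow:
  assumes "0 < s" "p \<in> borel_measurable borel" "\<And>x. \<bar>p x\<bar> \<le> A * (1 + (norm x)\<^sup>2)"
  shows "integrable lborel (\<lambda>x. p x * dflow s b x)"
  unfolding dflow_def using integrable_weight_conv1[OF gauss_dom_dheat[OF assms(1)] assms(2,3)] .

lemma integrable_norm_square_flow: "0 < s \<Longrightarrow> integrable lborel (\<lambda>x. (norm x)\<^sup>2 * flow s x)"
  by (rule integrable_weight_flow[where A = 1]) auto

lemma integrable_inner_square_flow: 
  assumes "0 < s" shows "integrable lborel (\<lambda>x. (x \<bullet> b)\<^sup>2 * flow s x)"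
proof (rule integrable_weight_flow[OF assms, where A = "(norm b)\<^sup>2"])
  fix x
  have "(x \<bullet> b)\<^sup>2 \<le> (norm x * norm b)\<^sup>2"
    using Cauchy_Schwarz_ineq2[of x b] by (metis abs_ge_zero power2_abs power_mono)
  then show "\<bar>(x \<bullet> b)\<^sup>2\<bar> \<le> (norm b)\<^sup>2 * (1 + (norm x)\<^sup>2)"
    by (simp add: power_mult_distrib algebra_simps add_increasing)
qed measurable

lemma integral_norm_square_flow:
  assumes s: "0 < s"
  shows "(\<integral>x. (norm x)\<^sup>2 * flow s x \<partial>lborel) = second_moment + real DIM('a) * s"
proof -
  have g: "gauss_dom (heat s :: 'a \<Rightarrow> real)" by (rule gauss_dom_heat[OF s])
  have i1: "integrable lborel (\<lambda>u::'a. (norm u)\<^sup>2 * heat s u)"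
    by (intro gauss_dom_integrable gauss_dom_square_mult g)
  have i2: "integrable lborel (\<lambda>u. (u \<bullet> y) * heat s u)" for y :: 'a
    by (intro gauss_dom_integrable gauss_dom_inner_mult g)
  have "(\<integral>x. (norm x)\<^sup>2 * flow s x \<partial>lborel) = (\<integral>y. (\<integral>u. (norm (u + y))\<^sup>2 * heat s u \<partial>lborel) \<partial>\<nu>)"
    unfolding flow_def by (rule integral_weight_conv1[OF g, where A = 1]) auto
  also have "(\<lambda>y::'a. \<integral>u. (norm (u + y))\<^sup>2 * heat s u \<partial>lborel) = (\<lambda>y. s * real DIM('a) + (norm y)\<^sup>2)"
  proof (rule ext)
    fix y :: 'a
    have "(\<integral>u. (norm (u + y))\<^sup>2 * heat s u \<partial>lborel) =
        (\<integral>u. (norm u)\<^sup>2 * heat s u + 2 * ((u \<bullet> y) * heat s u) + (norm y)\<^sup>2 * heat s u \<partial>lborel)"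
    proof (intro Bochner_Integration.integral_cong refl)
      fix u :: 'a
      have "(norm (u + y))\<^sup>2 = (norm u)\<^sup>2 + 2 * (u \<bullet> y) + (norm y)\<^sup>2"
        unfolding power2_norm_eq_inner by (simp add: inner_add_left inner_add_right inner_commute[of y u])
      then show "(norm (u + y))\<^sup>2 * heat s u = (norm u)\<^sup>2 * heat s u + 2 * ((u \<bullet> y) * heat s u) + (norm y)\<^sup>2 * heat s u"
        by (simp only: distrib_right mult.assoc)
    qed
    also have "\<dots> = s * real DIM('a) + (norm y)\<^sup>2"
      using i1 i2[of y] integrable_heat[OF s, where 'a='a] heat_moment1[OF s, of y]
      by (simp add: heat_moment_norm[OF s] integral_heat[OF s])
    finally show "(\<integral>u. (norm (u + y))\<^sup>2 * heat s u \<partial>lborel) = s * real DIM('a) + (norm y)\<^sup>2" .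
  qed
  also have "(\<integral>y. s * real DIM('a) + (norm y)\<^sup>2 \<partial>\<nu>) = second_moment + real DIM('a) * s"
    using integrable_norm_square by (simp add: prob_space second_moment_def)
  finally show ?thesis .
qed

lemma integral_inner_dflow:
  assumes s: "0 < s" and b: "b \<in> Basis"
  shows "(\<integral>x. (x \<bullet> b) * dflow s b x \<partial>lborel) = - 1"
proof -
  have "(\<integral>x. (x \<bullet> b) * dflow s b x \<partial>lborel) = - (\<integral>x. (b \<bullet> b) * flow s x \<partial>lborel)"
  proof (rule integral_by_parts_dderiv[OF has_dderiv_inner has_dderiv_flow[OF s]])
    show "integrable lborel (\<lambda>x. (x \<bullet> b) * flow s x)"
      by (rule integrable_weight_flow[OF s _ inner_le_one_plus_square]) measurable
    show "integrable lborel (\<lambda>x. (x \<bullet> b) * dflow s b x)"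
      by (rule integrable_weight_dflow[OF s _ inner_le_one_plus_square]) measurable
  qed (use integrable_flow[OF s] in simp)
  then show ?thesis using b integral_flow[OF s] by (simp add: inner_same_Basis)
qed

lemma rel_score_square_expand:
  "0 < s \<Longrightarrow> (rel_score s b x)\<^sup>2 / flow s x =
    (x \<bullet> b)\<^sup>2 * flow s x + 2 * (1 + s) * ((x \<bullet> b) * dflow s b x) + (1 + s)\<^sup>2 * ((dflow s b x)\<^sup>2 / flow s x)"
  using flow_pos[of s x] by (simp add: rel_score_def field_simps power2_eq_square)

lemma integrable_inner_dflow: "0 < s \<Longrightarrow> integrable lborel (\<lambda>x. (x \<bullet> a) * dflow s b x)"
  by (rule integrable_weight_dflow[OF _ _ inner_le_one_plus_square]) measurable

lemma integrable_rel_score_square: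
  "0 < s \<Longrightarrow> integrable lborel (\<lambda>x. (rel_score s b x)\<^sup>2 / flow s x)"
  unfolding rel_score_square_expand
  by (intro Bochner_Integration.integrable_add integrable_mult_right integrable_inner_square_flow
      integrable_inner_dflow integrable_score_square)

text \<open>Expanding the square leaves a cross term, which integration by parts evaluates to -1 in
  each direction.\<close>

lemma rel_fisher_eq:
  assumes s: "0 < s"
  shows "rel_fisher s = second_moment + real DIM('a) * s - 2 * (1 + s) * real DIM('a) + (1 + s)\<^sup>2 * fisher s"
proof -
  have "rel_fisher s = (\<Sum>b\<in>Basis. (\<integral>x. (x \<bullet> b)\<^sup>2 * flow s x \<partial>lborel) - 2 * (1 + s) +
      (1 + s)\<^sup>2 * (\<integral>x. (dflow s b x)\<^sup>2 / flow s x \<partial>lborel))"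
    unfolding rel_fisher_def
  proof (intro sum.cong refl)
    fix b :: 'a assume b: "b \<in> Basis"
    have "(\<integral>x. A x + p * B x + q * C x \<partial>lborel) = (\<integral>x. A x \<partial>lborel) + p * (\<integral>x. B x \<partial>lborel) + q * (\<integral>x. C x \<partial>lborel)"
      if "integrable lborel A" "integrable lborel B" "integrable lborel C" for A B C :: "'a \<Rightarrow> real" and p q
      using that by simp
    from this[OF integrable_inner_square_flow[OF s] integrable_inner_dflow[OF s] integrable_score_square[OF s]]
    show "(\<integral>x. (rel_score s b x)\<^sup>2 / flow s x \<partial>lborel) = (\<integral>x. (x \<bullet> b)\<^sup>2 * flow s x \<partial>lborel) - 2 * (1 + s) +
      (1 + s)\<^sup>2 * (\<integral>x. (dflow s b x)\<^sup>2 / flow s x \<partial>lborel)"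
      unfolding rel_score_square_expand[OF s] by (simp only: integral_inner_dflow[OF s b] mult_minus1_right diff_conv_add_uminus)
  qed
  also have "\<dots> = (\<Sum>b\<in>Basis. \<integral>x. (x \<bullet> b)\<^sup>2 * flow s x \<partial>lborel) - 2 * (1 + s) * real DIM('a) + (1 + s)\<^sup>2 * fisher s"
    by (simp add: sum.distrib sum_subtractf fisher_def sum_distrib_left)
  also have "(\<Sum>b\<in>Basis. \<integral>x. (x \<bullet> b)\<^sup>2 * flow s x \<partial>lborel) = (\<integral>x. (norm x)\<^sup>2 * flow s x \<partial>lborel)"
    using integrable_inner_square_flow[OF s] by (simp add: norm_square_eq_sum_inner sum_distrib_right)
  finally show ?thesis by (simp add: integral_norm_square_flow[OF s])
qed

text \<open>The derivatives of the two explicit terms complete the square that de Bruijn's identity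
  begins; \<open>rel_fisher_eq\<close> is that square expanded.\<close>

lemma rel_entropy_has_derivative:
  assumes s: "0 < s"
  shows "(rel_entropy has_real_derivative - rel_fisher s / (2 * (1 + s)\<^sup>2)) (at s)"
proof -
  define d where "d = real DIM('a)"
  have 1: "((\<lambda>s. d / 2 * ln (2 * pi * (1 + s))) has_real_derivative d / (2 * (1 + s))) (at s)"
  proof -
    have p: "0 < 2 * pi * (1 + s)" using s by simp
    have "((\<lambda>s. 2 * pi * (1 + s)) has_real_derivative 2 * pi) (at s)"
      by (auto intro!: derivative_eq_intros)
    from DERIV_cmult[OF DERIV_chain2[OF DERIV_ln_divide[OF p] this], of "d / 2"]
    show ?thesis using s by simp
  qed
  have 2: "((\<lambda>s. (second_moment + d * s) / (2 * (1 + s))) has_real_derivative (d - second_moment) / (2 * (1 + s)\<^sup>2)) (at s)"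
  proof -
    have "((\<lambda>s. (second_moment + d * s) / (2 * (1 + s))) has_real_derivative
        (d * (2 * (1 + s)) - (second_moment + d * s) * 2) / ((2 * (1 + s)) * (2 * (1 + s)))) (at s)"
      using s by (auto intro!: derivative_eq_intros)
    moreover have "(d * (2 * t) - (second_moment + d * (t - 1)) * 2) / ((2 * t) * (2 * t)) = (d - second_moment) / (2 * t\<^sup>2)" if "0 < t" for t
      using that by (simp add: field_simps power2_eq_square)
    from this[of "1 + s"] have "(d * (2 * (1 + s)) - (second_moment + d * s) * 2) / ((2 * (1 + s)) * (2 * (1 + s))) = (d - second_moment) / (2 * (1 + s)\<^sup>2)"
      using s by simp
    ultimately show ?thesis by simp
  qed
  have "(rel_entropy has_real_derivative - fisher s / 2 + d / (2 * (1 + s)) + (d - second_moment) / (2 * (1 + s)\<^sup>2)) (at s)"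
    unfolding rel_entropy_def[abs_def] d_def[symmetric] by (intro DERIV_add de_Bruijn 1 2 s)
  also have "- fisher s / 2 + d / (2 * (1 + s)) + (d - second_moment) / (2 * (1 + s)\<^sup>2) = - rel_fisher s / (2 * (1 + s)\<^sup>2)"
  proof -
    have "- F / 2 + d / (2 * t) + (d - second_moment) / (2 * t\<^sup>2) = (- (F * t\<^sup>2) + d * t + (d - second_moment)) / (2 * t\<^sup>2)"
      if "0 < t" for t F
      using that by (simp add: field_simps power2_eq_square)
    from this[of "1 + s" "fisher s"] s have "- fisher s / 2 + d / (2 * (1 + s)) + (d - second_moment) / (2 * (1 + s)\<^sup>2) =
        (- (fisher s * (1 + s)\<^sup>2) + d * (1 + s) + (d - second_moment)) / (2 * (1 + s)\<^sup>2)"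
      by simp
    also have "- (fisher s * (1 + s)\<^sup>2) + d * (1 + s) + (d - second_moment) = - rel_fisher s"
      unfolding rel_fisher_eq[OF s] d_def by (simp add: algebra_simps)
    finally show ?thesis .
  qed
  finally show ?thesis .
qed

text \<open>Pointwise Jensen: \<open>flow s x\<close> is the \<nu>-mean of
  \<open>heat s (x - y)\<close> and \<open>t ln t\<close> is convex. So convolution does not lower
  the entropy of the Gaussian, whose negative is the right-hand side.\<close>

lemma neg_entropy_le:
  assumes s: "0 < s"
  shows "neg_entropy s \<le> - (real DIM('a) / 2) * ln (2 * pi * s) - real DIM('a) / 2"
proof -
  define L where "L = - (real DIM('a) / 2) * ln (2 * pi * s)"
  define K where "K u = L * heat s u - 1 / (2 * s) * ((norm u)\<^sup>2 * heat s u)" for u :: 'a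
  have g: "gauss_dom (heat s :: 'a \<Rightarrow> real)" by (rule gauss_dom_heat[OF s])
  have K: "gauss_dom K"
    using gauss_dom_add[OF gauss_dom_cmult[OF g, of L] gauss_dom_cmult[OF gauss_dom_square_mult[OF g], of "- 1 / (2 * s)"]]
    by (simp add: K_def[abs_def])
  have heat_ln: "heat s u * ln (heat s u) = K u" for u
  proof -
    have l: "ln (heat s u) = L - (norm u)\<^sup>2 / (2 * s)"
      unfolding heat_def using s by (subst ln_mult) (auto simp: ln_powr L_def)
    show ?thesis unfolding l K_def by (simp add: algebra_simps)
  qed
  have "neg_entropy s \<le> (\<integral>x. conv1 K x \<partial>lborel)"
    unfolding neg_entropy_def
  proof (rule integral_mono[OF integrable_flow_ln_flow[OF s]])
    show "integrable lborel (conv1 K)" by (intro integrable_conv gauss_dom_integrable K) auto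
    fix x
    have i: "integrable \<nu> (\<lambda>y. heat s (x - y))" "integrable \<nu> (\<lambda>y. K (x - y))"
      by (intro integrable_conv1_point g K)+
    have "flow s x * ln (flow s x) = (\<integral>y. flow s x * ln (flow s x) + (1 + ln (flow s x)) * (heat s (x - y) - flow s x) \<partial>\<nu>)"
      using i by (simp add: prob_space) (simp add: flow_def conv_def)
    also have "\<dots> \<le> (\<integral>y. K (x - y) \<partial>\<nu>)"
    proof (rule integral_mono[OF _ i(2)])
      show "integrable \<nu> (\<lambda>y. flow s x * ln (flow s x) + (1 + ln (flow s x)) * (heat s (x - y) - flow s x))"
        using i by simp
      show "flow s x * ln (flow s x) + (1 + ln (flow s x)) * (heat s (x - y) - flow s x) \<le> K (x - y)" for y
        using xlnx_tangent[OF flow_pos[OF s, of x] heat_pos[OF s, of "x - y"]] by (simp add: heat_ln)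
    qed
    finally show "flow s x * ln (flow s x) \<le> conv1 K x" by (simp add: conv_def)
  qed
  also have "\<dots> = (\<integral>u. K u \<partial>lborel)"
    using K by (subst integral_conv) (auto simp: prob_space gauss_dom_integrable)
  also have "\<dots> = L - real DIM('a) / 2"
    using integrable_heat[OF s, where 'a='a] gauss_dom_integrable[OF gauss_dom_square_mult[OF g]] s
    by (simp add: K_def integral_heat[OF s] heat_moment_norm[OF s])
  finally show ?thesis by (simp add: L_def)
qed

text \<open>Only the decay as \<open>s\<close> tends to infinity matters. The logarithms of
  \<open>neg_entropy_le\<close> and of \<open>q\<^sub>s\<close> differ by
  \<open>ln (1 + 1 / s) \<le> 1 / s\<close>.\<close>

lemma rel_entropy_le:
  assumes s: "0 < s"
  shows "rel_entropy s \<le> (real DIM('a) + second_moment) / (2 * s)"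
proof -
  define d where "d = real DIM('a)"
  have d: "0 \<le> d" by (simp add: d_def)
  have "ln (2 * pi * (1 + s)) - ln (2 * pi * s) = ln (1 + 1 / s)"
  proof -
    have "ln (2 * pi * (1 + s)) - ln (2 * pi * s) = ln (2 * pi * (1 + s) / (2 * pi * s))"
      using s by (subst ln_div) auto
    also have "2 * pi * (1 + s) / (2 * pi * s) = 1 + 1 / s"
      using s by (simp add: field_simps)
    finally show ?thesis .
  qed
  also have "\<dots> \<le> 1 / s" using s by (intro ln_add_one_self_le_self) auto
  finally have 1: "ln (2 * pi * (1 + s)) \<le> ln (2 * pi * s) + 1 / s" by simp
  have "rel_entropy s \<le> - (d / 2) * ln (2 * pi * s) - d / 2 + d / 2 * ln (2 * pi * (1 + s)) + (second_moment + d * s) / (2 * (1 + s))"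
    using neg_entropy_le[OF s] by (simp add: rel_entropy_def d_def)
  also have "\<dots> \<le> - (d / 2) * ln (2 * pi * s) - d / 2 + d / 2 * (ln (2 * pi * s) + 1 / s) + (second_moment + d * s) / (2 * (1 + s))"
    using 1 d by (intro add_mono order_refl mult_left_mono) auto
  also have "\<dots> = - d / 2 + d / (2 * s) + (second_moment + d * s) / (2 * (1 + s))"
    by (simp add: algebra_simps)
  also have "(second_moment + d * s) / (2 * (1 + s)) \<le> second_moment / (2 * s) + d / 2"
  proof -
    have "second_moment / (2 * (1 + s)) \<le> second_moment / (2 * s)" using s second_moment_nonneg by (intro divide_left_mono) auto
    moreover have "d * s / (2 * (1 + s)) \<le> d / 2" using s d by (simp add: field_simps)
    ultimately show ?thesis unfolding add_divide_distrib by (rule add_mono)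
  qed
  finally show ?thesis by (simp add: d_def add_divide_distrib)
qed

text \<open>\<open>rel_entropy - E\<close> is nondecreasing and, as \<open>E\<close> is nonnegative,
  at late times it is at most \<open>rel_entropy\<close>, which is small there. This replaces
  integration over all later times.\<close>

lemma rel_entropy_le_of_derivative:
  assumes E: "\<And>t. 0 < t \<Longrightarrow> (E has_real_derivative E' t) (at t)" "\<And>t. 0 < t \<Longrightarrow> 0 \<le> E t"
    and E': "\<And>t. 0 < t \<Longrightarrow> E' t \<le> - rel_fisher t / (2 * (1 + t)\<^sup>2)"
    and s: "0 < s"
  shows "rel_entropy s \<le> E s"
proof (rule field_le_epsilon)
  fix e :: real assume e: "0 < e"
  \<comment> \<open>Late enough for the decay bound on \<open>rel_entropy t\<close> to be at most
    \<open>e\<close>.\<close>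
  define t where "t = max s ((real DIM('a) + second_moment) / (2 * e))"
  have t: "s \<le> t" "0 < t" "(real DIM('a) + second_moment) / (2 * e) \<le> t" using s by (auto simp: t_def)
  have "rel_entropy s - E s \<le> rel_entropy t - E t"
  proof (rule DERIV_nonneg_imp_nondecreasing[OF t(1)])
    fix x assume x: "s \<le> x" "x \<le> t"
    then have "0 < x" using s by simp
    then show "\<exists>y. ((\<lambda>s. rel_entropy s - E s) has_real_derivative y) (at x) \<and> 0 \<le> y"
      using E' by (intro exI[of _ "- rel_fisher x / (2 * (1 + x)\<^sup>2) - E' x"] conjI DERIV_diff rel_entropy_has_derivative E) auto
  qed
  also have "rel_entropy t - E t \<le> (real DIM('a) + second_moment) / (2 * t)"
    using rel_entropy_le[OF t(2)] E(2)[OF t(2)] by simp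
  also have "\<dots> \<le> e" using t e by (simp add: field_simps)
  finally show "rel_entropy s \<le> E s + e" by simp
qed

end

section \<open>The bound by the Fisher information\<close>

context finite_second_moment
begin

lemma conv_Cauchy_Schwarz:
  assumes K: "gauss_dom K" "\<And>u. 0 \<le> K u" and m: "integrable \<nu> m" "integrable \<nu> (\<lambda>y. (m y)\<^sup>2)"
  shows "(conv m K x)\<^sup>2 \<le> conv1 K x * conv (\<lambda>y. (m y)\<^sup>2) K x"
  using weighted_Cauchy_Schwarz[of "\<lambda>y. K (x - y)" \<nu> m] K(2) integrable_conv1_point[OF K(1)]
    integrable_conv_point_gauss[OF m(1) K(1)] integrable_conv_point_gauss[OF m(2) K(1)]
  by (simp add: conv_def mult.commute)

lemma integrable_norm: "integrable \<nu> (\<lambda>y. norm y)"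
  by (rule square_integrable_imp_integrable) (use integrable_norm_square in auto)

lemma integrable_inner: "integrable \<nu> (\<lambda>y. y \<bullet> b)"
  by (rule Bochner_Integration.integrable_bound[of \<nu> "\<lambda>y. norm b * norm y"])
    (use integrable_norm Cauchy_Schwarz_ineq2[of _ b] in \<open>auto simp: mult.commute\<close>)

text \<open>Since \<open>s * dheat s b u = - (u \<bullet> b) * heat s u\<close> at
  \<open>u = x - y\<close>, the unbounded factor \<open>x\<close> disappears into the convolution,
  and the field can be differentiated by \<open>has_dderiv_conv\<close>.\<close>

lemma rel_score_eq_conv:
  assumes s: "0 < s"
  shows "rel_score s b x = conv (\<lambda>y. y \<bullet> b) (heat s) x + dflow s b x"
proof -
  have g: "gauss_dom (heat s :: 'a \<Rightarrow> real)" by (rule gauss_dom_heat[OF s])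
  have i: "integrable \<nu> (\<lambda>y. (y \<bullet> b) * heat s (x - y))" "integrable \<nu> (\<lambda>y. heat s (x - y))"
    by (intro integrable_conv_point_gauss g integrable_inner integrable_conv1_point)+
  have sd: "s * dheat s b u = - (u \<bullet> b) * heat s u" for u
    using s by (simp add: dheat_def)
  have "s * dflow s b x = (\<integral>y. s * dheat s b (x - y) \<partial>\<nu>)"
    by (simp add: dflow_def conv_def)
  also have "(\<lambda>y. s * dheat s b (x - y)) = (\<lambda>y. (y \<bullet> b) * heat s (x - y) - (x \<bullet> b) * heat s (x - y))"
    by (simp add: sd inner_diff_left algebra_simps)
  also have "(\<integral>y. (y \<bullet> b) * heat s (x - y) - (x \<bullet> b) * heat s (x - y) \<partial>\<nu>) =
      conv (\<lambda>y. y \<bullet> b) (heat s) x - (x \<bullet> b) * flow s x"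
    using i by (simp add: conv_def flow_def)
  finally show ?thesis by (simp add: rel_score_def distrib_right)
qed

end

text \<open>By \<open>dh_zero\<close>, and because division by 0 gives 0, the measure
  \<open>dh b d\<gamma>\<close> is \<open>dh b / h\<close> times \<nu> even across zeros of
  \<open>h\<close>. Thus \<open>conv\<close> applies to it.\<close>

locale smooth_density = finite_second_moment \<nu> for \<nu> :: "'a::euclidean_space measure" +
  fixes h :: "'a \<Rightarrow> real" and dh :: "'a \<Rightarrow> 'a \<Rightarrow> real"
  assumes density: "\<nu> = density lborel (\<lambda>x. ennreal (h x * heat 1 x))"
    and h_nonneg: "0 \<le> h x"
    and h_cont: "continuous_on UNIV h"
    and dh_measurable [measurable]: "b \<in> Basis \<Longrightarrow> dh b \<in> borel_measurable borel"
    and dh: "b \<in> Basis \<Longrightarrow> has_dderiv h b (dh b)"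
    and dh_zero: "b \<in> Basis \<Longrightarrow> h x = 0 \<Longrightarrow> dh b x = 0"
begin

lemma h_measurable [measurable]: "h \<in> borel_measurable borel"
  using h_cont by (rule borel_measurable_continuous_onI)

lemma
  fixes f :: "'a \<Rightarrow> real"
  assumes [measurable]: "f \<in> borel_measurable borel"
  shows integrable_nu_iff: "integrable \<nu> f \<longleftrightarrow> integrable lborel (\<lambda>x. h x * heat 1 x * f x)"
    and integral_nu: "(\<integral>x. f x \<partial>\<nu>) = (\<integral>x. h x * heat 1 x * f x \<partial>lborel)"
  unfolding density
  by (subst integrable_density integral_density; auto simp: h_nonneg heat_nonneg)+

text \<open>The integral over \<open>y\<close> of the derivative of
  \<open>h y * heat 1 y * heat s (x - y)\<close> vanishes. The derivative of \<open>heat 1\<close>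
  contributes the term with \<open>y \<bullet> b\<close> and that of \<open>heat s\<close>
  contributes \<open>dflow\<close>; by \<open>rel_score_eq_conv\<close> together they make
  \<open>rel_score\<close>.\<close>

lemma rel_score_eq_conv_log_gradient:
  assumes s: "0 < s" and b: "b \<in> Basis" and m: "integrable \<nu> (\<lambda>y. dh b y / h y)"
  shows "rel_score s b x = conv (\<lambda>y. dh b y / h y) (heat s) x"
proof -
  have g: "gauss_dom (heat s :: 'a \<Rightarrow> real)" by (rule gauss_dom_heat[OF s])
  note [measurable] = dh_measurable[OF b]
  define F where "F y = (h y * heat 1 y) * heat s (x - y)" for y
  define F' where "F' y = (dh b y * heat 1 y + h y * dheat 1 b y) * heat s (x - y) + (h y * heat 1 y) * - dheat s b (x - y)" for y
  have D: "has_dderiv F b F'"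
    unfolding F_def[abs_def] F'_def[abs_def]
  proof (intro has_dderiv_mult dh b has_dderiv_heat)
    show "has_dderiv (\<lambda>y. heat s (x - y)) b (\<lambda>y. - dheat s b (x - y))"
      unfolding has_dderiv_def
    proof
      fix y
      have "((\<lambda>t. heat s ((x - y) + t *\<^sub>R (- b))) has_real_derivative dheat s (- b) (x - y)) (at 0)"
        using has_dderiv_heat[OF s, of "- b"] unfolding has_dderiv_def by blast
      then show "((\<lambda>t. heat s (x - (y + t *\<^sub>R b))) has_real_derivative - dheat s b (x - y)) (at 0)"
        by (simp add: dheat_def[of s "- b"] dheat_def[of s b] diff_diff_eq add.commute flip: diff_conv_add_uminus)
    qed
  qed simp
  have F'_eq: "F' y = h y * heat 1 y * ((dh b y / h y) * heat s (x - y))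
      - h y * heat 1 y * ((y \<bullet> b) * heat s (x - y)) - h y * heat 1 y * dheat s b (x - y)" for y
    using dh_zero[OF b, of y] by (cases "h y = 0") (auto simp: F'_def dheat_def[of 1] algebra_simps)
  have i: "integrable lborel F"
    "integrable lborel (\<lambda>y. h y * heat 1 y * ((dh b y / h y) * heat s (x - y)))"
    "integrable lborel (\<lambda>y. h y * heat 1 y * ((y \<bullet> b) * heat s (x - y)))"
    "integrable lborel (\<lambda>y. h y * heat 1 y * dheat s b (x - y))"
    using integrable_conv1_point[OF g, of x] integrable_conv_point_gauss[OF m g, of x]
      integrable_conv_point_gauss[OF integrable_inner g, of b x] integrable_conv1_point[OF gauss_dom_dheat[OF s], of b x]
    by (simp_all add: integrable_nu_iff F_def[abs_def])
  have "0 = (\<integral>y. F' y \<partial>lborel)"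
    using i by (intro integral_dderiv_eq_0[OF D, symmetric]) (auto simp: F'_eq[abs_def])
  also have "\<dots> = (\<integral>y. (dh b y / h y) * heat s (x - y) \<partial>\<nu>) - (\<integral>y. (y \<bullet> b) * heat s (x - y) \<partial>\<nu>)
      - (\<integral>y. dheat s b (x - y) \<partial>\<nu>)"
    unfolding F'_eq using i by (simp add: integral_nu)
  finally show ?thesis
    unfolding rel_score_eq_conv[OF s] by (simp add: conv_def dflow_def)
qed

text \<open>After Cauchy-Schwarz the dependence on \<open>s\<close> sits in the total mass of
  \<open>heat s\<close>, which is 1.\<close>

lemma rel_fisher_le_fisher:
  assumes s: "0 < s" and i: "\<And>b. b \<in> Basis \<Longrightarrow> integrable \<nu> (\<lambda>y. (dh b y / h y)\<^sup>2)"
  shows "rel_fisher s \<le> (\<Sum>b\<in>Basis. \<integral>y. (dh b y / h y)\<^sup>2 \<partial>\<nu>)"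
  unfolding rel_fisher_def
proof (rule sum_mono)
  fix b :: 'a assume b: "b \<in> Basis"
  note [measurable] = dh_measurable[OF b]
  let ?m = "\<lambda>y. dh b y / h y"
  have m: "integrable \<nu> ?m"
    by (rule square_integrable_imp_integrable[OF _ i[OF b]]) measurable
  have "(\<integral>x. (rel_score s b x)\<^sup>2 / flow s x \<partial>lborel) \<le> (\<integral>x. conv (\<lambda>y. (?m y)\<^sup>2) (heat s) x \<partial>lborel)"
  proof (rule integral_mono[OF integrable_rel_score_square[OF s]])
    show "integrable lborel (conv (\<lambda>y. (?m y)\<^sup>2) (heat s))"
      by (intro integrable_conv i b integrable_heat s)
    show "(rel_score s b x)\<^sup>2 / flow s x \<le> conv (\<lambda>y. (?m y)\<^sup>2) (heat s) x" for x
      using conv_Cauchy_Schwarz[OF gauss_dom_heat[OF s] heat_nonneg m i[OF b], of x] flow_pos[OF s, of x]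
      by (simp add: rel_score_eq_conv_log_gradient[OF s b m] flow_def divide_simps mult.commute)
  qed
  also have "\<dots> = (\<integral>y. (?m y)\<^sup>2 \<partial>\<nu>)"
    by (simp add: integral_conv i b integrable_heat s integral_heat)
  finally show "(\<integral>x. (rel_score s b x)\<^sup>2 / flow s x \<partial>lborel) \<le> (\<integral>y. (?m y)\<^sup>2 \<partial>\<nu>)" .
qed

end

section \<open>The bound by the Stein discrepancy\<close>

context finite_second_moment
begin

text \<open>Up to an additive constant, \<open>(1 + s) * ln (f\<^sub>s / q\<^sub>s)\<close>.\<close>

definition potential :: "real \<Rightarrow> 'a \<Rightarrow> real" where
  "potential s x = (1 + s) * ln (flow s x) + (norm x)\<^sup>2 / 2"

lemma borel_measurable_potential [measurable]: "potential s \<in> borel_measurable borel"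
  unfolding potential_def[abs_def] by measurable

lemma has_dderiv_norm_square: "has_dderiv (\<lambda>x::'a. (norm x)\<^sup>2) e (\<lambda>x. 2 * (x \<bullet> e))"
  unfolding has_dderiv_def norm_add_scaleR_square by (auto intro!: derivative_eq_intros)

lemma has_dderiv_potential:
  assumes s: "0 < s"
  shows "has_dderiv (potential s) b (\<lambda>x. rel_score s b x / flow s x)"
proof -
  have "has_dderiv (\<lambda>x. (1 + s) * ln (flow s x) + 1 / 2 * (norm x)\<^sup>2) b
      (\<lambda>x. (1 + s) * (1 / flow s x * dflow s b x) + 1 / 2 * (2 * (x \<bullet> b)))"
    by (intro has_dderiv_add has_dderiv_cmult has_dderiv_ln_flow has_dderiv_norm_square s)
  moreover have "(1 + s) * (1 / flow s x * dflow s b x) + 1 / 2 * (2 * (x \<bullet> b)) = rel_score s b x / flow s x" for x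
    using flow_pos[OF s, of x] by (simp add: rel_score_def field_simps)
  ultimately show ?thesis by (simp add: potential_def[abs_def])
qed

lemma potential_bound:
  assumes s: "0 < s"
  obtains A where "0 \<le> A" "\<And>x. \<bar>potential s x\<bar> \<le> A * (1 + (norm x)\<^sup>2)"
proof -
  obtain A where A: "0 \<le> A" "\<And>x. \<bar>ln (flow s x)\<bar> \<le> A * (1 + (norm x)\<^sup>2)" by (metis ln_flow_bound1[OF s])
  have "\<bar>potential s x\<bar> \<le> ((1 + s) * A + 1) * (1 + (norm x)\<^sup>2)" for x
  proof -
    have "\<bar>potential s x\<bar> \<le> \<bar>(1 + s) * ln (flow s x)\<bar> + \<bar>(norm x)\<^sup>2 / 2\<bar>"
      unfolding potential_def by (rule abs_triangle_ineq)
    also have "\<bar>(1 + s) * ln (flow s x)\<bar> \<le> (1 + s) * (A * (1 + (norm x)\<^sup>2))"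
      unfolding abs_mult using A s by (intro mult_mono) auto
    also have "\<bar>(norm x)\<^sup>2 / 2\<bar> \<le> 1 + (norm x)\<^sup>2" by simp
    finally show ?thesis by (simp add: algebra_simps)
  qed
  moreover have "0 \<le> (1 + s) * A + 1" using A s by simp
  ultimately show ?thesis using that by blast
qed

text \<open>A Gaussian serves as cutoff: it beats the quadratic growth of \<open>potential\<close>,
  and its derivative is the cutoff itself times an explicit linear factor.\<close>

definition cutoff :: "nat \<Rightarrow> 'a \<Rightarrow> real" where
  "cutoff n x = exp (- (1 / real (Suc n)) * (norm x)\<^sup>2)"

lemma borel_measurable_cutoff [measurable]: "cutoff n \<in> borel_measurable borel"
  unfolding cutoff_def[abs_def] by measurable

lemma cutoff_pos: "0 < cutoff n x" and cutoff_le_1: "cutoff n x \<le> 1"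
  by (simp_all add: cutoff_def)

text \<open>A derivative falling on the cutoff costs a factor \<open>1 / real (Suc n)\<close> times
  a linear one. With this bound that factor compensates the growth of \<open>potential\<close>
  uniformly in \<open>n\<close>.\<close>

lemma cutoff_decay: "1 / real (Suc n) * (1 + (norm x)\<^sup>2) * cutoff n x \<le> 2"
proof -
  define t where "t = 1 / real (Suc n) * (norm x)\<^sup>2"
  have "t \<le> exp t" using exp_ge_add_one_self[of t] by linarith
  then have "t * exp (- t) \<le> 1" by (simp add: exp_minus field_simps)
  moreover have "1 / real (Suc n) * exp (- t) \<le> 1 * 1"
    by (intro mult_mono) (auto simp: t_def)
  moreover have "cutoff n x = exp (- t)" by (simp add: cutoff_def t_def)
  then have "1 / real (Suc n) * (1 + (norm x)\<^sup>2) * cutoff n x = 1 / real (Suc n) * exp (- t) + t * exp (- t)"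
    by (simp only: t_def distrib_left distrib_right mult_1_right)
  ultimately show ?thesis by linarith
qed

lemma cutoff_tendsto: "(\<lambda>n. cutoff n x) \<longlonglongrightarrow> 1"
proof -
  have "(\<lambda>n. exp (- (1 / real (Suc n)) * (norm x)\<^sup>2)) \<longlonglongrightarrow> exp (- 0 * (norm x)\<^sup>2)"
    by (intro tendsto_intros LIMSEQ_Suc[OF lim_1_over_n])
  then show ?thesis by (simp add: cutoff_def)
qed

lemma has_dderiv_cutoff:
  "has_dderiv (cutoff n) b (\<lambda>x. cutoff n x * (- (1 / real (Suc n)) * (2 * (x \<bullet> b))))"
proof -
  have "has_dderiv (\<lambda>x::'a. exp (- (1 / real (Suc n)) * (norm x)\<^sup>2)) b
      (\<lambda>x. exp (- (1 / real (Suc n)) * (norm x)\<^sup>2) * (- (1 / real (Suc n)) * (2 * (x \<bullet> b))))"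
    by (rule has_dderiv_compose[OF has_dderiv_cmult[OF has_dderiv_norm_square]]) (rule DERIV_exp)
  then show ?thesis by (simp add: cutoff_def[abs_def])
qed

text \<open>Integration by parts of \<open>potential s\<close> against \<open>Z\<close>. The product
  \<open>potential s * dZ\<close> is not known to be integrable, so the formula is a limit over
  cutoffs; the term in which the derivative hits the cutoff tends to 0 pointwise and is
  dominated.\<close>

lemma cutoff_integral_tendsto:
  assumes s: "0 < s" and b: "b \<in> Basis"
    and D: "has_dderiv Z b dZ"
    and Z: "integrable lborel Z" and dZ: "integrable lborel dZ"
    and Z2: "integrable lborel (\<lambda>x. (Z x)\<^sup>2 / flow s x)"
  shows "integrable lborel (\<lambda>x. rel_score s b x * Z x / flow s x)"
    and "integrable lborel (\<lambda>x. cutoff n x * potential s x * dZ x)"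
    and "(\<lambda>n. - (\<integral>x. cutoff n x * potential s x * dZ x \<partial>lborel)) \<longlonglongrightarrow> (\<integral>x. rel_score s b x * Z x / flow s x \<partial>lborel)"
proof -
  have [measurable]: "Z \<in> borel_measurable borel" "dZ \<in> borel_measurable borel" using Z dZ by auto
  obtain A where A: "0 \<le> A" "\<And>x. \<bar>potential s x\<bar> \<le> A * (1 + (norm x)\<^sup>2)" by (metis potential_bound[OF s])
  define \<epsilon> where "\<epsilon> n = 1 / real (Suc n)" for n
  have \<epsilon>: "0 < \<epsilon> n" for n by (simp add: \<epsilon>_def)
  have psi: "\<epsilon> n * \<bar>cutoff n x * potential s x\<bar> \<le> 2 * A" for n x
  proof -
    have "\<epsilon> n * \<bar>cutoff n x * potential s x\<bar> = \<epsilon> n * cutoff n x * \<bar>potential s x\<bar>"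
      using cutoff_pos[of n x] by (simp add: abs_mult)
    also have "\<dots> \<le> \<epsilon> n * cutoff n x * (A * (1 + (norm x)\<^sup>2))"
      using cutoff_pos[of n x] \<epsilon>[of n] A(2) by (intro mult_left_mono) auto
    also have "\<dots> = A * (\<epsilon> n * (1 + (norm x)\<^sup>2) * cutoff n x)" by (simp only: mult_ac)
    also have "\<dots> \<le> A * 2"
      using cutoff_decay[of n x] A(1) unfolding \<epsilon>_def by (rule mult_left_mono)
    finally show ?thesis by simp
  qed
  have amgm: "\<bar>p * q\<bar> / f \<le> p\<^sup>2 / f + q\<^sup>2 / f" if "0 < f" for p q f :: real
  proof -
    show ?thesis using abs_mult_le_sum_squares[of p q] that by (simp add: divide_right_mono flip: add_divide_distrib)
  qed
  show UZ: "integrable lborel (\<lambda>x. rel_score s b x * Z x / flow s x)"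
  proof (rule Bochner_Integration.integrable_bound)
    show "integrable lborel (\<lambda>x. (rel_score s b x)\<^sup>2 / flow s x + (Z x)\<^sup>2 / flow s x)"
      by (intro Bochner_Integration.integrable_add integrable_rel_score_square s Z2)
    show "AE x in lborel. norm (rel_score s b x * Z x / flow s x) \<le> norm ((rel_score s b x)\<^sup>2 / flow s x + (Z x)\<^sup>2 / flow s x)"
      using amgm[OF flow_pos[OF s]] flow_pos[OF s]
      by (intro AE_I2) (simp add: less_imp_le abs_mult)
  qed measurable
  have bZ: "integrable lborel (\<lambda>x. cutoff n x * potential s x * W x)" if W: "integrable lborel W" for n W
  proof (rule Bochner_Integration.integrable_bound)
    have [measurable]: "W \<in> borel_measurable borel" using W by auto
    show "integrable lborel (\<lambda>x. 2 * A / \<epsilon> n * W x)" using W by simp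
    show "AE x in lborel. norm (cutoff n x * potential s x * W x) \<le> norm (2 * A / \<epsilon> n * W x)"
    proof (rule AE_I2)
      fix x
      have "\<bar>cutoff n x * potential s x\<bar> \<le> 2 * A / \<epsilon> n" using psi[of n x] \<epsilon>[of n] by (simp add: field_simps)
      then have "\<bar>cutoff n x * potential s x\<bar> * \<bar>W x\<bar> \<le> 2 * A / \<epsilon> n * \<bar>W x\<bar>" by (rule mult_right_mono) simp
      then show "norm (cutoff n x * potential s x * W x) \<le> norm (2 * A / \<epsilon> n * W x)"
        using A(1) \<epsilon>[of n] by (simp add: abs_mult)
    qed
    show "(\<lambda>x. cutoff n x * potential s x * W x) \<in> borel_measurable lborel" by measurable
  qed
  show "integrable lborel (\<lambda>x. cutoff n x * potential s x * dZ x)" by (rule bZ[OF dZ])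
  define G where "G n x = cutoff n x * (rel_score s b x / flow s x) - 2 * (x \<bullet> b) * (\<epsilon> n * (cutoff n x * potential s x))" for n x
  have DG: "has_dderiv (\<lambda>x. cutoff n x * potential s x) b (G n)" for n
    using has_dderiv_mult[OF has_dderiv_cutoff[of n b] has_dderiv_potential[OF s, of b]]
    by (simp add: G_def[abs_def] \<epsilon>_def algebra_simps)
  \<comment> \<open>A bound free of \<open>n\<close>: the first two terms control
    \<open>U Z / f\<close>, the bracket controls the term from the cutoff, writing
    \<open>(x \<bullet> b) * Z\<close> as \<open>((x \<bullet> b) f) Z / f\<close>.\<close>
  let ?w = "\<lambda>x. (rel_score s b x)\<^sup>2 / flow s x + (Z x)\<^sup>2 / flow s x + 4 * A * ((x \<bullet> b)\<^sup>2 * flow s x + (Z x)\<^sup>2 / flow s x)"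
  have w: "integrable lborel ?w"
    by (intro Bochner_Integration.integrable_add integrable_mult_right integrable_rel_score_square
        integrable_inner_square_flow s Z2)
  have GZ: "\<bar>G n x * Z x\<bar> \<le> ?w x" for n x
  proof -
    have f: "0 < flow s x" by (rule flow_pos[OF s])
    have "\<bar>cutoff n x * (rel_score s b x / flow s x) * Z x\<bar> = cutoff n x * (\<bar>rel_score s b x * Z x\<bar> / flow s x)"
      using cutoff_pos[of n x] f by (simp add: abs_mult)
    also have "\<dots> \<le> 1 * (\<bar>rel_score s b x * Z x\<bar> / flow s x)"
      using cutoff_le_1[of n x] f by (intro mult_right_mono) auto
    also have "\<dots> \<le> (rel_score s b x)\<^sup>2 / flow s x + (Z x)\<^sup>2 / flow s x"
      using amgm[OF f] by simp
    finally have 1: "\<bar>cutoff n x * (rel_score s b x / flow s x) * Z x\<bar> \<le> (rel_score s b x)\<^sup>2 / flow s x + (Z x)\<^sup>2 / flow s x" .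
    have "\<bar>2 * (x \<bullet> b) * (\<epsilon> n * (cutoff n x * potential s x)) * Z x\<bar> =
        (2 * \<bar>(x \<bullet> b) * Z x\<bar>) * (\<epsilon> n * \<bar>cutoff n x * potential s x\<bar>)"
      using \<epsilon>[of n] by (simp add: abs_mult)
    also have "\<dots> \<le> (2 * \<bar>(x \<bullet> b) * Z x\<bar>) * (2 * A)"
      using psi by (intro mult_left_mono) auto
    also have "\<dots> = 4 * A * \<bar>(x \<bullet> b) * Z x\<bar>" by simp
    also have "\<dots> \<le> 4 * A * ((x \<bullet> b)\<^sup>2 * flow s x + (Z x)\<^sup>2 / flow s x)"
      using amgm[OF f, of "(x \<bullet> b) * flow s x" "Z x"] f A(1)
      by (intro mult_left_mono) (auto simp: abs_mult power2_eq_square)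
    finally have 2: "\<bar>2 * (x \<bullet> b) * (\<epsilon> n * (cutoff n x * potential s x)) * Z x\<bar> \<le>
        4 * A * ((x \<bullet> b)\<^sup>2 * flow s x + (Z x)\<^sup>2 / flow s x)"
      .
    show ?thesis
      unfolding G_def left_diff_distrib by (rule order_trans[OF abs_triangle_ineq4 add_mono[OF 1 2]])
  qed
  have [measurable]: "G n \<in> borel_measurable borel" for n
    unfolding G_def[abs_def] by measurable
  have iGZ: "integrable lborel (\<lambda>x. G n x * Z x)" for n
    by (rule Bochner_Integration.integrable_bound[OF w]) (use GZ in \<open>auto intro: order_trans[OF _ abs_ge_self]\<close>)
  have "(\<integral>x. cutoff n x * potential s x * dZ x \<partial>lborel) = - (\<integral>x. G n x * Z x \<partial>lborel)" for n
    by (rule integral_by_parts_dderiv[OF DG D bZ[OF Z] iGZ bZ[OF dZ]])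
  moreover have "(\<lambda>n. \<integral>x. G n x * Z x \<partial>lborel) \<longlonglongrightarrow> (\<integral>x. rel_score s b x * Z x / flow s x \<partial>lborel)"
  proof (rule integral_dominated_convergence[OF _ _ w])
    show "AE x in lborel. (\<lambda>n. G n x * Z x) \<longlonglongrightarrow> rel_score s b x * Z x / flow s x"
    proof (rule AE_I2)
      fix x
      have "(\<lambda>n. G n x * Z x) \<longlonglongrightarrow> (1 * (rel_score s b x / flow s x) - 2 * (x \<bullet> b) * (0 * (1 * potential s x))) * Z x"
        unfolding G_def \<epsilon>_def by (intro tendsto_intros cutoff_tendsto LIMSEQ_Suc[OF lim_1_over_n])
      then show "(\<lambda>n. G n x * Z x) \<longlonglongrightarrow> rel_score s b x * Z x / flow s x" by simp
    qed
    show "AE x in lborel. norm (G n x * Z x) \<le> ?w x" for n using GZ by simp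
  qed measurable
  ultimately show "(\<lambda>n. - (\<integral>x. cutoff n x * potential s x * dZ x \<partial>lborel)) \<longlonglongrightarrow> (\<integral>x. rel_score s b x * Z x / flow s x \<partial>lborel)"
    by simp
qed

text \<open>A weighted projection: since \<open>U / f\<close> is a gradient, \<open>U\<close> has
  the least norm among fields with its divergence. For each \<open>n\<close> the cutoff integrals of
  the two fields agree, because \<open>div\<close> equates their divergences pointwise; hence so do
  the limits.\<close>

lemma rel_fisher_le_of_divergence:
  assumes s: "0 < s"
    and D: "\<And>b. b \<in> Basis \<Longrightarrow> has_dderiv (V b) b (dV b)"
    and V: "\<And>b. b \<in> Basis \<Longrightarrow> integrable lborel (V b)" "\<And>b. b \<in> Basis \<Longrightarrow> integrable lborel (dV b)"
    and V2: "\<And>b. b \<in> Basis \<Longrightarrow> integrable lborel (\<lambda>x. (V b x)\<^sup>2 / flow s x)"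
    and div: "\<And>x. (\<Sum>b\<in>Basis. conv (\<lambda>y. y \<bullet> b) (dheat s b) x + conv1 (ddheat s b b) x) = (\<Sum>b\<in>Basis. dV b x)"
  shows "rel_fisher s \<le> (\<Sum>b\<in>Basis. \<integral>x. (V b x)\<^sup>2 / flow s x \<partial>lborel)"
proof -
  let ?dU = "\<lambda>b x. conv (\<lambda>y. y \<bullet> b) (dheat s b) x + conv1 (ddheat s b b) x"
  have rel_score: "rel_score s b = (\<lambda>x. conv (\<lambda>y. y \<bullet> b) (heat s) x + dflow s b x)" for b
    using rel_score_eq_conv[OF s] by blast
  have DU: "has_dderiv (rel_score s b) b (?dU b)" for b
    unfolding rel_score
    by (intro has_dderiv_add has_dderiv_dflow s has_dderiv_conv integrable_inner has_dderiv_heat gauss_dom_heat gauss_dom_dheat)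
  have U: "integrable lborel (rel_score s b)" "integrable lborel (?dU b)" for b
    unfolding rel_score dflow_def
    by (intro Bochner_Integration.integrable_add integrable_conv integrable_inner gauss_dom_integrable
        gauss_dom_heat gauss_dom_dheat gauss_dom_ddheat s; simp)+
  note cU = cutoff_integral_tendsto[OF s _ DU U integrable_rel_score_square[OF s]]
  note cV = cutoff_integral_tendsto[OF s _ D V V2]
  have "(\<lambda>n. \<Sum>b\<in>Basis. - (\<integral>x. cutoff n x * potential s x * ?dU b x \<partial>lborel)) \<longlonglongrightarrow>
      (\<Sum>b\<in>Basis. \<integral>x. rel_score s b x * rel_score s b x / flow s x \<partial>lborel)"
    by (intro tendsto_sum cU(3))
  moreover have "(\<lambda>n. \<Sum>b\<in>Basis. - (\<integral>x. cutoff n x * potential s x * dV b x \<partial>lborel)) \<longlonglongrightarrow>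
      (\<Sum>b\<in>Basis. \<integral>x. rel_score s b x * V b x / flow s x \<partial>lborel)"
    by (intro tendsto_sum cV(3))
  moreover have "(\<Sum>b\<in>Basis. - (\<integral>x. cutoff n x * potential s x * ?dU b x \<partial>lborel)) =
      (\<Sum>b\<in>Basis. - (\<integral>x. cutoff n x * potential s x * dV b x \<partial>lborel))" for n
  proof -
    have "(\<Sum>b\<in>Basis. \<integral>x. cutoff n x * potential s x * ?dU b x \<partial>lborel) =
        (\<integral>x. cutoff n x * potential s x * (\<Sum>b\<in>Basis. ?dU b x) \<partial>lborel)"
      using cU(2) by (simp add: sum_distrib_left)
    also have "\<dots> = (\<Sum>b\<in>Basis. \<integral>x. cutoff n x * potential s x * dV b x \<partial>lborel)"
      unfolding div using cV(2) by (simp add: sum_distrib_left)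
    finally show ?thesis by (simp add: sum_negf)
  qed
  ultimately have eq: "(\<Sum>b\<in>Basis. \<integral>x. rel_score s b x * rel_score s b x / flow s x \<partial>lborel) =
      (\<Sum>b\<in>Basis. \<integral>x. rel_score s b x * V b x / flow s x \<partial>lborel)"
    using LIMSEQ_unique by auto
  have "rel_fisher s = (\<Sum>b\<in>Basis. \<integral>x. rel_score s b x * V b x / flow s x \<partial>lborel)"
    unfolding rel_fisher_def using eq by (simp add: power2_eq_square)
  \<comment> \<open>By \<open>u v \<le> (u\<^sup>2 + v\<^sup>2) / 2\<close>; the half of
    \<open>rel_fisher s\<close> that appears is then moved to the left.\<close>
  also have "\<dots> \<le> (\<Sum>b\<in>Basis. \<integral>x. (1 / 2) * ((rel_score s b x)\<^sup>2 / flow s x) + (1 / 2) * ((V b x)\<^sup>2 / flow s x) \<partial>lborel)"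
  proof (intro sum_mono integral_mono cV(1))
    fix b :: 'a and x assume b: "b \<in> Basis"
    show "integrable lborel (\<lambda>x. (1 / 2) * ((rel_score s b x)\<^sup>2 / flow s x) + (1 / 2) * ((V b x)\<^sup>2 / flow s x))"
      by (intro Bochner_Integration.integrable_add integrable_mult_right integrable_rel_score_square s V2 b)
    show "rel_score s b x * V b x / flow s x \<le> (1 / 2) * ((rel_score s b x)\<^sup>2 / flow s x) + (1 / 2) * ((V b x)\<^sup>2 / flow s x)"
      using sum_squares_bound[of "rel_score s b x" "V b x"] flow_pos[OF s, of x] by (simp add: field_simps)
  qed auto
  also have "\<dots> = (1 / 2) * rel_fisher s + (1 / 2) * (\<Sum>b\<in>Basis. \<integral>x. (V b x)\<^sup>2 / flow s x \<partial>lborel)"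
  proof -
    have "(\<integral>x. (1 / 2) * ((rel_score s b x)\<^sup>2 / flow s x) + (1 / 2) * ((V b x)\<^sup>2 / flow s x) \<partial>lborel) =
        (1 / 2) * (\<integral>x. (rel_score s b x)\<^sup>2 / flow s x \<partial>lborel) + (1 / 2) * (\<integral>x. (V b x)\<^sup>2 / flow s x \<partial>lborel)" if "b \<in> Basis" for b
      using integrable_mult_right[OF integrable_rel_score_square[OF s, of b], of "1 / 2"] integrable_mult_right[OF V2[OF that], of "1 / 2"]
      by (simp only: Bochner_Integration.integral_add integral_mult_right_zero)
    then show ?thesis
      unfolding rel_fisher_def sum_distrib_left sum.distrib[symmetric] by (intro sum.cong refl)
  qed
  finally show ?thesis by simp
qed

end

lemma xlnx_nonneg: "0 \<le> (t::real) \<Longrightarrow> 0 \<le> t * ln t - t + 1"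
  using xlnx_tangent[of 1 t] by (cases "t = 0") auto

text \<open>At \<open>t = 0\<close> the value is 0, which is also the limit of \<open>x ln x\<close>
  from the right; positivity of \<open>f\<close> ensures that 0 is approached from that
  side.\<close>

lemma tendsto_xlnx:
  fixes f :: "'b \<Rightarrow> real"
  assumes f: "(f \<longlongrightarrow> t) F" and nonneg: "0 \<le> t" "\<And>x. 0 < f x"
  shows "((\<lambda>x. f x * ln (f x)) \<longlongrightarrow> t * ln t) F"
proof (cases "t = 0")
  case True
  have "((\<lambda>x::real. x * ln x) \<longlongrightarrow> 0) (at_right 0)" by real_asymp
  moreover have "filterlim f (at_right 0) F"
    unfolding filterlim_at using f True nonneg(2) by (simp add: less_imp_neq[symmetric])
  ultimately show ?thesis using True by (auto dest: filterlim_compose)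
next
  case False
  then show ?thesis by (intro tendsto_mult tendsto_ln f)
qed

section \<open>The vector field built from the Stein kernel\<close>

context finite_second_moment
begin

text \<open>\<open>V x\<close> is the integral of \<open>n\<close> with weight
  \<open>heat s (x - y)\<close>, so Cauchy-Schwarz gives \<open>V\<^sup>2 / f \<le> W\<close>. In
  the integral of \<open>W\<close> the second moments of the heat kernel, \<open>s\<close> on the
  diagonal and 0 off it, meet the factor \<open>1 / s\<^sup>2\<close>: only squares survive, with
  factor \<open>1 / s\<close>.\<close>

lemma stein_field_square:
  assumes s: "0 < s"
    and M: "\<And>c. c \<in> Basis \<Longrightarrow> M c \<in> borel_measurable borel" "\<And>c. c \<in> Basis \<Longrightarrow> integrable \<nu> (\<lambda>y. (M c y)\<^sup>2)"
  defines "V \<equiv> \<lambda>x. \<Sum>c\<in>Basis. - conv (M c) (dheat s c) x"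
  shows "integrable lborel (\<lambda>x. (V x)\<^sup>2 / flow s x)"
    and "(\<integral>x. (V x)\<^sup>2 / flow s x \<partial>lborel) \<le> (\<Sum>c\<in>Basis. \<integral>y. (M c y)\<^sup>2 \<partial>\<nu>) / s"
proof -
  have g: "gauss_dom (heat s :: 'a \<Rightarrow> real)" by (rule gauss_dom_heat[OF s])
  have Mm: "M c \<in> borel_measurable \<nu>" if "c \<in> Basis" for c using M(1)[OF that] by measurable
  have M1: "integrable \<nu> (M c)" if "c \<in> Basis" for c
    by (rule square_integrable_imp_integrable[OF Mm M(2)]) (use that in auto)
  have MM: "integrable \<nu> (\<lambda>y. M c y * M e y)" if c: "c \<in> Basis" "e \<in> Basis" for c e
  proof (rule Bochner_Integration.integrable_bound)
    show "integrable \<nu> (\<lambda>y. (M c y)\<^sup>2 + (M e y)\<^sup>2)" using M(2) c by simp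
    show "(\<lambda>y. M c y * M e y) \<in> borel_measurable \<nu>" using Mm c by simp
    show "AE y in \<nu>. norm (M c y * M e y) \<le> norm ((M c y)\<^sup>2 + (M e y)\<^sup>2)"
      using abs_mult_le_sum_squares by (intro AE_I2) simp
  qed
  define K where "K c e u = (1 / s\<^sup>2) * ((u \<bullet> c) * ((u \<bullet> e) * heat s u))" for c e u :: 'a
  have K: "gauss_dom (K c e)" for c e
    unfolding K_def[abs_def] by (intro gauss_dom_cmult gauss_dom_inner_mult g)
  define W where "W x = (\<Sum>c\<in>Basis. \<Sum>e\<in>Basis. conv (\<lambda>y. M c y * M e y) (K c e) x)" for x
  have W: "integrable lborel W"
    unfolding W_def[abs_def]
    by (intro Bochner_Integration.integrable_sum integrable_conv MM gauss_dom_integrable K)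
  have VW: "(V x)\<^sup>2 / flow s x \<le> W x" for x
  proof -
    define n where "n y = (\<Sum>c\<in>Basis. M c y * (((x - y) \<bullet> c) / s))" for y
    have gn: "heat s (x - y) * n y = (\<Sum>c\<in>Basis. - (M c y * dheat s c (x - y)))" for y
      unfolding n_def sum_distrib_left by (intro sum.cong refl) (simp add: dheat_def)
    have gn2: "heat s (x - y) * (n y)\<^sup>2 = (\<Sum>c\<in>Basis. \<Sum>e\<in>Basis. M c y * M e y * K c e (x - y))" for y
    proof -
      have "(n y)\<^sup>2 = (\<Sum>c\<in>Basis. \<Sum>e\<in>Basis. (M c y * (((x - y) \<bullet> c) / s)) * (M e y * (((x - y) \<bullet> e) / s)))"
        unfolding n_def power2_eq_square sum_product ..
      then show ?thesis
        by (simp only: sum_distrib_left) (intro sum.cong refl, simp add: K_def power2_eq_square)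
    qed
    have i1: "integrable \<nu> (\<lambda>y. M c y * dheat s c (x - y))" if "c \<in> Basis" for c
      by (intro integrable_conv_point_gauss M1 that gauss_dom_dheat s)
    have i2: "integrable \<nu> (\<lambda>y. M c y * M e y * K c e (x - y))" if "c \<in> Basis" "e \<in> Basis" for c e
      by (intro integrable_conv_point_gauss MM that K)
    have "(\<integral>y. heat s (x - y) * n y \<partial>\<nu>)\<^sup>2 \<le> (\<integral>y. heat s (x - y) \<partial>\<nu>) * (\<integral>y. heat s (x - y) * (n y)\<^sup>2 \<partial>\<nu>)"
    proof (rule weighted_Cauchy_Schwarz[OF heat_nonneg integrable_conv1_point[OF g]])
      show "integrable \<nu> (\<lambda>y. heat s (x - y) * n y)" unfolding gn using i1 by simp
      show "integrable \<nu> (\<lambda>y. heat s (x - y) * (n y)\<^sup>2)" unfolding gn2 using i2 by simp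
    qed
    also have "(\<integral>y. heat s (x - y) * n y \<partial>\<nu>) = V x"
      unfolding gn V_def conv_def using i1 by simp
    also have "(\<integral>y. heat s (x - y) * (n y)\<^sup>2 \<partial>\<nu>) = W x"
      unfolding gn2 W_def conv_def using i2 by simp
    also have "(\<integral>y. heat s (x - y) \<partial>\<nu>) = flow s x" by (simp add: flow_def conv_def)
    finally show ?thesis using flow_pos[OF s, of x] by (simp add: divide_simps mult.commute)
  qed
  have [measurable]: "V \<in> borel_measurable borel"
    unfolding V_def using M(1) by measurable
  have V0: "0 \<le> (V x)\<^sup>2 / flow s x" for x using flow_pos[OF s, of x] by simp
  show i: "integrable lborel (\<lambda>x. (V x)\<^sup>2 / flow s x)"
  proof (rule Bochner_Integration.integrable_bound[OF W])
    show "AE x in lborel. norm ((V x)\<^sup>2 / flow s x) \<le> norm (W x)"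
      unfolding real_norm_def abs_of_nonneg[OF V0] by (intro AE_I2 order_trans[OF VW abs_ge_self])
  qed measurable
  have Kint: "(\<integral>u. K c e u \<partial>lborel) = (c \<bullet> e) / s" for c e
    using heat_moment2[OF s, of c e] s by (simp add: K_def mult.assoc power2_eq_square)
  have "(\<integral>x. (V x)\<^sup>2 / flow s x \<partial>lborel) \<le> (\<integral>x. W x \<partial>lborel)"
    by (rule integral_mono[OF i W VW])
  also have "\<dots> = (\<Sum>c\<in>Basis. \<Sum>e\<in>Basis. (\<integral>y. M c y * M e y \<partial>\<nu>) * ((c \<bullet> e) / s))"
    unfolding W_def
    using MM K by (simp add: integrable_conv gauss_dom_integrable integral_conv Kint)
  also have "\<dots> = (\<Sum>c\<in>Basis. (\<integral>y. (M c y)\<^sup>2 \<partial>\<nu>) / s)"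
  proof (intro sum.cong refl)
    fix c :: 'a assume c: "c \<in> Basis"
    have "(\<Sum>e\<in>Basis. (\<integral>y. M c y * M e y \<partial>\<nu>) * ((c \<bullet> e) / s)) =
        (\<Sum>e\<in>Basis. if c = e then (\<integral>y. M c y * M e y \<partial>\<nu>) / s else 0)"
      by (intro sum.cong refl) (auto simp: inner_Basis c)
    then show "(\<Sum>e\<in>Basis. (\<integral>y. M c y * M e y \<partial>\<nu>) * ((c \<bullet> e) / s)) = (\<integral>y. (M c y)\<^sup>2 \<partial>\<nu>) / s"
      using c by (simp add: power2_eq_square)
  qed
  finally show "(\<integral>x. (V x)\<^sup>2 / flow s x \<partial>lborel) \<le> (\<Sum>c\<in>Basis. \<integral>y. (M c y)\<^sup>2 \<partial>\<nu>) / s"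
    by (simp add: sum_divide_distrib)
qed

text \<open>The hypothesis \<open>stein\<close> is the Stein identity for the test function
  \<open>heat s (x - y)\<close> of \<open>y\<close>. It identifies the part of the divergence of
  \<open>V\<close> that comes from \<tau> with that of the convolution of \<open>y d\<nu>\<close>;
  the identity matrix contributes the Laplacian of \<open>flow s\<close>, and the sum is the
  divergence of \<open>U\<close>.\<close>

lemma rel_fisher_le_stein:
  assumes s: "0 < s"
    and \<tau>: "\<And>b c. b \<in> Basis \<Longrightarrow> c \<in> Basis \<Longrightarrow> \<tau> b c \<in> borel_measurable borel"
    and M: "\<And>b c. b \<in> Basis \<Longrightarrow> c \<in> Basis \<Longrightarrow> integrable \<nu> (\<lambda>y. (\<tau> b c y - b \<bullet> c)\<^sup>2)"
    and stein: "\<And>x. - (\<Sum>b\<in>Basis. conv (\<lambda>y. y \<bullet> b) (dheat s b) x) = (\<Sum>b\<in>Basis. \<Sum>c\<in>Basis. conv (\<tau> b c) (ddheat s c b) x)"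
  shows "rel_fisher s \<le> (\<Sum>b\<in>Basis. \<Sum>c\<in>Basis. \<integral>y. (\<tau> b c y - b \<bullet> c)\<^sup>2 \<partial>\<nu>) / s"
proof -
  define M where "M b c y = \<tau> b c y - b \<bullet> c" for b c y
  have Mm: "M b c \<in> borel_measurable borel" if "b \<in> Basis" "c \<in> Basis" for b c
    unfolding M_def[abs_def] using \<tau>[OF that] by measurable
  have M2: "integrable \<nu> (\<lambda>y. (M b c y)\<^sup>2)" if "b \<in> Basis" "c \<in> Basis" for b c
    unfolding M_def using M[OF that] .
  have M1: "integrable \<nu> (M b c)" if "b \<in> Basis" "c \<in> Basis" for b c
  proof (rule square_integrable_imp_integrable[OF _ M2[OF that]])
    show "M b c \<in> borel_measurable \<nu>" using Mm[OF that] by measurable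
  qed
  have \<tau>1: "integrable \<nu> (\<tau> b c)" if "b \<in> Basis" "c \<in> Basis" for b c
    using Bochner_Integration.integrable_add[OF M1[OF that], of "\<lambda>_. b \<bullet> c"] by (simp add: M_def)
  define V where "V b x = (\<Sum>c\<in>Basis. - conv (M b c) (dheat s c) x)" for b x
  define dV where "dV b x = (\<Sum>c\<in>Basis. - conv (M b c) (ddheat s c b) x)" for b x
  have cvM: "conv (M b c) (ddheat s c b) x = conv (\<tau> b c) (ddheat s c b) x - (b \<bullet> c) * conv1 (ddheat s c b) x"
    if "b \<in> Basis" "c \<in> Basis" for b c x
    using integrable_conv_point_gauss[OF \<tau>1[OF that] gauss_dom_ddheat[OF s], of c b x]
      integrable_conv1_point[OF gauss_dom_ddheat[OF s], of c b x]
    by (simp add: conv_def M_def left_diff_distrib)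
  have "rel_fisher s \<le> (\<Sum>b\<in>Basis. \<integral>x. (V b x)\<^sup>2 / flow s x \<partial>lborel)"
  proof (rule rel_fisher_le_of_divergence[OF s, where dV = dV])
    fix b :: 'a assume b: "b \<in> Basis"
    have neg: "has_dderiv (\<lambda>x. - f x) b (\<lambda>x. - f' x)" if "has_dderiv f b f'" for f f'
      using has_dderiv_cmult[OF that, of "-1"] by simp
    show "has_dderiv (V b) b (dV b)"
      unfolding V_def[abs_def] dV_def[abs_def]
      by (intro has_dderiv_sum neg has_dderiv_conv M1[OF b] has_dderiv_dheat gauss_dom_dheat gauss_dom_ddheat s)
    show "integrable lborel (V b)" "integrable lborel (dV b)"
      unfolding V_def[abs_def] dV_def[abs_def]
      by (auto intro!: Bochner_Integration.integrable_sum Bochner_Integration.integrable_minus integrable_conv M1[OF b]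
          gauss_dom_integrable[OF gauss_dom_dheat[OF s]] gauss_dom_integrable[OF gauss_dom_ddheat[OF s]])
    show "integrable lborel (\<lambda>x. (V b x)\<^sup>2 / flow s x)"
      unfolding V_def by (intro stein_field_square(1) s Mm M2 b)
  next
    fix x
    have "(\<Sum>b\<in>Basis. dV b x) = - (\<Sum>b\<in>Basis. \<Sum>c\<in>Basis. conv (M b c) (ddheat s c b) x)"
      by (simp add: dV_def sum_negf)
    also have "(\<Sum>b\<in>Basis. \<Sum>c\<in>Basis. conv (M b c) (ddheat s c b) x) =
        (\<Sum>b\<in>Basis. \<Sum>c\<in>Basis. conv (\<tau> b c) (ddheat s c b) x) - (\<Sum>b\<in>Basis. \<Sum>c\<in>Basis. (b \<bullet> c) * conv1 (ddheat s c b) x)"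
      by (simp add: cvM sum_subtractf)
    also have "(\<Sum>b\<in>(Basis::'a set). \<Sum>c\<in>Basis. (b \<bullet> c) * conv1 (ddheat s c b) x) = (\<Sum>b\<in>Basis. conv1 (ddheat s b b) x)"
    proof (intro sum.cong refl)
      fix b :: 'a assume b: "b \<in> Basis"
      have "(\<Sum>c\<in>Basis. (b \<bullet> c) * conv1 (ddheat s c b) x) = (\<Sum>c\<in>Basis. if b = c then conv1 (ddheat s c b) x else 0)"
        by (intro sum.cong refl) (auto simp: inner_Basis b)
      then show "(\<Sum>c\<in>Basis. (b \<bullet> c) * conv1 (ddheat s c b) x) = conv1 (ddheat s b b) x" using b by simp
    qed
    finally show "(\<Sum>b\<in>Basis. conv (\<lambda>y. y \<bullet> b) (dheat s b) x + conv1 (ddheat s b b) x) = (\<Sum>b\<in>Basis. dV b x)"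
      using stein[of x] by (simp add: sum.distrib)
  qed
  also have "\<dots> \<le> (\<Sum>b\<in>Basis. (\<Sum>c\<in>Basis. \<integral>y. (M b c y)\<^sup>2 \<partial>\<nu>) / s)"
    unfolding V_def by (intro sum_mono stein_field_square(2) s Mm M2)
  finally show ?thesis by (simp add: M_def sum_divide_distrib)
qed

section \<open>Relative entropy as the integral of a nonnegative function\<close>

lemma ln_heat:
  assumes "0 < s"
  shows "ln (heat s (x::'a)) = - (real DIM('a) / 2) * ln (2 * pi * s) - (norm x)\<^sup>2 / (2 * s)"
  unfolding heat_def using assms by (subst ln_mult) (auto simp: ln_powr)

text \<open>With \<open>t = f\<^sub>s / q\<^sub>s\<close> the integrand is
  \<open>q\<^sub>s (t ln t - t + 1)\<close>. The correction \<open>- t + 1\<close> integrates to 0,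
  both densities having mass 1, and makes the integrand nonnegative, as Fatou's lemma
  requires.\<close>

lemma
  assumes s: "0 < s"
  defines "G \<equiv> \<lambda>x. heat (1 + s) x * (flow s x / heat (1 + s) x * ln (flow s x / heat (1 + s) x) - flow s x / heat (1 + s) x + 1)"
  shows integrable_rel_entropy: "integrable lborel G" and integral_rel_entropy: "(\<integral>x. G x \<partial>lborel) = rel_entropy s"
proof -
  have s1: "0 < 1 + s" using s by simp
  define k where "k = real DIM('a) / 2 * ln (2 * pi * (1 + s))"
  have eq: "G x = flow s x * ln (flow s x) + k * flow s x + (1 / (2 * (1 + s))) * ((norm x)\<^sup>2 * flow s x) - flow s x + heat (1 + s) x" for x
  proof -
    have f: "0 < flow s x" "0 < heat (1 + s) x" using flow_pos[OF s] heat_pos[OF s1] by auto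
    have "G x = flow s x * (ln (flow s x) - ln (heat (1 + s) x)) - flow s x + heat (1 + s) x"
      unfolding G_def using f by (simp add: ln_div field_simps)
    then show ?thesis
      by (simp add: ln_heat[OF s1] k_def algebra_simps)
  qed
  note i = integrable_flow_ln_flow[OF s] integrable_flow[OF s] integrable_norm_square_flow[OF s] integrable_heat[OF s1, where 'a='a]
  show "integrable lborel G"
    unfolding eq[abs_def] using i
    by (intro Bochner_Integration.integrable_add Bochner_Integration.integrable_diff integrable_mult_right)
  have comb: "(\<integral>x. A x + p * B x + q * C x - B x + D x \<partial>lborel) =
      (\<integral>x. A x \<partial>lborel) + p * (\<integral>x. B x \<partial>lborel) + q * (\<integral>x. C x \<partial>lborel) - (\<integral>x. B x \<partial>lborel) + (\<integral>x. D x \<partial>lborel)"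
    if "integrable lborel A" "integrable lborel B" "integrable lborel C" "integrable lborel D"
    for A B C D :: "'a \<Rightarrow> real" and p q
    using that by simp
  show "(\<integral>x. G x \<partial>lborel) = rel_entropy s"
    unfolding eq[abs_def] comb[OF i] integral_flow[OF s] integral_norm_square_flow[OF s] integral_heat[OF s1]
    by (simp add: rel_entropy_def neg_entropy_def k_def)
qed

end

section \<open>The limit as \<open>s\<close> tends to 0\<close>

lemma heat_tail_tendsto:
  assumes "0 < \<delta>"
  shows "((\<lambda>s. (2 * pi * s) powr (- real d / 2) * exp (- \<delta>\<^sup>2 / (2 * s))) \<longlongrightarrow> 0) (at_right 0)"
  using assms by real_asymp

context smooth_density
begin

text \<open>No bound on the density \<open>p\<close> is available, only continuity at
  \<open>x\<close> and mass 1. Near \<open>x\<close> continuity is used. Far from \<open>x\<close>,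
  \<open>p y\<close> is multiplied by at most \<open>T s\<close>, the size of the kernel at distance
  \<delta>, and the term with \<open>p x\<close> is estimated by Chebyshev's inequality with the
  second moment of \<open>heat s\<close>.\<close>

lemma flow_tendsto: "((\<lambda>s. flow s x) \<longlongrightarrow> h x * heat 1 x) (at_right 0)"
proof (rule tendstoI)
  fix e :: real assume e: "0 < e"
  define p where "p y = h y * heat 1 y" for y
  have p0: "0 \<le> p y" for y by (simp add: p_def h_nonneg heat_nonneg)
  have "continuous_on UNIV p"
    unfolding p_def heat_def by (intro continuous_intros h_cont) auto
  then have "isCont p x" by (simp add: continuous_on_eq_continuous_at)
  then obtain \<delta> where \<delta>: "0 < \<delta>" "\<And>y. dist y x < \<delta> \<Longrightarrow> dist (p y) (p x) < e / 4"
    using e unfolding continuous_at_eps_delta by (metis zero_less_divide_iff zero_less_numeral)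
  have p1: "integrable lborel p" "(\<integral>y. p y \<partial>lborel) = 1"
    using integrable_nu_iff[of "\<lambda>_. 1"] integral_nu[of "\<lambda>_. 1"] by (simp_all add: p_def[abs_def] prob_space)
  define T where "T s = (2 * pi * s) powr (- real DIM('a) / 2) * exp (- \<delta>\<^sup>2 / (2 * s))" for s
  have bound: "\<bar>flow s x - p x\<bar> \<le> e / 4 + T s + p x / \<delta>\<^sup>2 * (s * real DIM('a))" if s: "0 < s" for s
  proof -
    have g: "gauss_dom (heat s :: 'a \<Rightarrow> real)" by (rule gauss_dom_heat[OF s])
    have hx: "integrable lborel (\<lambda>y. heat s (y - x))" "(\<integral>y. heat s (y - x) \<partial>lborel) = 1"
      using integrable_translation[OF integrable_heat[OF s], of "- x"]
        integral_translation[OF integrable_heat[OF s], of "- x"] by (simp_all add: integral_heat[OF s])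
    have i2: "integrable lborel (\<lambda>u::'a. (norm u)\<^sup>2 * heat s u)"
      by (intro gauss_dom_integrable gauss_dom_square_mult g)
    have hx2: "integrable lborel (\<lambda>y. (norm (y - x))\<^sup>2 * heat s (y - x))"
        "(\<integral>y. (norm (y - x))\<^sup>2 * heat s (y - x) \<partial>lborel) = s * real DIM('a)"
      using integrable_translation[OF i2, of "- x"] integral_translation[OF i2, of "- x"]
      by (simp_all add: heat_moment_norm[OF s])
    have f: "flow s x = (\<integral>y. p y * heat s (y - x) \<partial>lborel)"
      unfolding flow_def conv_def p_def by (subst integral_nu) (auto simp: heat_minus_commute)
    have ip: "integrable lborel (\<lambda>y. p y * heat s (y - x))"
      using integrable_conv1_point[OF g, of x] integrable_nu_iff[of "\<lambda>y. heat s (x - y)"]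
      by (simp add: p_def heat_minus_commute)
    have "flow s x - p x = (\<integral>y. p y * heat s (y - x) - p x * heat s (y - x) \<partial>lborel)"
      using ip hx by (simp add: f)
    then have "\<bar>flow s x - p x\<bar> \<le> (\<integral>y. \<bar>p y * heat s (y - x) - p x * heat s (y - x)\<bar> \<partial>lborel)"
      by (simp only: integral_abs_bound)
    also have "\<dots> \<le> (\<integral>y. e / 4 * heat s (y - x) + T s * p y + p x / \<delta>\<^sup>2 * ((norm (y - x))\<^sup>2 * heat s (y - x)) \<partial>lborel)"
    proof (rule integral_mono)
      show "integrable lborel (\<lambda>y. \<bar>p y * heat s (y - x) - p x * heat s (y - x)\<bar>)"
        using ip hx by simp
      show "integrable lborel (\<lambda>y. e / 4 * heat s (y - x) + T s * p y + p x / \<delta>\<^sup>2 * ((norm (y - x))\<^sup>2 * heat s (y - x)))"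
        by (intro Bochner_Integration.integrable_add integrable_mult_right hx hx2 p1)
      fix y
      have nn: "0 \<le> T s * p y" "0 \<le> p x / \<delta>\<^sup>2 * ((norm (y - x))\<^sup>2 * heat s (y - x))" "0 \<le> e / 4 * heat s (y - x)"
        using e by (auto intro!: mult_nonneg_nonneg divide_nonneg_nonneg p0 heat_nonneg simp: T_def)
      have eq: "\<bar>p y * heat s (y - x) - p x * heat s (y - x)\<bar> = \<bar>p y - p x\<bar> * heat s (y - x)"
        using heat_nonneg[of s "y - x"] by (simp add: abs_mult flip: left_diff_distrib)
      show "\<bar>p y * heat s (y - x) - p x * heat s (y - x)\<bar> \<le>
          e / 4 * heat s (y - x) + T s * p y + p x / \<delta>\<^sup>2 * ((norm (y - x))\<^sup>2 * heat s (y - x))"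
      proof (cases "dist y x < \<delta>")
        case True
        then have "\<bar>p y - p x\<bar> * heat s (y - x) \<le> e / 4 * heat s (y - x)"
          using \<delta>(2)[OF True] heat_nonneg[of s "y - x"] by (intro mult_right_mono) (auto simp: dist_real_def)
        then show ?thesis using nn eq by linarith
      next
        case False
        then have d: "\<delta>\<^sup>2 \<le> (norm (y - x))\<^sup>2" using \<delta>(1) by (intro power_mono) (auto simp: dist_norm)
        have "heat s (y - x) \<le> T s"
          unfolding heat_def T_def using d s by (intro mult_left_mono) (auto simp: divide_right_mono)
        then have a: "p y * heat s (y - x) \<le> T s * p y"
          using mult_right_mono[of "heat s (y - x)" "T s" "p y"] p0[of y] by (simp add: mult.commute)
        have "1 \<le> (norm (y - x))\<^sup>2 / \<delta>\<^sup>2" using d \<delta>(1) by simp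
        then have "p x * heat s (y - x) * 1 \<le> p x * heat s (y - x) * ((norm (y - x))\<^sup>2 / \<delta>\<^sup>2)"
          by (intro mult_left_mono mult_nonneg_nonneg p0 heat_nonneg)
        then have b: "p x * heat s (y - x) \<le> p x / \<delta>\<^sup>2 * ((norm (y - x))\<^sup>2 * heat s (y - x))"
          by (simp add: mult_ac)
        have "0 \<le> p y * heat s (y - x)" "0 \<le> p x * heat s (y - x)"
          by (intro mult_nonneg_nonneg p0 heat_nonneg)+
        then show ?thesis using a b nn by linarith
      qed
    qed
    also have "\<dots> = e / 4 + T s + p x / \<delta>\<^sup>2 * (s * real DIM('a))"
    proof -
      have comb: "(\<integral>x. a * A x + b * B x + c * C x \<partial>lborel) = a * (\<integral>x. A x \<partial>lborel) + b * (\<integral>x. B x \<partial>lborel) + c * (\<integral>x. C x \<partial>lborel)"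
        if "integrable lborel A" "integrable lborel B" "integrable lborel C" for A B C :: "'a \<Rightarrow> real" and a b c
        using that by simp
      show ?thesis unfolding comb[OF hx(1) p1(1) hx2(1)] hx(2) hx2(2) p1(2) by simp
    qed
    finally show ?thesis .
  qed
  have "((\<lambda>s. T s + p x / \<delta>\<^sup>2 * (s * real DIM('a))) \<longlongrightarrow> 0 + p x / \<delta>\<^sup>2 * (0 * real DIM('a))) (at_right 0)"
    unfolding T_def by (intro tendsto_intros heat_tail_tendsto \<delta>)
  then have "\<forall>\<^sub>F s in at_right 0. T s + p x / \<delta>\<^sup>2 * (s * real DIM('a)) < e / 4"
    using e by (intro order_tendstoD(2)) auto
  then show "\<forall>\<^sub>F s in at_right 0. dist (flow s x) (h x * heat 1 x) < e"
    using eventually_at_right_less[of "0::real"]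
  proof eventually_elim
    case (elim s)
    then show ?case using bound[of s] e unfolding dist_real_def p_def[symmetric] by linarith
  qed
qed

text \<open>Fatou's lemma for the integrands of \<open>integral_rel_entropy\<close>, which converge
  pointwise along a sequence of times tending to 0.\<close>

lemma entropy_le:
  assumes "0 < s0" and B: "\<And>s. 0 < s \<Longrightarrow> s < s0 \<Longrightarrow> rel_entropy s \<le> B"
  shows "(\<integral>\<^sup>+x. ennreal (heat 1 x * (h x * ln (h x) - h x + 1)) \<partial>lborel) \<le> ennreal B"
proof -
  \<comment> \<open>The shift by 2 keeps already \<open>X 0\<close> strictly below
    \<open>s0\<close>.\<close>
  define X where "X n = s0 / real (n + 2)" for n
  have X: "0 < X n" "X n < s0" for n using assms(1) by (auto simp: X_def field_simps add_strict_increasing)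
  have X0: "X \<longlonglongrightarrow> 0" unfolding X_def using assms(1) by real_asymp
  define r where "r n x = flow (X n) x / heat (1 + X n) x" for n x
  define G where "G n x = heat (1 + X n) x * (r n x * ln (r n x) - r n x + 1)" for n x
  have rpos: "0 < r n x" for n x
    unfolding r_def using X(1)[of n] by (simp add: flow_pos heat_pos)
  have G0: "0 \<le> G n x" for n x
    unfolding G_def using xlnx_nonneg[of "r n x"] rpos[of n x] heat_nonneg[of "1 + X n" x] by simp
  have [measurable]: "G n \<in> borel_measurable borel" for n
    unfolding G_def[abs_def] r_def by measurable
  have lim: "(\<lambda>n. ennreal (G n x)) \<longlonglongrightarrow> ennreal (heat 1 x * (h x * ln (h x) - h x + 1))" for x
  proof -
    have "filterlim X (at_right 0) sequentially"
      unfolding filterlim_at using X0 X(1) by (simp add: less_imp_neq[symmetric])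
    then have f: "(\<lambda>n. flow (X n) x) \<longlonglongrightarrow> h x * heat 1 x"
      using filterlim_compose[OF flow_tendsto] by blast
    have q: "(\<lambda>n. heat (1 + X n) x) \<longlonglongrightarrow> heat (1 + 0) x"
      unfolding heat_def by (intro tendsto_intros X0) auto
    have "(\<lambda>n. r n x) \<longlonglongrightarrow> h x * heat 1 x / heat (1 + 0) x"
      unfolding r_def using heat_pos[of 1 x] by (intro tendsto_divide f q) auto
    then have r: "(\<lambda>n. r n x) \<longlonglongrightarrow> h x" using heat_pos[of 1 x] by simp
    have "(\<lambda>n. G n x) \<longlonglongrightarrow> heat (1 + 0) x * (h x * ln (h x) - h x + 1)"
      unfolding G_def by (intro tendsto_intros q r tendsto_xlnx h_nonneg rpos)
    then show ?thesis by simp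
  qed
  have int: "(\<integral>\<^sup>+x. ennreal (G n x) \<partial>lborel) \<le> ennreal B" for n
  proof -
    have "(\<integral>\<^sup>+x. ennreal (G n x) \<partial>lborel) = ennreal (rel_entropy (X n))"
      using integrable_rel_entropy[OF X(1)[of n]] integral_rel_entropy[OF X(1)[of n]] G0
      unfolding G_def r_def by (subst nn_integral_eq_integral) auto
    also have "\<dots> \<le> ennreal B" using B[OF X] by (rule ennreal_leI)
    finally show ?thesis .
  qed
  have "(\<integral>\<^sup>+x. ennreal (heat 1 x * (h x * ln (h x) - h x + 1)) \<partial>lborel) = (\<integral>\<^sup>+x. liminf (\<lambda>n. ennreal (G n x)) \<partial>lborel)"
    using lim_imp_Liminf[OF _ lim] by simp
  also have "\<dots> \<le> liminf (\<lambda>n. \<integral>\<^sup>+x. ennreal (G n x) \<partial>lborel)"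
    by (rule nn_integral_liminf) measurable
  also have "\<dots> \<le> liminf (\<lambda>n. ennreal B)"
    by (intro Liminf_mono always_eventually allI int)
  finally show ?thesis by (simp add: Liminf_const)
qed

end

section \<open>Smooth test functions\<close>

lemma partial_deriv_eq:
  "(f has_derivative f') (at x) \<Longrightarrow> partial_deriv i f x = f' (axis i 1)"
  unfolding partial_deriv_def by (metis frechet_derivative_at)

lemma partial_deriv_eqI:
  "(\<And>x. (f has_derivative f' x) (at x)) \<Longrightarrow> partial_deriv i f = (\<lambda>x. f' x (axis i 1))"
  by (rule ext) (rule partial_deriv_eq)

lemma C_class_continuous: "C_class k f \<Longrightarrow> continuous_on UNIV f"
proof (cases k)
  case (Suc n)
  assume "C_class k f"
  then show ?thesis
    using Suc by (intro continuous_at_imp_continuous_on ballI differentiable_imp_continuous_within) simp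
qed simp

lemma C_class_SucD: "C_class (Suc k) f \<Longrightarrow> C_class k f"
proof (induction k arbitrary: f)
  case 0
  then show ?case using C_class_continuous[OF 0] by simp
next
  case (Suc k)
  then show ?case by (subst C_class.simps) (subst (asm) C_class.simps, blast)
qed

lemma C_class_const: "C_class k (\<lambda>x::real ^ 'n::finite. c)"
proof (induction k arbitrary: c)
  case (Suc k)
  have "partial_deriv i (\<lambda>x::real ^ 'n. c) = (\<lambda>x. 0)" for i c
    by (rule partial_deriv_eqI[where f' = "\<lambda>x h. 0"]) simp
  then show ?case using Suc by simp
qed simp

lemma has_derivative_C_class:
  "C_class (Suc k) f \<Longrightarrow> (f has_derivative frechet_derivative f (at x)) (at x)"
  by (simp add: frechet_derivative_works)

lemma C_class_add: "C_class k f \<Longrightarrow> C_class k g \<Longrightarrow> C_class k (\<lambda>x. f x + g x)"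
proof (induction k arbitrary: f g)
  case (Suc k)
  have "partial_deriv i (\<lambda>x. f x + g x) = (\<lambda>x. partial_deriv i f x + partial_deriv i g x)" for i
    using has_derivative_C_class[OF Suc.prems(1)] has_derivative_C_class[OF Suc.prems(2)]
    unfolding partial_deriv_def[of i f] partial_deriv_def[of i g]
    by (intro partial_deriv_eqI has_derivative_add)
  then show ?case using Suc by simp
qed (simp add: continuous_on_add)

lemma partial_deriv_mult:
  assumes "C_class (Suc k) f" "C_class (Suc k) g"
  shows "partial_deriv i (\<lambda>x. f x * g x) = (\<lambda>x. f x * partial_deriv i g x + partial_deriv i f x * g x)"
  using has_derivative_C_class[OF assms(1)] has_derivative_C_class[OF assms(2)]
  unfolding partial_deriv_def[of i f] partial_deriv_def[of i g]
  by (intro partial_deriv_eqI has_derivative_mult)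

lemma C_class_mult: "C_class k f \<Longrightarrow> C_class k g \<Longrightarrow> C_class k (\<lambda>x. f x * g x)"
proof (induction k arbitrary: f g)
  case (Suc k)
  have fg: "C_class k f" "C_class k g" using Suc.prems by (auto dest: C_class_SucD simp del: C_class.simps)
  show ?case
    using Suc.prems by (simp add: partial_deriv_mult[OF Suc.prems] C_class_add Suc.IH fg)
qed (simp add: continuous_on_mult)

lemma partial_deriv_compose:
  assumes "\<And>x. (g has_real_derivative g' x) (at x)" "C_class (Suc k) q"
  shows "partial_deriv i (\<lambda>x. g (q x)) = (\<lambda>x. g' (q x) * partial_deriv i q x)"
  unfolding partial_deriv_def[of i q]
  using has_derivative_compose[OF has_derivative_C_class[OF assms(2)] has_field_derivative_imp_has_derivative[OF assms(1)]]
  by (intro partial_deriv_eqI) simp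

text \<open>The family \<open>G\<close> lists a function with all its derivatives, so the induction
  on \<open>k\<close>, for arbitrary \<open>n\<close>, reduces \<open>G n\<close> to a product with
  \<open>G (Suc n)\<close>.\<close>

lemma C_class_compose:
  assumes G: "\<And>n x. (G n has_real_derivative G (Suc n) x) (at x)" and q: "\<And>k. C_class k q"
  shows "C_class k (\<lambda>x. G n (q x))"
proof (induction k arbitrary: n)
  case 0
  have "continuous_on UNIV (G n)"
    using G by (meson DERIV_continuous continuous_at_imp_continuous_on)
  then have "continuous_on UNIV (G n \<circ> q)"
    using C_class_continuous[OF q[of 0]] by (intro continuous_on_compose) (auto intro: continuous_on_subset)
  then show ?case by (simp add: comp_def)
next
  case (Suc k)
  have "(\<lambda>x. G n (q x)) differentiable (at x)" for x
    using has_derivative_compose[OF has_derivative_C_class[OF q[of 1, unfolded One_nat_def]] has_field_derivative_imp_has_derivative[OF G]]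
    unfolding differentiable_def by blast
  moreover have "C_class k (partial_deriv i q)" for i using q[of "Suc k"] by simp
  ultimately show ?case
    by (simp add: partial_deriv_compose[OF G q[of "Suc 0"]] C_class_mult Suc.IH)
qed

text \<open>The test functions will be radial around \<open>x\<close>. Using the squared distance as
  radial variable avoids a singularity at \<open>x\<close>.\<close>

definition sqdist :: "real ^ 'n \<Rightarrow> real ^ 'n \<Rightarrow> real" where
  "sqdist x y = (norm (y - x))\<^sup>2"

lemma has_derivative_sqdist: "(sqdist x has_derivative (\<lambda>h. 2 * ((y - x) \<bullet> h))) (at y)"
  unfolding sqdist_def[abs_def] power2_norm_eq_inner
  by (auto intro!: derivative_eq_intros simp: inner_commute)

lemma partial_deriv_sqdist: "partial_deriv i (sqdist x) = (\<lambda>y. 2 * (y $ i - x $ i))"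
  using partial_deriv_eqI[OF has_derivative_sqdist, of i x] by (simp add: inner_axis)

lemma has_derivative_coord_diff: "((\<lambda>y. 2 * (y $ i - c)) has_derivative (\<lambda>h. 2 * (h $ i))) (at (y :: real ^ 'n))"
  by (auto intro!: derivative_eq_intros bounded_linear_imp_has_derivative bounded_linear_vec_nth
      simp del: right_diff_distrib_numeral)

lemma partial_deriv_coord_diff:
  "partial_deriv j (\<lambda>y. 2 * (y $ i - c)) = (\<lambda>y. if i = j then 2 else 0)"
  using partial_deriv_eqI[OF has_derivative_coord_diff, of j i c] by (auto simp: axis_def)

lemma C_class_coord_diff: "C_class k (\<lambda>y. 2 * (y $ i - c))"
  by (cases k) (auto simp: partial_deriv_coord_diff C_class_const simp del: right_diff_distrib_numeral
      intro!: continuous_intros differentiable_diff differentiable_const bounded_linear_imp_differentiable[OF bounded_linear_vec_nth])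

lemma C_class_sqdist: "C_class k (sqdist x)"
proof (cases k)
  case 0
  then show ?thesis by (auto simp: sqdist_def[abs_def] intro!: continuous_intros)
next
  case (Suc n)
  then show ?thesis
    using has_derivative_sqdist[of x] by (auto simp: partial_deriv_sqdist C_class_coord_diff differentiable_def
        simp del: right_diff_distrib_numeral)
qed

section \<open>Compactly supported approximations of the Gaussian profile\<close>

text \<open>The functions \<open>flat P\<close> are the derivatives of all orders of \<open>exp (- 1 / u)\<close>.\<close>

definition flat :: "real poly \<Rightarrow> real \<Rightarrow> real" where
  "flat P u = (if 0 < u then poly P (1 / u) * exp (- (1 / u)) else 0)"

text \<open>The chain rule for \<open>poly P (1 / u) * exp (- (1 / u))\<close>; the factor
  \<open>[:0, 0, 1:]\<close> is \<open>1 / u\<^sup>2\<close> as a polynomial in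
  \<open>1 / u\<close>.\<close>

definition flat_deriv :: "real poly \<Rightarrow> real poly" where
  "flat_deriv P = [:0, 0, 1:] * (P - pderiv P)"

lemma power_exp_minus_le_fact: "0 \<le> t \<Longrightarrow> t ^ k * exp (- t) \<le> fact k" for t :: real
proof -
  assume t: "0 \<le> t"
  have "sum (\<lambda>n. t ^ n /\<^sub>R fact n) {k} \<le> (\<Sum>n. t ^ n /\<^sub>R fact n)"
    using t by (intro sum_le_suminf summable_exp_generic) auto
  then have "t ^ k / fact k \<le> exp t" by (simp add: exp_def field_simps)
  then show ?thesis by (simp add: exp_minus field_simps)
qed

text \<open>The extra power makes the induction work: \<open>pCons a P\<close> with \<open>k\<close>
  leads to \<open>P\<close> with \<open>Suc k\<close>. The case \<open>k = 2\<close> is what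
  differentiability of \<open>flat P\<close> at 0 needs.\<close>

lemma poly_exp_minus_bounded: "\<exists>C. \<forall>t\<ge>0. \<bar>t ^ k * poly P t * exp (- t)\<bar> \<le> (C::real)"
proof (induction P arbitrary: k rule: pCons_induct)
  case 0
  then show ?case by (intro exI[of _ 0]) simp
next
  case (pCons a P)
  obtain C where C: "\<And>t. 0 \<le> t \<Longrightarrow> \<bar>t ^ Suc k * poly P t * exp (- t)\<bar> \<le> C"
    using pCons.IH[of "Suc k"] by blast
  have "\<bar>t ^ k * poly (pCons a P) t * exp (- t)\<bar> \<le> \<bar>a\<bar> * fact k + C" if t: "0 \<le> t" for t
  proof -
    have "t ^ k * poly (pCons a P) t * exp (- t) = a * (t ^ k * exp (- t)) + t ^ Suc k * poly P t * exp (- t)"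
      by (simp add: algebra_simps)
    also have "\<bar>\<dots>\<bar> \<le> \<bar>a * (t ^ k * exp (- t))\<bar> + \<bar>t ^ Suc k * poly P t * exp (- t)\<bar>"
      by (rule abs_triangle_ineq)
    also have "\<bar>a * (t ^ k * exp (- t))\<bar> \<le> \<bar>a\<bar> * fact k"
      using power_exp_minus_le_fact[OF t, of k] t by (simp add: abs_mult mult_left_mono)
    finally show ?thesis using C[OF t] by simp
  qed
  then show ?case by blast
qed

lemma flat_bounded: obtains C where "0 \<le> C" "\<And>u. \<bar>flat P u\<bar> \<le> C"
proof -
  obtain C where C: "\<And>t. 0 \<le> t \<Longrightarrow> \<bar>t ^ 0 * poly P t * exp (- t)\<bar> \<le> C"
    using poly_exp_minus_bounded by blast
  have "0 \<le> C" using C[of 0] by linarith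
  moreover have "\<bar>flat P u\<bar> \<le> C" for u
    using C[of "1 / u"] \<open>0 \<le> C\<close> by (simp add: flat_def)
  ultimately show ?thesis using that by blast
qed

text \<open>Only \<open>u = 0\<close> is delicate: for \<open>h > 0\<close> the difference quotient
  is \<open>h\<close> times \<open>t\<^sup>2 * poly P t * exp (- t)\<close> at
  \<open>t = 1 / h\<close>, and the latter is bounded.\<close>

lemma flat_has_derivative: "(flat P has_real_derivative flat (flat_deriv P) u) (at u)"
proof (cases "u = 0")
  case True
  obtain C where C: "\<And>t. 0 \<le> t \<Longrightarrow> \<bar>t\<^sup>2 * poly P t * exp (- t)\<bar> \<le> C"
    using poly_exp_minus_bounded by blast
  have C0: "0 \<le> C" using C[of 0] by linarith
  have bound: "norm ((flat P h - flat P 0) / (h - 0)) \<le> C * \<bar>h\<bar>" for h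
  proof (cases "0 < h")
    case True
    then have "(flat P h - flat P 0) / (h - 0) = h * ((1 / h)\<^sup>2 * poly P (1 / h) * exp (- (1 / h)))"
      by (simp add: flat_def power2_eq_square)
    then show ?thesis
      using C[of "1 / h"] True by (simp only: real_norm_def abs_mult) (simp add: mult.commute mult_left_mono)
  qed (use C0 in \<open>auto simp: flat_def not_less mult_nonneg_nonpos\<close>)
  have "((\<lambda>h. (flat P h - flat P 0) / (h - 0)) \<longlongrightarrow> 0) (at 0)"
  proof (rule tendsto_0_le[where K = 1])
    show "((\<lambda>h. C * \<bar>h\<bar>) \<longlongrightarrow> 0) (at 0)" by (auto intro!: tendsto_eq_intros)
    show "\<forall>\<^sub>F h in at 0. norm ((flat P h - flat P 0) / (h - 0)) \<le> norm (C * \<bar>h\<bar>) * 1"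
      using bound C0 by (intro always_eventually allI) (simp add: abs_mult)
  qed
  then show ?thesis using True by (simp add: has_field_derivative_iff) (simp add: flat_def)
next
  case False
  show ?thesis
  proof (cases "0 < u")
    case True
    have "((\<lambda>u. poly P (1 / u) * exp (- (1 / u))) has_real_derivative flat (flat_deriv P) u) (at u)"
      using True by (auto intro!: derivative_eq_intros DERIV_chain2[OF poly_DERIV]
          simp: flat_def flat_deriv_def field_simps power2_eq_square)
    then show ?thesis
      by (rule has_field_derivative_transform_within[where d = u])
        (use True in \<open>auto simp: flat_def dist_real_def\<close>)
  next
    case False
    with \<open>u \<noteq> 0\<close> have u: "u < 0" by simp
    have "((\<lambda>u. 0) has_real_derivative flat (flat_deriv P) u) (at u)"
      using u by (simp add: flat_def)
    then show ?thesis
      by (rule has_field_derivative_transform_within[where d = "- u"])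
        (use u in \<open>auto simp: flat_def dist_real_def\<close>)
  qed
qed

lemma sum_Basis_vec: "(\<Sum>b\<in>(Basis :: (real ^ 'n::finite) set). f b) = (\<Sum>i\<in>UNIV. f (axis i (1::real)))"
proof -
  have 1: "(Basis :: (real ^ 'n) set) = range (\<lambda>i. axis i 1)"
    by (auto simp: Basis_vec_def)
  have 2: "inj (\<lambda>i::'n. axis i (1::real))"
    by (auto simp: inj_on_def axis_eq_axis)
  show ?thesis unfolding 1 by (subst sum.reindex[OF 2]) (simp add: comp_def)
qed

text \<open>The \<open>n\<close>-th derivative of \<open>flat 1 (1 - r / real (Suc N))\<close>, a
  smooth function that vanishes for \<open>r \<ge> real (Suc N)\<close>. For large \<open>N\<close>
  it approaches the constant \<open>flat 1 1 = exp (- 1)\<close>, the origin of that factor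
  below.\<close>

definition bump :: "nat \<Rightarrow> nat \<Rightarrow> real \<Rightarrow> real" where
  "bump N n r = (- 1 / real (Suc N)) ^ n * flat ((flat_deriv ^^ n) 1) (1 - r / real (Suc N))"

text \<open>The \<open>n\<close>-th derivative of \<open>exp (- r / (2 * s))\<close>, which at the
  squared distance is the heat kernel without its normalising factor.\<close>

definition decay :: "real \<Rightarrow> nat \<Rightarrow> real \<Rightarrow> real" where
  "decay s n r = (- 1 / (2 * s)) ^ n * exp (- r / (2 * s))"

lemma bump_has_derivative: "(bump N n has_real_derivative bump N (Suc n) r) (at r)"
proof -
  have "((\<lambda>r. 1 - r / real (Suc N)) has_real_derivative - 1 / real (Suc N)) (at r)"
    by (auto intro!: derivative_eq_intros)
  from DERIV_cmult[OF DERIV_chain2[OF flat_has_derivative this], of "(- 1 / real (Suc N)) ^ n" "(flat_deriv ^^ n) 1"]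
  show ?thesis by (simp add: bump_def[abs_def] mult_ac)
qed

lemma decay_has_derivative: "(decay s n has_real_derivative decay s (Suc n) r) (at r)"
proof -
  have "((\<lambda>r. - r / (2 * s)) has_real_derivative - 1 / (2 * s)) (at r)"
    by (intro DERIV_cdivide DERIV_minus DERIV_ident)
  from DERIV_cmult[OF DERIV_chain2[OF DERIV_exp this], of "(- 1 / (2 * s)) ^ n"]
  show ?thesis by (simp add: decay_def[abs_def] mult_ac)
qed

lemma bump_tendsto: "(\<lambda>N. bump N n r) \<longlonglongrightarrow> (if n = 0 then exp (- 1) else 0)"
proof -
  have "isCont (flat ((flat_deriv ^^ n) 1)) 1"
    using flat_has_derivative DERIV_isCont by blast
  moreover have "(\<lambda>N. 1 - r / real (Suc N)) \<longlonglongrightarrow> 1" by real_asymp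
  ultimately have "(\<lambda>N. flat ((flat_deriv ^^ n) 1) (1 - r / real (Suc N))) \<longlonglongrightarrow> flat ((flat_deriv ^^ n) 1) 1"
    using isCont_tendsto_compose by blast
  moreover have "(\<lambda>N. - 1 / real (Suc N)) \<longlonglongrightarrow> 0" by real_asymp
  then have "(\<lambda>N. (- 1 / real (Suc N)) ^ n) \<longlonglongrightarrow> 0 ^ n" by (rule tendsto_power)
  ultimately have "(\<lambda>N. bump N n r) \<longlonglongrightarrow> 0 ^ n * flat ((flat_deriv ^^ n) 1) 1"
    unfolding bump_def by (intro tendsto_mult)
  then show ?thesis by (cases n) (simp_all add: flat_def)
qed

lemma bump_bounded: obtains C where "0 \<le> C" "\<And>N r. \<bar>bump N n r\<bar> \<le> C"
proof -
  obtain C where C: "0 \<le> C" "\<And>u. \<bar>flat ((flat_deriv ^^ n) 1) u\<bar> \<le> C" using flat_bounded by blast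
  have "\<bar>bump N n r\<bar> \<le> 1 * C" for N r
    unfolding bump_def abs_mult power_abs using C
    by (intro mult_mono power_le_one) (auto simp: field_simps)
  then show ?thesis using that C(1) by simp
qed

text \<open>For \<open>n \<le> 2\<close>, \<open>bump_gauss N s n\<close> is the \<open>n\<close>-th derivative of a compactly supported function of the
  squared distance \<open>r\<close> that tends to \<open>exp (- 1 - r / (2 * s))\<close> as \<open>N\<close> grows.\<close>

definition bump_gauss :: "nat \<Rightarrow> real \<Rightarrow> nat \<Rightarrow> real \<Rightarrow> real" where
  "bump_gauss N s n r = (if n = 0 then bump N 0 r * decay s 0 r
     else if n = 1 then bump N 1 r * decay s 0 r + bump N 0 r * decay s 1 r
     else bump N 2 r * decay s 0 r + 2 * (bump N 1 r * decay s 1 r) + bump N 0 r * decay s 2 r)"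

lemma bump_gauss_has_derivative:
  "(bump_gauss N s 0 has_real_derivative bump_gauss N s 1 r) (at r)" "(bump_gauss N s 1 has_real_derivative bump_gauss N s 2 r) (at r)"
proof -
  note b = bump_has_derivative[of N 0 r] bump_has_derivative[of N "Suc 0" r]
  note d = decay_has_derivative[of s 0 r] decay_has_derivative[of s "Suc 0" r]
  have t0: "bump_gauss N s 0 = (\<lambda>r. bump N 0 r * decay s 0 r)"
    and t1: "bump_gauss N s 1 = (\<lambda>r. bump N (Suc 0) r * decay s 0 r + bump N 0 r * decay s (Suc 0) r)"
    by (auto simp: bump_gauss_def)
  show "(bump_gauss N s 0 has_real_derivative bump_gauss N s 1 r) (at r)"
    unfolding t0 t1 using DERIV_mult[OF b(1) d(1)] by (simp add: mult.commute)
  show "(bump_gauss N s 1 has_real_derivative bump_gauss N s 2 r) (at r)"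
    unfolding t1 using DERIV_add[OF DERIV_mult[OF b(2) d(1)] DERIV_mult[OF b(1) d(2)]]
    by (simp add: bump_gauss_def numeral_2_eq_2 algebra_simps)
qed

lemma bump_gauss_tendsto: "n \<le> 2 \<Longrightarrow> (\<lambda>N. bump_gauss N s n r) \<longlonglongrightarrow> exp (- 1) * decay s n r"
proof -
  assume "n \<le> 2"
  then consider "n = 0" | "n = 1" | "n = 2" by linarith
  then show ?thesis
    using bump_tendsto[of 0 r] bump_tendsto[of 1 r] bump_tendsto[of 2 r]
    by cases (auto simp: bump_gauss_def intro!: tendsto_eq_intros)
qed

text \<open>Uniformity in \<open>N\<close> is what dominated convergence uses; one constant serves
  all \<open>n\<close> because \<open>bump_gauss\<close> has only three distinct branches.\<close>

lemma bump_gauss_bounded: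
  assumes s: "0 < s"
  obtains C where "0 \<le> C" "\<And>N n r. \<bar>bump_gauss N s n r\<bar> \<le> C * exp (- r / (2 * s))"
proof -
  obtain C0 where C0: "0 \<le> C0" "\<And>N r. \<bar>bump N 0 r\<bar> \<le> C0" using bump_bounded by blast
  obtain C1 where C1: "0 \<le> C1" "\<And>N r. \<bar>bump N 1 r\<bar> \<le> C1" using bump_bounded by blast
  obtain C2 where C2: "0 \<le> C2" "\<And>N r. \<bar>bump N 2 r\<bar> \<le> C2" using bump_bounded by blast
  define k where "k = 1 / (2 * s)"
  have k: "0 < k" using s by (simp add: k_def)
  define C where "C = (C2 + 2 * (C1 * k) + C0 * k\<^sup>2) + (C1 + C0 * k) + C0"
  have parts: "0 \<le> C2 + 2 * (C1 * k) + C0 * k\<^sup>2" "0 \<le> C1 + C0 * k" using C0 C1 C2 k by auto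
  have b: "\<bar>B * decay s n r\<bar> \<le> D * k ^ n * exp (- r / (2 * s))" if "\<bar>B\<bar> \<le> D" for B D n r
    using that mult_right_mono[OF that, of "k ^ n * exp (- r / (2 * s))"] k
    by (simp add: decay_def abs_mult power_abs k_def mult_ac)
  have "\<bar>bump_gauss N s n r\<bar> \<le> C * exp (- r / (2 * s))" for N n r
  proof -
    define E where "E = exp (- r / (2 * s))"
    have E: "0 \<le> E" by (simp add: E_def)
    have "\<bar>bump_gauss N s n r\<bar> \<le> C0 * E \<or> \<bar>bump_gauss N s n r\<bar> \<le> (C1 + C0 * k) * E \<or> \<bar>bump_gauss N s n r\<bar> \<le> (C2 + 2 * (C1 * k) + C0 * k\<^sup>2) * E"
    proof -
      have t2: "\<bar>p + q\<bar> \<le> P + Q" if "\<bar>p\<bar> \<le> P" "\<bar>q\<bar> \<le> Q" for p q P Q :: real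
        using that by linarith
      have t3: "\<bar>p + 2 * q + r\<bar> \<le> P + 2 * Q + R" if "\<bar>p\<bar> \<le> P" "\<bar>q\<bar> \<le> Q" "\<bar>r\<bar> \<le> R" for p q r P Q R :: real
        using that by linarith
      consider "n = 0" | "n = 1" | "n \<noteq> 0" "n \<noteq> 1" by blast
      then show ?thesis
      proof cases
        case 1
        then show ?thesis using b[OF C0(2), of N r 0 r] by (simp add: bump_gauss_def E_def)
      next
        case 2
        then show ?thesis
          using t2[OF b[OF C1(2), of N r 0 r] b[OF C0(2), of N r 1 r]]
          by (simp add: bump_gauss_def E_def distrib_right)
      next
        case 3
        then show ?thesis
          using t3[OF b[OF C2(2), of N r 0 r] b[OF C1(2), of N r 1 r] b[OF C0(2), of N r 2 r]]
          by (simp add: bump_gauss_def E_def distrib_right)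
      qed
    qed
    moreover have "C0 * E \<le> C * E" "(C1 + C0 * k) * E \<le> C * E" "(C2 + 2 * (C1 * k) + C0 * k\<^sup>2) * E \<le> C * E"
      unfolding C_def using parts C0(1) E by (auto intro!: mult_right_mono)
    ultimately show ?thesis unfolding E_def[symmetric] by linarith
  qed
  moreover have "0 \<le> C" using parts C0 by (simp add: C_def)
  ultimately show ?thesis using that by blast
qed

lemma smooth_bump_gauss: "smooth (\<lambda>y. bump_gauss N s 0 (sqdist x y))"
  unfolding smooth_def
proof
  fix k
  have "C_class k (\<lambda>y. bump N 0 (sqdist x y) * decay s 0 (sqdist x y))"
    by (rule C_class_mult[OF C_class_compose[where G = "bump N", OF bump_has_derivative C_class_sqdist]
          C_class_compose[where G = "decay s", OF decay_has_derivative C_class_sqdist]])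
  then show "C_class k (\<lambda>y. bump_gauss N s 0 (sqdist x y))" by (simp add: bump_gauss_def)
qed

lemma compact_support_bump_gauss: "compact (closure {y. bump_gauss N s 0 (sqdist x y) \<noteq> 0})"
proof -
  have "{y. bump_gauss N s 0 (sqdist x y) \<noteq> 0} \<subseteq> cball x (real (Suc N))"
  proof
    fix y assume "y \<in> {y. bump_gauss N s 0 (sqdist x y) \<noteq> 0}"
    then have "sqdist x y < real (Suc N)"
      by (auto simp: bump_gauss_def bump_def flat_def field_simps split: if_splits)
    \<comment> \<open>The crude bound by the square of \<open>real (Suc N)\<close> avoids a square
      root in the radius of the ball.\<close>
    then have "(norm (y - x))\<^sup>2 \<le> (real (Suc N))\<^sup>2"
    proof -
      assume "sqdist x y < real (Suc N)"
      also have "real (Suc N) \<le> (real (Suc N))\<^sup>2" by (simp add: power2_eq_square)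
      finally show ?thesis unfolding sqdist_def by (rule less_imp_le)
    qed
    then have "norm (y - x) \<le> real (Suc N)" by (rule power2_le_imp_le) linarith
    then show "y \<in> cball x (real (Suc N))" by (simp add: dist_norm norm_minus_commute)
  qed
  then have "bounded {y. bump_gauss N s 0 (sqdist x y) \<noteq> 0}" using bounded_cball bounded_subset by blast
  then show ?thesis by (simp add: compact_closure)
qed

lemma partial_deriv_bump_gauss:
  "partial_deriv j (\<lambda>y. bump_gauss N s 0 (sqdist x y)) = (\<lambda>y. bump_gauss N s 1 (sqdist x y) * (2 * (y $ j - x $ j)))"
  using partial_deriv_compose[OF bump_gauss_has_derivative(1) C_class_sqdist] by (simp add: partial_deriv_sqdist)

lemma partial_deriv_partial_deriv_bump_gauss:
  "partial_deriv i (partial_deriv j (\<lambda>y. bump_gauss N s 0 (sqdist x y))) y =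
    bump_gauss N s 2 (sqdist x y) * (2 * (y $ i - x $ i)) * (2 * (y $ j - x $ j)) + bump_gauss N s 1 (sqdist x y) * (if i = j then 2 else 0)"
proof -
  have "((\<lambda>y. bump_gauss N s 1 (sqdist x y) * (2 * (y $ j - x $ j))) has_derivative
      (\<lambda>h. bump_gauss N s 1 (sqdist x y) * (2 * (h $ j)) + bump_gauss N s 2 (sqdist x y) * (2 * ((y - x) \<bullet> h)) * (2 * (y $ j - x $ j)))) (at y)"
    by (intro has_derivative_mult has_derivative_coord_diff
        has_derivative_compose[OF has_derivative_sqdist has_field_derivative_imp_has_derivative[OF bump_gauss_has_derivative(2)]])
  from partial_deriv_eq[OF this, of i]
  have *: "partial_deriv i (\<lambda>y. bump_gauss N s 1 (sqdist x y) * (2 * (y $ j - x $ j))) y =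
      bump_gauss N s 1 (sqdist x y) * (2 * (axis i 1 $ j)) + bump_gauss N s 2 (sqdist x y) * (2 * ((y - x) \<bullet> axis i 1)) * (2 * (y $ j - x $ j))" .
  show ?thesis
    unfolding partial_deriv_bump_gauss * by (simp add: inner_axis) (simp add: axis_def)
qed

text \<open>The integrand \<open>y \<bullet> gradient \<phi> y\<close> for \<phi> radial around
  \<open>x\<close>, where \<open>A\<close> is the derivative of the profile in the squared distance.
  As \<open>A\<close> is a parameter, the bumps and their limit share one formula.\<close>

definition stein_lhs :: "(real \<Rightarrow> real) \<Rightarrow> real ^ 'n \<Rightarrow> real ^ 'n \<Rightarrow> real" where
  "stein_lhs A x y = (\<Sum>j\<in>UNIV. y $ j * (A (sqdist x y) * (2 * (y $ j - x $ j))))"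

text \<open>The inner product of \<open>T\<close> with the Hessian of the same radial function;
  \<open>A\<close> and \<open>B\<close> are the first two derivatives of its profile.\<close>

definition stein_rhs :: "(real \<Rightarrow> real) \<Rightarrow> (real \<Rightarrow> real) \<Rightarrow> real ^ 'n ^ 'n \<Rightarrow> real ^ 'n \<Rightarrow> real ^ 'n \<Rightarrow> real" where
  "stein_rhs A B T x y = (\<Sum>i\<in>UNIV. \<Sum>j\<in>UNIV. T $ i $ j *
     (B (sqdist x y) * (2 * (y $ i - x $ i)) * (2 * (y $ j - x $ j)) + A (sqdist x y) * (if i = j then 2 else 0)))"

lemma stein_bump_gauss:
  assumes "stein_kernel \<nu> \<tau>"
  shows "(\<integral>y. stein_lhs (bump_gauss N s 1) x y \<partial>\<nu>) = (\<integral>y. stein_rhs (bump_gauss N s 1) (bump_gauss N s 2) (\<tau> y) x y \<partial>\<nu>)"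
proof -
  let ?\<phi> = "\<lambda>y. bump_gauss N s 0 (sqdist x y)"
  have "stein_test_function ?\<phi>"
    unfolding stein_test_function_def using smooth_bump_gauss compact_support_bump_gauss by blast
  then have "(\<integral>y. y \<bullet> gradient ?\<phi> y \<partial>\<nu>) = (\<integral>y. \<tau> y \<bullet> hessian ?\<phi> y \<partial>\<nu>)"
    using assms unfolding stein_kernel_def by blast
  moreover have "y \<bullet> gradient ?\<phi> y = stein_lhs (bump_gauss N s 1) x y" for y
    unfolding gradient_def inner_vec_def partial_deriv_bump_gauss stein_lhs_def by simp
  moreover have "\<tau> y \<bullet> hessian ?\<phi> y = stein_rhs (bump_gauss N s 1) (bump_gauss N s 2) (\<tau> y) x y" for y
    unfolding hessian_def inner_vec_def stein_rhs_def by (simp add: partial_deriv_partial_deriv_bump_gauss)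
  ultimately show ?thesis by simp
qed

section \<open>The Stein identity for the heat kernel\<close>

lemma borel_measurable_decay [measurable]: "decay s k \<in> borel_measurable borel"
  unfolding decay_def[abs_def] by measurable

lemma borel_measurable_bump_gauss [measurable]: "bump_gauss N s n \<in> borel_measurable borel"
proof -
  have [measurable]: "bump N k \<in> borel_measurable borel" for k
    using bump_has_derivative by (intro borel_measurable_continuous_onI continuous_at_imp_continuous_on) (blast intro: DERIV_isCont)
  show ?thesis unfolding bump_gauss_def[abs_def] by measurable
qed

lemma borel_measurable_sqdist [measurable]: "sqdist x \<in> borel_measurable borel"
  unfolding sqdist_def[abs_def] by measurable

lemma stein_lhs_eq: "stein_lhs A x y = 2 * A (sqdist x y) * (y \<bullet> (y - x))"
  by (simp add: stein_lhs_def inner_vec_def sum_distrib_left algebra_simps)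

lemma stein_lhs_cmult: "stein_lhs (\<lambda>r. k * A r) x y = k * stein_lhs A x y"
  by (simp add: stein_lhs_eq)

lemma stein_rhs_cmult: "stein_rhs (\<lambda>r. k * A r) (\<lambda>r. k * B r) T x y = k * stein_rhs A B T x y"
  by (simp add: stein_rhs_def sum_distrib_left algebra_simps)

locale stein_measure = finite_second_moment \<nu> for \<nu> :: "(real ^ 'n::finite) measure" +
  fixes \<tau> :: "real ^ 'n \<Rightarrow> real ^ 'n ^ 'n"
  assumes stein: "stein_kernel \<nu> \<tau>"
begin

lemma integrable_kernel: "integrable \<nu> (\<lambda>y. \<tau> y $ i $ j)"
  using stein by (simp add: stein_kernel_def)

lemma kernel_measurable [measurable]: "(\<lambda>y. \<tau> y $ i $ j) \<in> borel_measurable borel"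
  using borel_measurable_integrable[OF integrable_kernel[of i j]] measurable_cong_sets[OF sets_eq refl] by blast

lemma integrable_coord: "integrable \<nu> (\<lambda>y. y $ j)"
  using integrable_inner[of "axis j 1"] by (simp add: inner_axis)

text \<open>The heat kernel lacks compact support, so the identity is obtained as a limit of
  \<open>stein_bump_gauss\<close>. The Gaussian factor absorbs all powers of \<open>y - x\<close>,
  leaving \<open>norm y\<close> and the entries of \<tau> as integrable bounds; the factor
  \<open>exp (- 1)\<close> cancels.\<close>

lemma stein_gauss_limit:
  assumes s: "0 < s"
  shows "(\<integral>y. stein_lhs (decay s 1) x y \<partial>\<nu>) = (\<integral>y. stein_rhs (decay s 1) (decay s 2) (\<tau> y) x y \<partial>\<nu>)"
proof -
  obtain C where C: "0 \<le> C" "\<And>N n r. \<bar>bump_gauss N s n r\<bar> \<le> C * exp (- r / (2 * s))" using bump_gauss_bounded[OF s] by blast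
  have "gauss_dom (\<lambda>u::real ^ 'n. exp (- (norm u)\<^sup>2 / (2 * s)))"
    by (rule gauss_domI[where c = "1 / (2 * s)" and C = 1]) (use s in auto)
  then have "gauss_dom (\<lambda>u::real ^ 'n. (1 + (norm u)\<^sup>2) * exp (- (norm u)\<^sup>2 / (2 * s)))"
    by (rule gauss_dom_poly_mult[where A = 1]) auto
  from gauss_dom_bounded[OF this]
  obtain Q where Q: "\<And>u::real ^ 'n. \<bar>(1 + (norm u)\<^sup>2) * exp (- (norm u)\<^sup>2 / (2 * s))\<bar> \<le> Q"
    by blast
  have tQ: "\<bar>bump_gauss N s n (sqdist x y)\<bar> * (1 + (norm (y - x))\<^sup>2) \<le> C * Q" for N n y
  proof -
    have "\<bar>bump_gauss N s n (sqdist x y)\<bar> * (1 + (norm (y - x))\<^sup>2) \<le>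
        (C * exp (- (norm (y - x))\<^sup>2 / (2 * s))) * (1 + (norm (y - x))\<^sup>2)"
      using C(2)[of N n "sqdist x y"] unfolding sqdist_def by (intro mult_right_mono) auto
    also have "\<dots> = C * ((1 + (norm (y - x))\<^sup>2) * exp (- (norm (y - x))\<^sup>2 / (2 * s)))" by simp
    also have "\<dots> \<le> C * Q" using Q[of "y - x"] C(1) by (intro mult_left_mono) auto
    finally show ?thesis .
  qed
  have L: "(\<lambda>N. \<integral>y. stein_lhs (bump_gauss N s 1) x y \<partial>\<nu>) \<longlonglongrightarrow> (\<integral>y. stein_lhs (\<lambda>r. exp (- 1) * decay s 1 r) x y \<partial>\<nu>)"
  proof (rule integral_dominated_convergence[where w = "\<lambda>y. 2 * (C * Q) * norm y"])
    show "integrable \<nu> (\<lambda>y. 2 * (C * Q) * norm y)" using integrable_norm by simp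
    show "AE y in \<nu>. (\<lambda>N. stein_lhs (bump_gauss N s 1) x y) \<longlonglongrightarrow> stein_lhs (\<lambda>r. exp (- 1) * decay s 1 r) x y"
      unfolding stein_lhs_eq by (intro AE_I2 tendsto_intros bump_gauss_tendsto) simp
    show "AE y in \<nu>. norm (stein_lhs (bump_gauss N s 1) x y) \<le> 2 * (C * Q) * norm y" for N
    proof (rule AE_I2)
      fix y
      have "\<bar>y \<bullet> (y - x)\<bar> \<le> norm y * norm (y - x)" by (rule Cauchy_Schwarz_ineq2)
      also have "\<dots> \<le> norm y * (1 + (norm (y - x))\<^sup>2)"
        by (rule mult_left_mono[OF norm_le_one_plus_square]) simp
      finally have "\<bar>bump_gauss N s 1 (sqdist x y)\<bar> * \<bar>y \<bullet> (y - x)\<bar> \<le> \<bar>bump_gauss N s 1 (sqdist x y)\<bar> * (norm y * (1 + (norm (y - x))\<^sup>2))"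
        by (rule mult_left_mono) simp
      also have "\<dots> = norm y * (\<bar>bump_gauss N s 1 (sqdist x y)\<bar> * (1 + (norm (y - x))\<^sup>2))" by simp
      also have "\<dots> \<le> norm y * (C * Q)" by (rule mult_left_mono[OF tQ]) simp
      finally show "norm (stein_lhs (bump_gauss N s 1) x y) \<le> 2 * (C * Q) * norm y"
        by (simp add: stein_lhs_eq abs_mult mult.commute)
    qed
  qed (simp_all add: stein_lhs_eq)
  have R: "(\<lambda>N. \<integral>y. stein_rhs (bump_gauss N s 1) (bump_gauss N s 2) (\<tau> y) x y \<partial>\<nu>) \<longlonglongrightarrow>
      (\<integral>y. stein_rhs (\<lambda>r. exp (- 1) * decay s 1 r) (\<lambda>r. exp (- 1) * decay s 2 r) (\<tau> y) x y \<partial>\<nu>)"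
  \<comment> \<open>The 6 is 4, from the two factors 2 next to \<open>bump_gauss N s 2\<close>, plus
    2 from the diagonal term.\<close>
  proof (rule integral_dominated_convergence[where w = "\<lambda>y. \<Sum>i\<in>UNIV. \<Sum>j\<in>UNIV. \<bar>\<tau> y $ i $ j\<bar> * (6 * (C * Q))"])
    show "integrable \<nu> (\<lambda>y. \<Sum>i\<in>UNIV. \<Sum>j\<in>UNIV. \<bar>\<tau> y $ i $ j\<bar> * (6 * (C * Q)))"
      using integrable_kernel by simp
    show "AE y in \<nu>. (\<lambda>N. stein_rhs (bump_gauss N s 1) (bump_gauss N s 2) (\<tau> y) x y) \<longlonglongrightarrow>
        stein_rhs (\<lambda>r. exp (- 1) * decay s 1 r) (\<lambda>r. exp (- 1) * decay s 2 r) (\<tau> y) x y"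
      unfolding stein_rhs_def by (intro AE_I2 tendsto_intros bump_gauss_tendsto) simp_all
    show "AE y in \<nu>. norm (stein_rhs (bump_gauss N s 1) (bump_gauss N s 2) (\<tau> y) x y) \<le>
        (\<Sum>i\<in>UNIV. \<Sum>j\<in>UNIV. \<bar>\<tau> y $ i $ j\<bar> * (6 * (C * Q)))" for N
    proof (rule AE_I2)
      fix y
      let ?t1 = "bump_gauss N s 1 (sqdist x y)" and ?t2 = "bump_gauss N s 2 (sqdist x y)"
      have entry: "\<bar>?t2 * (2 * (y $ i - x $ i)) * (2 * (y $ j - x $ j)) + ?t1 * (if i = j then 2 else 0)\<bar> \<le> 6 * (C * Q)" for i j
      proof -
        have "\<bar>y $ i - x $ i\<bar> * \<bar>y $ j - x $ j\<bar> \<le> norm (y - x) * norm (y - x)"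
          using component_le_norm_cart[of "y - x"] by (intro mult_mono) auto
        also have "\<dots> \<le> 1 + (norm (y - x))\<^sup>2" by (simp add: power2_eq_square)
        finally have "\<bar>?t2\<bar> * (\<bar>y $ i - x $ i\<bar> * \<bar>y $ j - x $ j\<bar>) \<le> \<bar>?t2\<bar> * (1 + (norm (y - x))\<^sup>2)"
          by (rule mult_left_mono) simp
        also have "\<dots> \<le> C * Q" by (rule tQ)
        finally have "\<bar>?t2\<bar> * (\<bar>y $ i - x $ i\<bar> * \<bar>y $ j - x $ j\<bar>) \<le> C * Q" .
        moreover have "\<bar>T * (2 * a) * (2 * b)\<bar> = 4 * (\<bar>T\<bar> * (\<bar>a\<bar> * \<bar>b\<bar>))" for T a b :: real
          by (simp add: abs_mult)
        ultimately have "\<bar>?t2 * (2 * (y $ i - x $ i)) * (2 * (y $ j - x $ j))\<bar> \<le> 4 * (C * Q)"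
          by (simp only:)
        moreover have "\<bar>?t1 * (if i = j then 2 else 0)\<bar> \<le> 2 * (C * Q)"
        proof -
          have "\<bar>?t1\<bar> * 1 \<le> \<bar>?t1\<bar> * (1 + (norm (y - x))\<^sup>2)" by (rule mult_left_mono) auto
          then have "\<bar>?t1\<bar> \<le> C * Q" using tQ[of N 1 y] by linarith
          then show ?thesis by (auto simp: abs_mult)
        qed
        ultimately show ?thesis by linarith
      qed
      have "norm (stein_rhs (bump_gauss N s 1) (bump_gauss N s 2) (\<tau> y) x y) \<le> (\<Sum>i\<in>UNIV. \<Sum>j\<in>UNIV. \<bar>\<tau> y $ i $ j *
          (?t2 * (2 * (y $ i - x $ i)) * (2 * (y $ j - x $ j)) + ?t1 * (if i = j then 2 else 0))\<bar>)"
        unfolding stein_rhs_def real_norm_def by (intro order_trans[OF sum_abs] sum_mono order_refl)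
      also have "\<dots> \<le> (\<Sum>i\<in>UNIV. \<Sum>j\<in>UNIV. \<bar>\<tau> y $ i $ j\<bar> * (6 * (C * Q)))"
        unfolding abs_mult[of "\<tau> y $ i $ j" for i j] by (intro sum_mono mult_left_mono entry) simp
      finally show "norm (stein_rhs (bump_gauss N s 1) (bump_gauss N s 2) (\<tau> y) x y) \<le> \<dots>" .
    qed
  qed (simp_all add: stein_rhs_def)
  have "(\<integral>y. stein_lhs (\<lambda>r. exp (- 1) * decay s 1 r) x y \<partial>\<nu>) =
      (\<integral>y. stein_rhs (\<lambda>r. exp (- 1) * decay s 1 r) (\<lambda>r. exp (- 1) * decay s 2 r) (\<tau> y) x y \<partial>\<nu>)"
    using L R unfolding stein_bump_gauss[OF stein] by (rule LIMSEQ_unique)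
  then show ?thesis by (simp add: stein_lhs_cmult stein_rhs_cmult)
qed

text \<open>Matrix entries as a bilinear form, indexed by vectors: this is the shape of kernel for
  which \<open>rel_fisher_le_stein\<close> is stated.\<close>

definition entry :: "real ^ 'n \<Rightarrow> real ^ 'n \<Rightarrow> real ^ 'n \<Rightarrow> real" where
  "entry b c y = b \<bullet> (\<tau> y *v c)"

lemma entry_axis: "entry (axis i 1) (axis j 1) = (\<lambda>y. \<tau> y $ i $ j)"
  by (simp add: entry_def fun_eq_iff matrix_vector_mult_basis inner_axis' column_def)

text \<open>Multiplying \<open>stein_gauss_limit\<close> by the normalising factor \<open>k\<close>
  turns the derivatives of the profile into \<open>dheat\<close> and \<open>ddheat\<close> at
  \<open>x - y\<close>; the first changes sign because the test function is differentiated in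
  \<open>y\<close>.\<close>

lemma stein_heat:
  assumes s: "0 < s"
  shows "- (\<Sum>b\<in>Basis. conv (\<lambda>y. y \<bullet> b) (dheat s b) x) = (\<Sum>b\<in>Basis. \<Sum>c\<in>Basis. conv (entry b c) (ddheat s c b) x)"
proof -
  define k where "k = (2 * pi * s) powr (- real DIM(real ^ 'n) / 2)"
  have heat: "heat s (x - y) = k * exp (- sqdist x y / (2 * s))" for y
    by (simp add: heat_def k_def sqdist_def norm_minus_commute)
  have l: "- (y $ j * dheat s (axis j 1) (x - y)) = k * (y $ j * (decay s 1 (sqdist x y) * (2 * (y $ j - x $ j))))" for y j
    using s by (simp add: dheat_def heat decay_def inner_axis field_simps)
  have r: "\<tau> y $ i $ j * ddheat s (axis j 1) (axis i 1) (x - y) = k * (\<tau> y $ i $ j * (decay s 2 (sqdist x y) * (2 * (y $ i - x $ i)) * (2 * (y $ j - x $ j))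
      + decay s 1 (sqdist x y) * (if i = j then 2 else 0)))" for y i j
  proof -
    have "axis i 1 \<bullet> axis j (1::real) = (if i = j then 1 else 0)" by (simp add: inner_axis_axis)
    then show ?thesis
      using s by (auto simp: ddheat_def heat decay_def inner_axis field_simps power2_eq_square)
  qed
  have "- (\<Sum>b\<in>Basis. conv (\<lambda>y. y \<bullet> b) (dheat s b) x) = (\<integral>y. (\<Sum>j\<in>UNIV. - (y $ j * dheat s (axis j 1) (x - y))) \<partial>\<nu>)"
    unfolding sum_Basis_vec conv_def
    using integrable_conv_point_gauss[OF integrable_coord gauss_dom_dheat[OF s]]
    by (simp add: inner_axis sum_negf)
  also have "\<dots> = k * (\<integral>y. stein_lhs (decay s 1) x y \<partial>\<nu>)"
    unfolding l stein_lhs_def by (simp flip: sum_distrib_left)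
  also have "\<dots> = k * (\<integral>y. stein_rhs (decay s 1) (decay s 2) (\<tau> y) x y \<partial>\<nu>)"
    by (simp only: stein_gauss_limit[OF s])
  also have "\<dots> = (\<integral>y. (\<Sum>i\<in>UNIV. \<Sum>j\<in>UNIV. \<tau> y $ i $ j * ddheat s (axis j 1) (axis i 1) (x - y)) \<partial>\<nu>)"
    unfolding r stein_rhs_def by (simp flip: sum_distrib_left)
  also have "\<dots> = (\<Sum>b\<in>Basis. \<Sum>c\<in>Basis. conv (entry b c) (ddheat s c b) x)"
    unfolding sum_Basis_vec conv_def entry_axis
    using integrable_conv_point_gauss[OF integrable_kernel gauss_dom_ddheat[OF s]]
    by simp
  finally show ?thesis .
qed

end

section \<open>Integrating the two Fisher information bounds in time\<close>

context finite_second_moment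
begin

lemma has_derivative_reciprocal:
  fixes I t :: real
  assumes t: "0 < t"
  shows "((\<lambda>t. I / (2 * (1 + t))) has_real_derivative - I / (2 * (1 + t)\<^sup>2)) (at t)"
proof -
  have "((\<lambda>t. I / (2 * (1 + t))) has_real_derivative
      (0 * (2 * (1 + t)) - I * 2) / ((2 * (1 + t)) * (2 * (1 + t)))) (at t)"
    using t by (auto intro!: derivative_eq_intros)
  moreover have "(0 * (2 * u) - I * 2) / ((2 * u) * (2 * u)) = - I / (2 * u\<^sup>2)" for u
    by (simp add: power2_eq_square)
  ultimately show ?thesis by (simp only:)
qed

text \<open>The right-hand side is the integral of \<open>I / (2 * (1 + t)\<^sup>2)\<close> over
  \<open>t \<ge> s\<close>. It is at most \<open>I / 2\<close>, the logarithmic Sobolev bound, and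
  vanishes for \<open>I = 0\<close>.\<close>

lemma rel_entropy_le_fisher:
  assumes I: "\<And>t. 0 < t \<Longrightarrow> rel_fisher t \<le> I" and "0 \<le> I" "0 < s"
  shows "rel_entropy s \<le> I / (2 * (1 + s))"
proof (rule rel_entropy_le_of_derivative[where E = "\<lambda>t. I / (2 * (1 + t))" and E' = "\<lambda>t. - I / (2 * (1 + t)\<^sup>2)", OF _ _ _ assms(3)])
  fix t :: real assume t: "0 < t"
  show "((\<lambda>t. I / (2 * (1 + t))) has_real_derivative - I / (2 * (1 + t)\<^sup>2)) (at t)"
    by (rule has_derivative_reciprocal[OF t])
  show "0 \<le> I / (2 * (1 + t))" using t assms(2) by simp
  show "- I / (2 * (1 + t)\<^sup>2) \<le> - rel_fisher t / (2 * (1 + t)\<^sup>2)"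
    using I[OF t] by (intro divide_right_mono) auto
qed

lemma rel_entropy_diff_le:
  assumes I: "\<And>t. 0 < t \<Longrightarrow> rel_fisher t \<le> I" and s: "0 < s" "s \<le> t"
  shows "rel_entropy s - I / (2 * (1 + s)) \<le> rel_entropy t - I / (2 * (1 + t))"
proof (rule DERIV_nonneg_imp_nondecreasing[OF s(2)])
  fix u assume "s \<le> u" "u \<le> t"
  then have u: "0 < u" using s by simp
  note has_derivative_reciprocal[OF u, of I]
  from DERIV_diff[OF rel_entropy_has_derivative[OF u] this]
  show "\<exists>y. ((\<lambda>t. rel_entropy t - I / (2 * (1 + t))) has_real_derivative y) (at u) \<and> 0 \<le> y"
    using I[OF u] by (intro exI conjI) (assumption, simp add: divide_right_mono)
qed

text \<open>The right-hand side is the integral of \<open>S / (2 * t * (1 + t)\<^sup>2)\<close> over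
  \<open>t \<ge> s\<close>, found from the partial fractions
  \<open>1 / t - 1 / (1 + t) - 1 / (1 + t)\<^sup>2\<close>.\<close>

lemma rel_entropy_le_discrepancy:
  assumes S: "\<And>t. 0 < t \<Longrightarrow> rel_fisher t \<le> S / t" and "0 \<le> S" "0 < s"
  shows "rel_entropy s \<le> S / 2 * (ln ((1 + s) / s) - 1 / (1 + s))"
proof (rule rel_entropy_le_of_derivative[where E' = "\<lambda>t. - (S / t) / (2 * (1 + t)\<^sup>2)", OF _ _ _ assms(3)])
  fix t :: real assume t: "0 < t"
  have "((\<lambda>t. S / 2 * (ln (1 + t) - ln t - inverse (1 + t))) has_real_derivative
      S / 2 * (1 / (1 + t) - 1 / t + inverse ((1 + t)\<^sup>2))) (at t)"
    using t by (auto intro!: derivative_eq_intros simp: power2_eq_square)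
  also have "S / 2 * (1 / (1 + t) - 1 / t + inverse ((1 + t)\<^sup>2)) = - (S / t) / (2 * (1 + t)\<^sup>2)"
  proof -
    have "1 / (1 + t) - 1 / t + inverse ((1 + t)\<^sup>2) = - 1 / (t * (1 + t)\<^sup>2)"
      using t by (simp add: divide_simps power2_eq_square)
    then show ?thesis by simp
  qed
  finally have "((\<lambda>t. S / 2 * (ln (1 + t) - ln t - inverse (1 + t))) has_real_derivative - (S / t) / (2 * (1 + t)\<^sup>2)) (at t)" .
  then show "((\<lambda>s. S / 2 * (ln ((1 + s) / s) - 1 / (1 + s))) has_real_derivative - (S / t) / (2 * (1 + t)\<^sup>2)) (at t)"
    by (rule has_field_derivative_transform_within[where d = t])
      (use t in \<open>auto simp: dist_real_def ln_div inverse_eq_divide\<close>)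
  have "ln (t / (1 + t)) \<le> t / (1 + t) - 1" using t by (intro ln_le_minus_one) auto
  also have "t / (1 + t) - 1 = - 1 / (1 + t)" using t by (simp add: field_simps)
  finally have "1 / (1 + t) \<le> ln ((1 + t) / t)" using t by (simp add: ln_div)
  then show "0 \<le> S / 2 * (ln ((1 + t) / t) - 1 / (1 + t))" using assms(2) by simp
  show "- (S / t) / (2 * (1 + t)\<^sup>2) \<le> - rel_fisher t / (2 * (1 + t)\<^sup>2)"
    using S[OF t] by (intro divide_right_mono) auto
qed

text \<open>Beyond \<open>t = S / I\<close>, the Stein bound on the Fisher information is the better one.\<close>

lemma rel_entropy_le_HSI:
  assumes I: "\<And>t. 0 < t \<Longrightarrow> rel_fisher t \<le> I" "0 < I" and S: "\<And>t. 0 < t \<Longrightarrow> rel_fisher t \<le> S / t" "0 < S"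
    and s: "0 < s" "s < S / I"
  shows "rel_entropy s \<le> S * ln (1 + I / S) / 2"
proof -
  define t where "t = S / I"
  have t: "0 < t" "s < t" using I(2) S(2) s by (auto simp: t_def)
  have "rel_entropy s \<le> I / (2 * (1 + s)) - I / (2 * (1 + t)) + rel_entropy t"
    using rel_entropy_diff_le[OF I(1) s(1), of t] t by simp
  also have "I / (2 * (1 + s)) \<le> I / 2" using I(2) s by (simp add: field_simps)
  also have "rel_entropy t \<le> S / 2 * (ln ((1 + t) / t) - 1 / (1 + t))"
    by (rule rel_entropy_le_discrepancy[OF S(1) _ t(1)]) (use S(2) in auto)
  also have "I / 2 - I / (2 * (1 + t)) + S / 2 * (ln ((1 + t) / t) - 1 / (1 + t)) = S * ln (1 + I / S) / 2"
  proof -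
    have "(1 + t) / t = 1 + I / S" using I(2) S(2) by (simp add: t_def field_simps)
    moreover have "1 / (1 + t) = I / (I + S)" using I(2) S(2) by (simp add: t_def field_simps)
    moreover have "I / (2 * (1 + t)) = I / 2 * (1 / (1 + t))" by simp
    \<comment> \<open>At \<open>t = S / I\<close> the value \<open>x = 1 / (1 + t)\<close> satisfies
      \<open>(I + S) * x = I\<close>, so all rational terms cancel and only the logarithm
      remains.\<close>
    moreover have "I / 2 - I / 2 * x + S / 2 * (L - x) = (I - (I + S) * x) / 2 + S * L / 2" for L x
      by (simp add: field_simps)
    from this[of "I / (I + S)"] have "I / 2 - I / 2 * (I / (I + S)) + S / 2 * (L - I / (I + S)) = S * L / 2" for L
      using I(2) S(2) by simp
    ultimately show ?thesis by (simp only:)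
  qed
  finally show ?thesis by simp
qed

end

section \<open>The HSI inequality\<close>

text \<open>Passes from a finite \<open>ennreal\<close> integral of a squared norm, as in the
  definitions of discrepancy and Fisher information, to integrable components.\<close>

lemma
  fixes f :: "'i \<Rightarrow> 'a \<Rightarrow> real"
  assumes fin: "finite I" and f: "\<And>i. i \<in> I \<Longrightarrow> f i \<in> borel_measurable M"
    and bound: "(\<integral>\<^sup>+y. ennreal (\<Sum>i\<in>I. (f i y)\<^sup>2) \<partial>M) < \<infinity>"
  shows integrable_of_sum_squares: "i \<in> I \<Longrightarrow> integrable M (\<lambda>y. (f i y)\<^sup>2)"
    and sum_integral_squares: "(\<Sum>i\<in>I. \<integral>y. (f i y)\<^sup>2 \<partial>M) = enn2real (\<integral>\<^sup>+y. ennreal (\<Sum>i\<in>I. (f i y)\<^sup>2) \<partial>M)"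
proof -
  note [measurable] = f
  have m: "(\<lambda>y. \<Sum>i\<in>I. (f i y)\<^sup>2) \<in> borel_measurable M" by measurable
  have int: "integrable M (\<lambda>y. \<Sum>i\<in>I. (f i y)\<^sup>2)"
    using bound m by (intro integrableI_nonneg) (auto simp: sum_nonneg)
  show i: "integrable M (\<lambda>y. (f i y)\<^sup>2)" if "i \<in> I" for i
  proof (rule Bochner_Integration.integrable_bound[OF int])
    show "AE y in M. norm ((f i y)\<^sup>2) \<le> norm (\<Sum>i\<in>I. (f i y)\<^sup>2)"
      using fin that by (intro AE_I2) (auto simp: sum_nonneg intro: member_le_sum)
  qed (use f[OF that] in measurable)
  have "(\<Sum>i\<in>I. \<integral>y. (f i y)\<^sup>2 \<partial>M) = (\<integral>y. (\<Sum>i\<in>I. (f i y)\<^sup>2) \<partial>M)"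
    using i by simp
  also have "\<dots> = enn2real (\<integral>\<^sup>+y. ennreal (\<Sum>i\<in>I. (f i y)\<^sup>2) \<partial>M)"
    using m by (intro integral_eq_nn_integral) (auto simp: sum_nonneg)
  finally show "(\<Sum>i\<in>I. \<integral>y. (f i y)\<^sup>2 \<partial>M) = enn2real (\<integral>\<^sup>+y. ennreal (\<Sum>i\<in>I. (f i y)\<^sup>2) \<partial>M)" .
qed

section \<open>From the definitions of the theorem to the locales\<close>

lemma gaussian_eq: "(gaussian :: (real ^ 'n::finite) measure) = density lborel (\<lambda>x. ennreal (heat 1 x))"
  by (simp add: gaussian_def heat_def)

lemma nn_integral_gaussian:
  assumes [measurable]: "f \<in> borel_measurable borel"
  shows "(\<integral>\<^sup>+x. f x \<partial>(gaussian :: (real ^ 'n::finite) measure)) = (\<integral>\<^sup>+x. ennreal (heat 1 x) * f x \<partial>lborel)"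
  unfolding gaussian_eq by (subst nn_integral_density) auto

lemma sets_gaussian [measurable_cong]: "sets (gaussian :: (real ^ 'n::finite) measure) = sets borel"
  by (simp add: gaussian_eq)

lemma prob_space_gaussian: "prob_space (gaussian :: (real ^ 'n::finite) measure)"
  by (rule prob_spaceI) (simp add: gaussian_eq emeasure_density nn_integral_heat)

text \<open>For the admissible test function \<open>y $ i * y $ i\<close> the integrand
  \<open>y \<bullet> gradient \<phi> y\<close> is \<open>2 * (y $ i)\<^sup>2\<close>, and its
  integrability is part of the Stein identity.\<close>

lemma stein_kernel_integrable_norm_square:
  assumes "stein_kernel \<nu> \<tau>"
  shows "integrable \<nu> (\<lambda>y. (norm (y :: real ^ 'n::finite))\<^sup>2)"
proof -
  have "integrable \<nu> (\<lambda>y. (y $ i)\<^sup>2)" for i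
  proof -
    let ?\<phi> = "\<lambda>y::real ^ 'n. y $ i * y $ i"
    have "stein_test_function ?\<phi>" unfolding stein_test_function_def by blast
    then have int: "integrable \<nu> (\<lambda>y. y \<bullet> gradient ?\<phi> y)"
      using assms unfolding stein_kernel_def by blast
    have "(?\<phi> has_derivative (\<lambda>h. y $ i * h $ i + h $ i * y $ i)) (at y)" for y
      by (intro has_derivative_mult bounded_linear_imp_has_derivative bounded_linear_vec_nth)
    from partial_deriv_eq[OF this] have pd: "partial_deriv j ?\<phi> y = (if j = i then 2 * y $ i else 0)" for j y
      by (simp add: axis_def)
    have "y \<bullet> gradient ?\<phi> y = 2 * (y $ i)\<^sup>2" for y
      unfolding gradient_def inner_vec_def pd
      by (simp add: power2_eq_square if_distrib cong: if_cong)
    then show ?thesis using int by simp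
  qed
  then show ?thesis
    by (simp add: power2_norm_eq_inner inner_vec_def flip: power2_eq_square)
qed

text \<open>The correction \<open>- h + 1\<close> has \<gamma>-integral 0. Finiteness of the
  corrected integral makes \<open>h ln h\<close> integrable, so the difference of its two parts is
  an ordinary integral.\<close>

lemma relative_entropy_le:
  fixes h :: "real ^ 'n::finite \<Rightarrow> real"
  assumes [measurable]: "h \<in> borel_measurable borel" and h: "\<And>x. 0 \<le> h x"
    and prob: "prob_space (density gaussian (\<lambda>x. ennreal (h x)))"
    and B: "0 \<le> B" "(\<integral>\<^sup>+x. ennreal (heat 1 x * (h x * ln (h x) - h x + 1)) \<partial>lborel) \<le> ennreal B"
  shows "relative_entropy h \<le> ereal B"
proof -
  interpret G: prob_space "gaussian :: (real ^ 'n) measure" by (rule prob_space_gaussian)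
  interpret N: prob_space "density gaussian (\<lambda>x. ennreal (h x))" by (rule prob)
  have "(\<integral>\<^sup>+x. ennreal (h x) \<partial>gaussian) = 1"
    using N.emeasure_space_1 by (simp add: emeasure_density space_density cong: nn_integral_cong)
  then have ih: "integrable gaussian h" "(\<integral>x. h x \<partial>gaussian) = 1"
    using h by (auto intro!: integrableI_nonneg simp: integral_eq_nn_integral)
  let ?p = "\<lambda>x. h x * ln (h x) - h x + 1"
  have p0: "0 \<le> ?p x" for x by (rule xlnx_nonneg[OF h])
  have nn: "(\<integral>\<^sup>+x. ennreal (?p x) \<partial>gaussian) \<le> ennreal B"
    using B(2) by (subst nn_integral_gaussian) (simp_all add: ennreal_mult[OF heat_nonneg p0])
  have ip: "integrable gaussian ?p"
    by (rule integrableI_nonneg) (use p0 nn in \<open>auto intro: le_less_trans\<close>)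
  have "ennreal (\<integral>x. ?p x \<partial>gaussian) \<le> ennreal B"
    using nn p0 by (subst (asm) nn_integral_eq_integral[OF ip]) auto
  then have ipB: "(\<integral>x. ?p x \<partial>gaussian) \<le> B" using B(1) by simp
  have eq: "(\<lambda>x. h x * ln (h x)) = (\<lambda>x. ?p x + h x - 1)" by auto
  have iu: "integrable gaussian (\<lambda>x. h x * ln (h x))"
    unfolding eq by (intro Bochner_Integration.integrable_diff Bochner_Integration.integrable_add ip ih G.integrable_const)
  have "(\<integral>x. h x * ln (h x) \<partial>gaussian) = (\<integral>x. ?p x \<partial>gaussian) + 1 - 1"
  proof -
    have "(\<integral>x. f x + g x - 1 \<partial>gaussian) = (\<integral>x. f x \<partial>gaussian) + (\<integral>x. g x \<partial>gaussian) - 1"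
      if "integrable gaussian f" "integrable gaussian g" for f g :: "real ^ 'n \<Rightarrow> real"
      using that by (simp add: G.prob_space)
    from this[OF ip ih(1)] show ?thesis unfolding eq ih(2) .
  qed
  with ipB have le: "(\<integral>x. h x * ln (h x) \<partial>gaussian) \<le> B" by simp
  let ?a = "\<integral>\<^sup>+x. ennreal (h x * ln (h x)) \<partial>gaussian" and ?b = "\<integral>\<^sup>+x. ennreal (- (h x * ln (h x))) \<partial>gaussian"
  have fin: "?a \<noteq> \<infinity>" "?b \<noteq> \<infinity>" using iu unfolding real_integrable_def by auto
  have "relative_entropy h = ereal (enn2real ?a) - ereal (enn2real ?b)"
    unfolding relative_entropy_def using fin by (cases ?a; cases ?b) auto
  also have "\<dots> = ereal (\<integral>x. h x * ln (h x) \<partial>gaussian)"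
    by (simp add: real_lebesgue_integral_def[OF iu])
  finally show ?thesis using le by simp
qed

lemma smooth_density_of_smooth:
  fixes h :: "real ^ 'n::finite \<Rightarrow> real"
  assumes "finite_second_moment \<nu>" "smooth h" and h: "\<And>x. 0 \<le> h x"
    and \<nu>: "\<nu> = density gaussian (\<lambda>x. ennreal (h x))"
  shows "smooth_density \<nu> h (\<lambda>b x. frechet_derivative h (at x) b)"
proof -
  have C: "C_class k h" for k using assms(2) by (simp add: smooth_def)
  have D: "(h has_derivative frechet_derivative h (at x)) (at x)" for x
    by (rule has_derivative_C_class[OF C])
  have cont: "continuous_on UNIV h" by (rule C_class_continuous[OF C[of 0]])
  have [measurable]: "h \<in> borel_measurable borel" by (rule borel_measurable_continuous_onI[OF cont])
  have dd: "has_dderiv h b (\<lambda>x. frechet_derivative h (at x) b)" for b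
    unfolding has_dderiv_def
  proof
    fix x
    have "((\<lambda>t. x + t *\<^sub>R b) has_derivative (\<lambda>t. t *\<^sub>R b)) (at 0)"
      by (auto intro!: derivative_eq_intros)
    moreover have "(h has_derivative frechet_derivative h (at x)) (at (x + 0 *\<^sub>R b))" using D by simp
    ultimately have "((\<lambda>t. h (x + t *\<^sub>R b)) has_derivative (\<lambda>t. frechet_derivative h (at x) (t *\<^sub>R b))) (at 0)"
      by (rule has_derivative_compose)
    then show "((\<lambda>t. h (x + t *\<^sub>R b)) has_real_derivative frechet_derivative h (at x) b) (at 0)"
      unfolding has_field_derivative_def
      using linear_scale[OF has_derivative_linear[OF D]] by (simp add: mult_commute_abs)
  qed
  interpret finite_second_moment \<nu> by fact
  show ?thesis
  proof
    show "\<nu> = density lborel (\<lambda>x. ennreal (h x * heat 1 x))"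
      unfolding \<nu> gaussian_eq
      by (subst density_density_eq) (auto simp: ennreal_mult h heat_nonneg mult.commute intro!: density_cong)
    show "0 \<le> h x" for x by (rule h)
    show "continuous_on UNIV h" by (rule cont)
    fix b :: "real ^ 'n" assume b: "b \<in> Basis"
    then obtain i where i: "b = axis i 1" by (auto simp: Basis_vec_def)
    have "C_class 0 (partial_deriv i h)" using C[of "Suc 0"] by simp
    then have "continuous_on UNIV (\<lambda>x. frechet_derivative h (at x) b)"
      by (simp add: i partial_deriv_def[abs_def])
    then show "(\<lambda>x. frechet_derivative h (at x) b) \<in> borel_measurable borel"
      by (rule borel_measurable_continuous_onI)
    show "has_dderiv h b (\<lambda>x. frechet_derivative h (at x) b)" by (rule dd)
    \<comment> \<open>A nonnegative function has a minimum at each of its zeros.\<close>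
    fix x assume "h x = 0"
    have "((\<lambda>t. h (x + t *\<^sub>R b)) has_real_derivative frechet_derivative h (at x) b) (at 0)"
      using dd unfolding has_dderiv_def by blast
    then show "frechet_derivative h (at x) b = 0"
      by (rule DERIV_local_min[where d = 1]) (auto simp: \<open>h x = 0\<close> h)
  qed
qed

theorem theorem2p2:
  fixes h :: "real ^ 'n \<Rightarrow> real"
    and \<nu> :: "(real ^ 'n) measure"
    and \<tau> :: "real ^ 'n \<Rightarrow> real ^ 'n ^ 'n"
  assumes "smooth h"
    and "\<And>x. 0 \<le> h x"
    and "\<nu> = density gaussian (\<lambda>x. ennreal (h x))"
    and "prob_space \<nu>"
    and "centered \<nu>"
    and "stein_kernel \<nu> \<tau>"
  shows "relative_entropy h \<le>
    enn2ereal (ennreal (1 / 2) *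
      log_profile ((stein_discrepancy \<nu> \<tau>)\<^sup>2) (fisher_information h))"
proof -
  interpret prob_space \<nu> by fact
  have C: "C_class k h" for k using assms(1) by (simp add: smooth_def)
  have hm [measurable]: "h \<in> borel_measurable borel"
    by (rule borel_measurable_continuous_onI[OF C_class_continuous[OF C[of 0]]])
  interpret stein_measure \<nu> \<tau>
  proof
    show "sets \<nu> = sets borel" by (simp add: assms(3) sets_gaussian)
  qed (rule stein_kernel_integrable_norm_square[OF assms(6)], rule assms(6))
  interpret smooth_density \<nu> h "\<lambda>b x. frechet_derivative h (at x) b"
    by (rule smooth_density_of_smooth[OF finite_second_moment_axioms assms(1,2,3)])
  define I where "I = fisher_information h"
  define S where "S = (\<integral>\<^sup>+x. ennreal ((norm (\<tau> x - mat 1))\<^sup>2) \<partial>\<nu>)"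
  have disc: "(stein_discrepancy \<nu> \<tau>)\<^sup>2 = S"
    unfolding stein_discrepancy_def S_def by (rule ennreal_sqrt_power2)
  \<comment> \<open>Bounds for small \<open>s\<close> suffice, since the entropy of \<nu> is reached
    as \<open>s\<close> tends to 0.\<close>
  have rel_bound: "relative_entropy h \<le> ereal B"
    if "0 \<le> B" "0 < \<delta>" "\<And>s. 0 < s \<Longrightarrow> s < \<delta> \<Longrightarrow> rel_entropy s \<le> B" for B \<delta>
    using relative_entropy_le[OF hm assms(2) _ that(1) entropy_le[OF that(2,3)]] assms(3,4) by simp
  have fisher: "rel_fisher s \<le> enn2real I" if "I < \<infinity>" "0 < s" for s
  proof -
    let ?d = "\<lambda>b y. frechet_derivative h (at y) b / h y"
    have m: "?d b \<in> borel_measurable \<nu>" if "b \<in> Basis" for b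
      using dh_measurable[OF that] by measurable
    \<comment> \<open>At zeros of \<open>h\<close> both sides are 0, the right one by division by
      0.\<close>
    have grad: "h y * (\<Sum>b\<in>Basis. (?d b y)\<^sup>2) = (norm (gradient h y))\<^sup>2 / h y" for y
    proof -
      have "(\<Sum>b\<in>Basis. (?d b y)\<^sup>2) = (norm (gradient h y))\<^sup>2 / (h y)\<^sup>2"
        unfolding power2_norm_eq_inner inner_vec_def
        by (simp add: sum_Basis_vec gradient_def partial_deriv_def power_divide sum_divide_distrib power2_eq_square)
      then show ?thesis by (simp add: power2_eq_square)
    qed
    have I_eq: "(\<integral>\<^sup>+y. ennreal (\<Sum>b\<in>Basis. (?d b y)\<^sup>2) \<partial>\<nu>) = I"
    proof -
      have [measurable]: "(\<lambda>y. \<Sum>b\<in>Basis. (?d b y)\<^sup>2) \<in> borel_measurable borel"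
        using dh_measurable by (intro borel_measurable_sum borel_measurable_power borel_measurable_divide hm) auto
      show ?thesis
        unfolding assms(3) I_def fisher_information_def
        by (subst nn_integral_density)
          (auto simp flip: ennreal_mult simp: assms(2) sum_nonneg grad measurable_cong_sets[OF sets_gaussian refl])
    qed
    then have fin: "(\<integral>\<^sup>+y. ennreal (\<Sum>b\<in>Basis. (?d b y)\<^sup>2) \<partial>\<nu>) < \<infinity>" using that(1) by simp
    have "rel_fisher s \<le> (\<Sum>b\<in>Basis. \<integral>y. (?d b y)\<^sup>2 \<partial>\<nu>)"
      by (rule rel_fisher_le_fisher[OF that(2) integrable_of_sum_squares[where f = ?d, OF finite_Basis m fin]])
    then show ?thesis
      using sum_integral_squares[where f = ?d, OF finite_Basis m fin] I_eq by simp
  qed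
  have stein: "rel_fisher s \<le> enn2real S / s" if "S < \<infinity>" "0 < s" for s
  proof -
    let ?f = "\<lambda>(i, j) y. \<tau> y $ i $ j - (if i = j then 1 else 0)"
    have m: "?f ij \<in> borel_measurable \<nu>" for ij
      by (cases ij) simp
    have "(norm (\<tau> y - mat 1))\<^sup>2 = (\<Sum>ij\<in>UNIV. (?f ij y)\<^sup>2)" for y
      unfolding power2_norm_eq_inner inner_vec_def
      by (simp add: sum.cartesian_product mat_def power2_eq_square case_prod_beta')
    then have S_eq: "S = (\<integral>\<^sup>+y. ennreal (\<Sum>ij\<in>UNIV. (?f ij y)\<^sup>2) \<partial>\<nu>)"
      by (simp add: S_def)
    have fin: "(\<integral>\<^sup>+y. ennreal (\<Sum>ij\<in>UNIV. (?f ij y)\<^sup>2) \<partial>\<nu>) < \<infinity>" using that(1) S_eq by simp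
    have int: "integrable \<nu> (\<lambda>y. (?f ij y)\<^sup>2)" for ij
      by (rule integrable_of_sum_squares[OF finite m fin]) simp
    have "rel_fisher s \<le> (\<Sum>b\<in>Basis. \<Sum>c\<in>Basis. \<integral>y. (entry b c y - b \<bullet> c)\<^sup>2 \<partial>\<nu>) / s"
    proof (rule rel_fisher_le_stein[OF that(2) _ _ stein_heat[OF that(2)]])
      fix b c :: "real ^ 'n" assume "b \<in> Basis" "c \<in> Basis"
      then obtain i j where ij: "b = axis i 1" "c = axis j 1" by (auto simp: Basis_vec_def)
      show "entry b c \<in> borel_measurable borel" unfolding ij entry_axis by measurable
      show "integrable \<nu> (\<lambda>y. (entry b c y - b \<bullet> c)\<^sup>2)" using int[of "(i, j)"] by (cases "i = j") (simp_all add: ij entry_axis inner_axis_axis)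
    qed
    moreover have ax: "axis i 1 \<bullet> axis j (1::real) = (if i = j then 1 else 0)" for i j :: 'n
      by (simp add: inner_axis_axis)
    have "(\<Sum>b\<in>Basis. \<Sum>c\<in>Basis. \<integral>y. (entry b c y - b \<bullet> c)\<^sup>2 \<partial>\<nu>) = (\<Sum>ij\<in>UNIV. \<integral>y. (?f ij y)\<^sup>2 \<partial>\<nu>)"
      unfolding sum_Basis_vec
      by (simp add: entry_axis ax sum.cartesian_product case_prod_beta')
    moreover have "(\<Sum>ij\<in>UNIV. \<integral>y. (?f ij y)\<^sup>2 \<partial>\<nu>) = enn2real S"
      unfolding S_eq by (rule sum_integral_squares[OF finite m fin])
    ultimately show ?thesis by simp
  qed
  consider "S = 0" | "S = \<infinity>" | "0 < S" "S < \<infinity>" "I = \<infinity>" | "0 < S" "S < \<infinity>" "I < \<infinity>"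
    by (metis infinity_ennreal_def not_gr_zero top.not_eq_extremum)
  then show ?thesis
  proof cases
    \<comment> \<open>The Stein bound makes \<open>rel_fisher\<close> vanish at all times, and with
      it the entropy; the profile is 0 by convention.\<close>
    case 1
    then have "rel_fisher t \<le> 0" if "0 < t" for t using stein[OF _ that] by simp
    then have "relative_entropy h \<le> ereal 0"
      using rel_entropy_le_fisher[of 0] by (intro rel_bound[of _ 1]) auto
    then show ?thesis by (simp add: disc 1 log_profile_def zero_ereal_def zero_ennreal.rep_eq)
  next
    \<comment> \<open>The profile is \<open>I\<close> by convention, so the claim is the logarithmic
      Sobolev inequality.\<close>
    case 2
    show ?thesis
    proof (cases "I = \<infinity>")
      case True
      then show ?thesis by (simp add: disc 2 log_profile_def I_def[symmetric] ennreal_mult_top)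
    next
      case False
      define i where "i = enn2real I"
      have i: "0 \<le> i" "I = ennreal i" using False by (auto simp: i_def top.not_eq_extremum)
      have f: "rel_fisher t \<le> i" if "0 < t" for t
        using fisher[OF _ that] False by (simp add: i_def top.not_eq_extremum)
      have "rel_entropy s \<le> i / 2" if "0 < s" for s
      proof -
        have "i / (2 * (1 + s)) \<le> i / 2" using i(1) that by (simp add: field_simps)
        with rel_entropy_le_fisher[OF f i(1) that] show ?thesis by (rule order_trans)
      qed
      then have "relative_entropy h \<le> ereal (i / 2)"
        using i(1) by (intro rel_bound[of _ 1]) auto
      also have "\<dots> = enn2ereal (ennreal (1 / 2) * I)"
      proof -
        have "ennreal (1 / 2) * I = ennreal (i / 2)"
          unfolding i(2) using i(1) by (subst ennreal_mult[symmetric]) auto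
        then show ?thesis using i(1) by (simp add: enn2ereal_ennreal)
      qed
      finally show ?thesis by (simp add: disc 2 log_profile_def I_def)
    qed
  next
    \<comment> \<open>The right-hand side is infinite.\<close>
    case 3
    then have "S \<noteq> 0" "S \<noteq> \<infinity>" by auto
    then show ?thesis using 3 by (simp add: disc log_profile_def I_def[symmetric] ennreal_mult_top)
  next
    case 4
    define i \<sigma> where "i = enn2real I" and "\<sigma> = enn2real S"
    have i: "0 \<le> i" "I = ennreal i" using 4 by (auto simp: i_def)
    have \<sigma>: "0 < \<sigma>" "S = ennreal \<sigma>" using 4 by (auto simp: \<sigma>_def enn2real_positive_iff)
    have f: "rel_fisher t \<le> i" if "0 < t" for t
      using fisher[OF 4(3) that] by (simp add: i_def)
    have st: "rel_fisher t \<le> \<sigma> / t" if "0 < t" for t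
      using stein[OF 4(2) that] by (simp add: \<sigma>_def)
    have "relative_entropy h \<le> ereal (\<sigma> * ln (1 + i / \<sigma>) / 2)"
    \<comment> \<open>For \<open>i = 0\<close> there is no crossing time:
      \<open>\<sigma> / i\<close> would be 0. Both sides are then bounded by, respectively equal to,
      0 through the Fisher bound alone.\<close>
    proof (cases "i = 0")
      case True
      then show ?thesis
        using rel_entropy_le_fisher[OF f i(1)] by (intro rel_bound[of _ 1]) auto
    next
      case False
      with i have i0: "0 < i" by simp
      have "rel_entropy s \<le> \<sigma> * ln (1 + i / \<sigma>) / 2" if "0 < s" "s < \<sigma> / i" for s
        by (rule rel_entropy_le_HSI[OF f i0 st \<sigma>(1) that])
      then show ?thesis using i0 \<sigma>(1) by (intro rel_bound[of _ "\<sigma> / i"]) auto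
    qed
    also have "\<dots> = enn2ereal (ennreal (1 / 2) * log_profile S I)"
    proof -
      have nn: "0 \<le> \<sigma> * ln (1 + i / \<sigma>)" using i \<sigma>(1) by simp
      have "log_profile S I = ennreal (\<sigma> * ln (1 + i / \<sigma>))"
        using 4 by (auto simp: log_profile_def i_def \<sigma>_def)
      then have "ennreal (1 / 2) * log_profile S I = ennreal (\<sigma> * ln (1 + i / \<sigma>) / 2)"
        using nn by (simp only:) (subst ennreal_mult[symmetric], auto)
      then show ?thesis using nn by (simp add: enn2ereal_ennreal)
    qed
    finally show ?thesis by (simp add: disc I_def)
  qed
qed

end
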